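(* Let $k$ be a field and let $A$, $B$ be finite dimensional $k$-algebras without semisimple direct summands. Let $\alpha:\underline{\mathrm{mod}}\,A\to\underline{\mathrm{mod}}\,B$ be a stable equivalence such that $\alpha$ and its quasi-inverse preserve perfect exact sequences. Then $\alpha$ induces an isomorphism $G_0^{\mathcal{P}}(A)\xrightarrow{\sim}G_0^{\mathcal{P}}(B)$.
   Context: Modules are finitely generated right modules; $\mathrm{mod}\,A$, $\mathrm{proj}\,A$ denote the categories of finitely generated and of projective right $A$-modules; $\underline{\mathrm{mod}}\,A$ is the stable module category (morphisms modulo those factoring through projectives). A stable equivalence is an equivalence $\underline{\mathrm{mod}}\,A\to\underline{\mathrm{mod}}\,B$; for a module $X$, $\alpha(X)$ is represented by a $B$-module without non-zero projective direct summands. Write $(-)^*=\mathrm{Hom}_A(-,A)$. A short exact sequence $0\to X\to Y\to Z\to 0$ in $\mathrm{mod}\,A$ is perfect exact if the induced sequence $0\to Z^*\to Y^*\to X^*\to 0$ is exact. Let $\eta:0\to X\to Y\oplus P\to Z\to 0$ be a perfect exact sequence in $\mathrm{mod}\,A$ without split summands (no non-zero split short exact sequence is a direct summand of it) such that $P$ is projective and $Y$ has no projective direct summand. A stable equivalence $\alpha$ preserves $\eta$ if there exists a perfect exact sequence $0\to\alpha(X)\to\alpha(Y)\oplus\tilde P\to\alpha(Z)\to 0$ in $\mathrm{mod}\,B$ with $\tilde P\in\mathrm{proj}\,B$; $\alpha$ preserves perfect exact sequences if it preserves every such $\eta$. $G_0^{\mathcal{P}}(A)$ is the quotient $L/R'$,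 where $L$ is the free abelian group on the isomorphism classes of objects in $\mathrm{mod}\,A$ without (non-zero) projective direct summands, and $R'$ is the subgroup generated by the elements $[X]-[Y]+[Z]$ where $0\to X\to Y\oplus P\to Z\to 0$ is a perfect exact sequence with $P\in\mathrm{proj}\,A$ (and $X,Y,Z$ such modules). "Induces" means that the isomorphism is given by $[X]\mapsto[\alpha(X)]$. *)

theory Defs
  imports "HOL-Algebra.Ideal" "HOL-Algebra.Module" "HOL-Algebra.Free_Abelian_Groups"
begin

section \<open>Finite dimensional algebras\<close>

locale fd_algebra = K?: field K + A?: ring A + module K A
  for K :: "('k, 'i) ring_scheme" (structure) and A :: "('k, 'a, 'j) module_scheme" (structure) +
  assumes smult_mult_l: "\<lbrakk>c \<in> carrier K; x \<in> carrier A; y \<in> carrier A\<rbrakk>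
      \<Longrightarrow> c \<odot>\<^bsub>A\<^esub> (x \<otimes>\<^bsub>A\<^esub> y) = (c \<odot>\<^bsub>A\<^esub> x) \<otimes>\<^bsub>A\<^esub> y"
    and smult_mult_r: "\<lbrakk>c \<in> carrier K; x \<in> carrier A; y \<in> carrier A\<rbrakk>
      \<Longrightarrow> c \<odot>\<^bsub>A\<^esub> (x \<otimes>\<^bsub>A\<^esub> y) = x \<otimes>\<^bsub>A\<^esub> (c \<odot>\<^bsub>A\<^esub> y)"
    and finite_dim: "\<exists>S. finite S \<and> S \<subseteq> carrier A \<and>
      (\<forall>x\<in>carrier A. \<exists>c\<in>S \<rightarrow> carrier K. x = (\<Oplus>\<^bsub>A\<^esub>s\<in>S. c s \<odot>\<^bsub>A\<^esub> s))"


section \<open>Right modules\<close>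

text \<open>The multiplication and the unit inherited from \<open>ring\<close> carry no information, as for the
  record \<open>module\<close> of the library.\<close>

record ('a, 'm) rmodule = "'m ring" +
  rsmult :: "['m, 'a] \<Rightarrow> 'm" (infixl \<open>\<star>\<index>\<close> 70)

locale right_module = A?: ring A + M?: abelian_group M
  for A :: "('a, 'r) ring_scheme" (structure) and M :: "('a, 'm, 'j) rmodule_scheme" (structure) +
  assumes rsmult_closed: "\<lbrakk>x \<in> carrier M; a \<in> carrier A\<rbrakk> \<Longrightarrow> x \<star>\<^bsub>M\<^esub> a \<in> carrier M"
    and rsmult_add_l: "\<lbrakk>x \<in> carrier M; y \<in> carrier M; a \<in> carrier A\<rbrakk>
      \<Longrightarrow> (x \<oplus>\<^bsub>M\<^esub> y) \<star>\<^bsub>M\<^esub> a = x \<star>\<^bsub>M\<^esub> a \<oplus>\<^bsub>M\<^esub> y \<star>\<^bsub>M\<^esub> a"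
    and rsmult_add_r: "\<lbrakk>x \<in> carrier M; a \<in> carrier A; b \<in> carrier A\<rbrakk>
      \<Longrightarrow> x \<star>\<^bsub>M\<^esub> (a \<oplus>\<^bsub>A\<^esub> b) = x \<star>\<^bsub>M\<^esub> a \<oplus>\<^bsub>M\<^esub> x \<star>\<^bsub>M\<^esub> b"
    and rsmult_assoc: "\<lbrakk>x \<in> carrier M; a \<in> carrier A; b \<in> carrier A\<rbrakk>
      \<Longrightarrow> x \<star>\<^bsub>M\<^esub> (a \<otimes>\<^bsub>A\<^esub> b) = (x \<star>\<^bsub>M\<^esub> a) \<star>\<^bsub>M\<^esub> b"
    and rsmult_one: "x \<in> carrier M \<Longrightarrow> x \<star>\<^bsub>M\<^esub> \<one>\<^bsub>A\<^esub> = x"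

definition regular :: "('a, 'r) ring_scheme \<Rightarrow> ('a, 'a) rmodule" where
  "regular A = \<lparr>carrier = carrier A, monoid.mult = monoid.mult A, one = one A,
     ring.zero = ring.zero A, add = add A, rsmult = monoid.mult A\<rparr>"

definition direct_sum :: "('a, 'm) rmodule \<Rightarrow> ('a, 'n) rmodule \<Rightarrow> ('a, 'm \<times> 'n) rmodule" where
  "direct_sum M N = \<lparr>carrier = carrier M \<times> carrier N, monoid.mult = undefined, one = undefined,
     ring.zero = (\<zero>\<^bsub>M\<^esub>, \<zero>\<^bsub>N\<^esub>),
     add = (\<lambda>(x, y) (x', y'). (x \<oplus>\<^bsub>M\<^esub> x', y \<oplus>\<^bsub>N\<^esub> y')),
     rsmult = (\<lambda>(x, y) a. (x \<star>\<^bsub>M\<^esub> a, y \<star>\<^bsub>N\<^esub> a))\<rparr>"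

definition rsubmodule :: "('a, 'r) ring_scheme \<Rightarrow> ('a, 'm) rmodule \<Rightarrow> 'm set \<Rightarrow> bool" where
  "rsubmodule A M U \<longleftrightarrow> subgroup U (add_monoid M) \<and> (\<forall>x\<in>U. \<forall>a\<in>carrier A. x \<star>\<^bsub>M\<^esub> a \<in> U)"

definition rspan :: "('a, 'r) ring_scheme \<Rightarrow> ('a, 'm) rmodule \<Rightarrow> 'm set \<Rightarrow> 'm set" where
  "rspan A M S = \<Inter>{U. rsubmodule A M U \<and> S \<subseteq> U}"

definition finitely_generated :: "('a, 'r) ring_scheme \<Rightarrow> ('a, 'm) rmodule \<Rightarrow> bool" where
  "finitely_generated A M \<longleftrightarrow> (\<exists>S. finite S \<and> S \<subseteq> carrier M \<and> rspan A M S = carrier M)"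

definition internal_direct_sum ::
    "('a, 'r) ring_scheme \<Rightarrow> ('a, 'm) rmodule \<Rightarrow> 'm set \<Rightarrow> 'm set \<Rightarrow> bool" where
  "internal_direct_sum A M U V \<longleftrightarrow> rsubmodule A M U \<and> rsubmodule A M V \<and>
     U \<inter> V = {\<zero>\<^bsub>M\<^esub>} \<and> U <+>\<^bsub>M\<^esub> V = carrier M"

text \<open>Homomorphisms are extensional, so that equality of homomorphisms is equality of HOL
  functions.\<close>

definition rhom :: "('a, 'r) ring_scheme \<Rightarrow> ('a, 'm) rmodule \<Rightarrow> ('a, 'n) rmodule \<Rightarrow> ('m \<Rightarrow> 'n) set"
  where
  "rhom A M N = {f \<in> carrier M \<rightarrow>\<^sub>E carrier N.
     (\<forall>x\<in>carrier M. \<forall>y\<in>carrier M. f (x \<oplus>\<^bsub>M\<^esub> y) = f x \<oplus>\<^bsub>N\<^esub> f y) \<and>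
     (\<forall>x\<in>carrier M. \<forall>a\<in>carrier A. f (x \<star>\<^bsub>M\<^esub> a) = f x \<star>\<^bsub>N\<^esub> a)}"

definition rmod_isomorphic ::
    "('a, 'r) ring_scheme \<Rightarrow> ('a, 'm) rmodule \<Rightarrow> ('a, 'n) rmodule \<Rightarrow> bool" where
  "rmod_isomorphic A M N \<longleftrightarrow> (\<exists>f\<in>rhom A M N. bij_betw f (carrier M) (carrier N))"

definition hom_group ::
    "('a, 'r) ring_scheme \<Rightarrow> ('a, 'm) rmodule \<Rightarrow> ('a, 'n) rmodule \<Rightarrow> ('m \<Rightarrow> 'n) monoid" where
  "hom_group A M N = \<lparr>carrier = rhom A M N,
     monoid.mult = (\<lambda>f g. \<lambda>x\<in>carrier M. f x \<oplus>\<^bsub>N\<^esub> g x), one = (\<lambda>x\<in>carrier M. \<zero>\<^bsub>N\<^esub>)\<rparr>"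

text \<open>Objects of \<open>mod A\<close>. To have a single HOL type of objects, carriers are sets of lists over
  the type of elements of \<open>A\<close>. Up to isomorphism this is no restriction: a finitely generated
  module is a quotient of some \<open>A\<^sup>n\<close> (lemma \<open>fg_module_in_modA\<close> below).\<close>

type_synonym 'a obj = "('a, 'a list) rmodule"
type_synonym 'a arr = "'a list \<Rightarrow> 'a list"

definition modA :: "('a, 'r) ring_scheme \<Rightarrow> 'a obj set" where
  "modA A = {M. right_module A M \<and> finitely_generated A M}"

definition projA :: "('a, 'r) ring_scheme \<Rightarrow> 'a obj set" where
  "projA A = {P \<in> modA A. \<forall>M\<in>modA A. \<forall>N\<in>modA A. \<forall>g\<in>rhom A M N. \<forall>f\<in>rhom A P N.
     g ` carrier M = carrier N \<longrightarrow> (\<exists>h\<in>rhom A P M. compose (carrier P) g h = f)}"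

definition no_proj_summand :: "('a, 'r) ring_scheme \<Rightarrow> 'a obj \<Rightarrow> bool" where
  "no_proj_summand A M \<longleftrightarrow>
     (\<forall>U V. internal_direct_sum A M U V \<and> M\<lparr>carrier := U\<rparr> \<in> projA A \<longrightarrow> U = {\<zero>\<^bsub>M\<^esub>})"


section \<open>Semisimple direct summands of an algebra\<close>

definition simple_rsubmodule :: "('a, 'r) ring_scheme \<Rightarrow> ('a, 'm) rmodule \<Rightarrow> 'm set \<Rightarrow> bool" where
  "simple_rsubmodule A M S \<longleftrightarrow> rsubmodule A M S \<and> S \<noteq> {\<zero>\<^bsub>M\<^esub>} \<and>
     (\<forall>U. rsubmodule A M U \<and> U \<subseteq> S \<longrightarrow> U = {\<zero>\<^bsub>M\<^esub>} \<or> U = S)"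

text \<open>A module is semisimple if it is the sum of its simple submodules.\<close>

definition semisimple_ring :: "('a, 'r) ring_scheme \<Rightarrow> bool" where
  "semisimple_ring R \<longleftrightarrow> ring R \<and>
     rspan R (regular R) (\<Union>{S. simple_rsubmodule R (regular R) S}) = carrier R"

text \<open>A direct summand of the algebra is a two-sided ideal \<open>I\<close> with a complementary
  two-sided ideal; it is an algebra with its own unit \<open>e\<close>.\<close>

definition no_semisimple_summand :: "('a, 'r) ring_scheme \<Rightarrow> bool" where
  "no_semisimple_summand A \<longleftrightarrow> (\<forall>I J e. ideal I A \<and> ideal J A \<and>
     I \<inter> J = {\<zero>\<^bsub>A\<^esub>} \<and> I <+>\<^bsub>A\<^esub> J = carrier A \<and>
     semisimple_ring (A\<lparr>carrier := I, one := e\<rparr>) \<longrightarrow> I = {\<zero>\<^bsub>A\<^esub>})"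


section \<open>Perfect exact sequences\<close>

text \<open>The library notion \<open>short_exact_sequence\<close> needs the three groups to have the same
  element type.\<close>

definition ses :: "('x, 'i) monoid_scheme \<Rightarrow> ('y, 'j) monoid_scheme \<Rightarrow> ('z, 'l) monoid_scheme \<Rightarrow>
    ('x \<Rightarrow> 'y) \<Rightarrow> ('y \<Rightarrow> 'z) \<Rightarrow> bool" where
  "ses X Y Z f g \<longleftrightarrow> f \<in> mon X Y \<and> g \<in> epi Y Z \<and> f ` carrier X = kernel Y Z g"

definition rmod_ses :: "('a, 'r) ring_scheme \<Rightarrow>
    ('a, 'x) rmodule \<Rightarrow> ('a, 'y) rmodule \<Rightarrow> ('a, 'z) rmodule \<Rightarrow> ('x \<Rightarrow> 'y) \<Rightarrow> ('y \<Rightarrow> 'z) \<Rightarrow> bool" where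
  "rmod_ses A X Y Z f g \<longleftrightarrow> f \<in> rhom A X Y \<and> g \<in> rhom A Y Z \<and>
     ses (add_monoid X) (add_monoid Y) (add_monoid Z) f g"

definition dual :: "('a, 'r) ring_scheme \<Rightarrow> ('a, 'm) rmodule \<Rightarrow> ('m \<Rightarrow> 'a) monoid" where
  "dual A M = hom_group A M (regular A)"

definition dual_map :: "('a, 'm) rmodule \<Rightarrow> ('m \<Rightarrow> 'n) \<Rightarrow> ('n \<Rightarrow> 'a) \<Rightarrow> ('m \<Rightarrow> 'a)" where
  "dual_map M f = (\<lambda>\<phi>. compose (carrier M) \<phi> f)"

definition perfect_exact :: "('a, 'r) ring_scheme \<Rightarrow>
    ('a, 'x) rmodule \<Rightarrow> ('a, 'y) rmodule \<Rightarrow> ('a, 'z) rmodule \<Rightarrow> ('x \<Rightarrow> 'y) \<Rightarrow> ('y \<Rightarrow> 'z) \<Rightarrow> bool" where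
  "perfect_exact A X Y Z f g \<longleftrightarrow> rmod_ses A X Y Z f g \<and>
     ses (dual A Z) (dual A Y) (dual A X) (dual_map Y g) (dual_map X f)"

definition split_ses :: "('a, 'r) ring_scheme \<Rightarrow>
    ('a, 'x) rmodule \<Rightarrow> ('a, 'y) rmodule \<Rightarrow> ('a, 'z) rmodule \<Rightarrow> ('x \<Rightarrow> 'y) \<Rightarrow> ('y \<Rightarrow> 'z) \<Rightarrow> bool" where
  "split_ses A X Y Z f g \<longleftrightarrow> rmod_ses A X Y Z f g \<and>
     (\<exists>s\<in>rhom A Z Y. compose (carrier Z) g s = (\<lambda>z\<in>carrier Z. z))"

text \<open>A direct summand of a sequence is given by decompositions of its three terms that are
  respected by both maps.\<close>

definition no_split_summand :: "('a, 'r) ring_scheme \<Rightarrow>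
    ('a, 'x) rmodule \<Rightarrow> ('a, 'y) rmodule \<Rightarrow> ('a, 'z) rmodule \<Rightarrow> ('x \<Rightarrow> 'y) \<Rightarrow> ('y \<Rightarrow> 'z) \<Rightarrow> bool" where
  "no_split_summand A X Y Z f g \<longleftrightarrow> (\<forall>X1 X2 Y1 Y2 Z1 Z2.
     internal_direct_sum A X X1 X2 \<and> internal_direct_sum A Y Y1 Y2 \<and>
     internal_direct_sum A Z Z1 Z2 \<and>
     f ` X1 \<subseteq> Y1 \<and> f ` X2 \<subseteq> Y2 \<and> g ` Y1 \<subseteq> Z1 \<and> g ` Y2 \<subseteq> Z2 \<and>
     split_ses A (X\<lparr>carrier := X1\<rparr>) (Y\<lparr>carrier := Y1\<rparr>) (Z\<lparr>carrier := Z1\<rparr>)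
       (restrict f X1) (restrict g Y1)
     \<longrightarrow> X1 = {\<zero>\<^bsub>X\<^esub>} \<and> Y1 = {\<zero>\<^bsub>Y\<^esub>} \<and> Z1 = {\<zero>\<^bsub>Z\<^esub>})"


section \<open>Categories and equivalences\<close>

text \<open>Hom-sets need not be disjoint, so composition \<open>Comp C X Y Z g f\<close> of \<open>f : X \<rightarrow> Y\<close> and
  \<open>g : Y \<rightarrow> Z\<close> and the action of a functor on arrows take the objects as arguments.\<close>

record ('o, 'h) cat =
  Obj :: "'o set"
  Hom :: "'o \<Rightarrow> 'o \<Rightarrow> 'h set"
  Comp :: "'o \<Rightarrow> 'o \<Rightarrow> 'o \<Rightarrow> 'h \<Rightarrow> 'h \<Rightarrow> 'h"
  Ident :: "'o \<Rightarrow> 'h"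

record ('o, 'h, 'p, 'i) cat_functor =
  on_obj :: "'o \<Rightarrow> 'p"
  on_arr :: "'o \<Rightarrow> 'o \<Rightarrow> 'h \<Rightarrow> 'i"

definition is_functor :: "('o, 'h) cat \<Rightarrow> ('p, 'i) cat \<Rightarrow> ('o, 'h, 'p, 'i) cat_functor \<Rightarrow> bool" where
  "is_functor C D F \<longleftrightarrow>
     (\<forall>X\<in>Obj C. on_obj F X \<in> Obj D) \<and>
     (\<forall>X\<in>Obj C. \<forall>Y\<in>Obj C. \<forall>f\<in>Hom C X Y. on_arr F X Y f \<in> Hom D (on_obj F X) (on_obj F Y)) \<and>
     (\<forall>X\<in>Obj C. on_arr F X X (Ident C X) = Ident D (on_obj F X)) \<and>
     (\<forall>X\<in>Obj C. \<forall>Y\<in>Obj C. \<forall>Z\<in>Obj C. \<forall>f\<in>Hom C X Y. \<forall>g\<in>Hom C Y Z.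
        on_arr F X Z (Comp C X Y Z g f) =
        Comp D (on_obj F X) (on_obj F Y) (on_obj F Z) (on_arr F Y Z g) (on_arr F X Y f))"

definition id_functor :: "('o, 'h, 'o, 'h) cat_functor" where
  "id_functor = \<lparr>on_obj = (\<lambda>X. X), on_arr = (\<lambda>X Y f. f)\<rparr>"

definition comp_functor :: "('p, 'i, 'q, 'j) cat_functor \<Rightarrow> ('o, 'h, 'p, 'i) cat_functor \<Rightarrow>
    ('o, 'h, 'q, 'j) cat_functor" where
  "comp_functor G F = \<lparr>on_obj = (\<lambda>X. on_obj G (on_obj F X)),
     on_arr = (\<lambda>X Y f. on_arr G (on_obj F X) (on_obj F Y) (on_arr F X Y f))\<rparr>"

definition iso_arr :: "('o, 'h) cat \<Rightarrow> 'o \<Rightarrow> 'o \<Rightarrow> 'h \<Rightarrow> bool" where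
  "iso_arr C X Y f \<longleftrightarrow> f \<in> Hom C X Y \<and>
     (\<exists>g\<in>Hom C Y X. Comp C X Y X g f = Ident C X \<and> Comp C Y X Y f g = Ident C Y)"

definition naturally_isomorphic :: "('o, 'h) cat \<Rightarrow> ('p, 'i) cat \<Rightarrow>
    ('o, 'h, 'p, 'i) cat_functor \<Rightarrow> ('o, 'h, 'p, 'i) cat_functor \<Rightarrow> bool" where
  "naturally_isomorphic C D F G \<longleftrightarrow> (\<exists>\<tau>.
     (\<forall>X\<in>Obj C. iso_arr D (on_obj F X) (on_obj G X) (\<tau> X)) \<and>
     (\<forall>X\<in>Obj C. \<forall>Y\<in>Obj C. \<forall>f\<in>Hom C X Y.
        Comp D (on_obj F X) (on_obj F Y) (on_obj G Y) (\<tau> Y) (on_arr F X Y f) =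
        Comp D (on_obj F X) (on_obj G X) (on_obj G Y) (on_arr G X Y f) (\<tau> X)))"

definition quasi_inverse :: "('o, 'h) cat \<Rightarrow> ('p, 'i) cat \<Rightarrow>
    ('o, 'h, 'p, 'i) cat_functor \<Rightarrow> ('p, 'i, 'o, 'h) cat_functor \<Rightarrow> bool" where
  "quasi_inverse C D F G \<longleftrightarrow> is_functor C D F \<and> is_functor D C G \<and>
     naturally_isomorphic C C (comp_functor G F) id_functor \<and>
     naturally_isomorphic D D (comp_functor F G) id_functor"


section \<open>The stable module category\<close>

definition factor_proj :: "('a, 'r) ring_scheme \<Rightarrow> 'a obj \<Rightarrow> 'a obj \<Rightarrow> 'a arr set" where
  "factor_proj A M N =
     {compose (carrier M) v u | u v P. P \<in> projA A \<and> u \<in> rhom A M P \<and> v \<in> rhom A P N}"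

definition stable_class :: "('a, 'r) ring_scheme \<Rightarrow> 'a obj \<Rightarrow> 'a obj \<Rightarrow> 'a arr \<Rightarrow> 'a arr set" where
  "stable_class A M N f = factor_proj A M N #>\<^bsub>hom_group A M N\<^esub> f"

definition stable_mod :: "('a, 'r) ring_scheme \<Rightarrow> ('a obj, 'a arr set) cat" where
  "stable_mod A = \<lparr>Obj = modA A,
     Hom = (\<lambda>M N. carrier (hom_group A M N Mod factor_proj A M N)),
     Comp = (\<lambda>L M N G F. \<Union>g\<in>G. \<Union>f\<in>F. stable_class A L N (compose (carrier L) g f)),
     Ident = (\<lambda>M. stable_class A M M (\<lambda>x\<in>carrier M. x))\<rparr>"

type_synonym ('a, 'b) stable_functor = "('a obj, 'a arr set, 'b obj, 'b arr set) cat_functor"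

text \<open>The module \<open>\<alpha>(X)\<close>: a representative, in its isomorphism class in the stable category, that
  has no non-zero projective direct summand.\<close>

definition nonproj_image ::
    "('b, 's) ring_scheme \<Rightarrow> ('a, 'b) stable_functor \<Rightarrow> 'a obj \<Rightarrow> 'b obj" where
  "nonproj_image B \<alpha> X = (SOME W. W \<in> modA B \<and> no_proj_summand B W \<and>
     (\<exists>f. iso_arr (stable_mod B) W (on_obj \<alpha> X) f))"

definition preserves_perfect_exact ::
    "('a, 'r) ring_scheme \<Rightarrow> ('b, 's) ring_scheme \<Rightarrow> ('a, 'b) stable_functor \<Rightarrow> bool" where
  "preserves_perfect_exact A B \<alpha> \<longleftrightarrow> (\<forall>X Y Z P f g.
     X \<in> modA A \<and> Y \<in> modA A \<and> Z \<in> modA A \<and> P \<in> projA A \<and> no_proj_summand A Y \<and>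
     perfect_exact A X (direct_sum Y P) Z f g \<and> no_split_summand A X (direct_sum Y P) Z f g \<longrightarrow>
     (\<exists>P'\<in>projA B. \<exists>f' g'. perfect_exact B (nonproj_image B \<alpha> X)
        (direct_sum (nonproj_image B \<alpha> Y) P') (nonproj_image B \<alpha> Z) f' g'))"


section \<open>The Grothendieck group\<close>

definition nonproj_mod :: "('a, 'r) ring_scheme \<Rightarrow> 'a obj set" where
  "nonproj_mod A = {X \<in> modA A. no_proj_summand A X}"

definition iso_class :: "('a, 'r) ring_scheme \<Rightarrow> 'a obj \<Rightarrow> 'a obj set" where
  "iso_class A X = {Y \<in> modA A. rmod_isomorphic A X Y}"

definition L_group :: "('a, 'r) ring_scheme \<Rightarrow> ('a obj set \<Rightarrow>\<^sub>0 int) monoid" where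
  "L_group A = free_Abelian_group (iso_class A ` nonproj_mod A)"

definition G0P_relations :: "('a, 'r) ring_scheme \<Rightarrow> ('a obj set \<Rightarrow>\<^sub>0 int) set" where
  "G0P_relations A = generate (L_group A)
     {frag_of (iso_class A X) - frag_of (iso_class A Y) + frag_of (iso_class A Z) | X Y Z P f g.
        X \<in> nonproj_mod A \<and> Y \<in> nonproj_mod A \<and> Z \<in> nonproj_mod A \<and> P \<in> projA A \<and>
        perfect_exact A X (direct_sum Y P) Z f g}"

definition G0P :: "('a, 'r) ring_scheme \<Rightarrow> ('a obj set \<Rightarrow>\<^sub>0 int) set monoid" where
  "G0P A = L_group A Mod G0P_relations A"

definition G0P_class :: "('a, 'r) ring_scheme \<Rightarrow> 'a obj \<Rightarrow> ('a obj set \<Rightarrow>\<^sub>0 int) set" where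
  "G0P_class A X = G0P_relations A #>\<^bsub>L_group A\<^esub> frag_of (iso_class A X)"


section \<open>Every finitely generated module has a copy in \<open>modA\<close>\<close>

primrec lincomb :: "('a, 'm) rmodule \<Rightarrow> 'm list \<Rightarrow> 'a list \<Rightarrow> 'm" where
  "lincomb M [] as = \<zero>\<^bsub>M\<^esub>"
| "lincomb M (s # ss) as = s \<star>\<^bsub>M\<^esub> hd as \<oplus>\<^bsub>M\<^esub> lincomb M ss (tl as)"

context
  fixes A :: "('a, 'r) ring_scheme" and M :: "('a, 'm) rmodule"
  assumes right_module: "right_module A M"
begin

interpretation right_module A M by (rule right_module)

lemma rsmult_zero_r: "x \<in> carrier M \<Longrightarrow> x \<star>\<^bsub>M\<^esub> \<zero>\<^bsub>A\<^esub> = \<zero>\<^bsub>M\<^esub>"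
  by (metis A.add.r_one A.zero_closed M.add.r_cancel_one rsmult_add_r rsmult_closed)

lemma rsmult_zero_l: "a \<in> carrier A \<Longrightarrow> \<zero>\<^bsub>M\<^esub> \<star>\<^bsub>M\<^esub> a = \<zero>\<^bsub>M\<^esub>"
  by (metis M.add.r_one M.zero_closed M.add.r_cancel_one rsmult_add_l rsmult_closed)

lemma rsmult_minus_r:
  "\<lbrakk>x \<in> carrier M; a \<in> carrier A\<rbrakk> \<Longrightarrow> x \<star>\<^bsub>M\<^esub> (\<ominus>\<^bsub>A\<^esub> a) = \<ominus>\<^bsub>M\<^esub> (x \<star>\<^bsub>M\<^esub> a)"
  by (metis A.a_inv_closed A.l_neg M.minus_equality rsmult_add_r rsmult_closed rsmult_zero_r)

lemma lincomb_closed: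
  "\<lbrakk>set ss \<subseteq> carrier M; length as = length ss; set as \<subseteq> carrier A\<rbrakk>
    \<Longrightarrow> lincomb M ss as \<in> carrier M"
  by (induction ss arbitrary: as) (auto simp: length_Suc_conv rsmult_closed)

lemma lincomb_add:
  "\<lbrakk>set ss \<subseteq> carrier M; length as = length ss; set as \<subseteq> carrier A;
    length bs = length ss; set bs \<subseteq> carrier A\<rbrakk>
    \<Longrightarrow> lincomb M ss (map2 (\<oplus>\<^bsub>A\<^esub>) as bs) = lincomb M ss as \<oplus>\<^bsub>M\<^esub> lincomb M ss bs"
proof (induction ss arbitrary: as bs)
  case (Cons s ss)
  then obtain a as' b bs' where ab: "as = a # as'" "bs = b # bs'"
    by (auto simp: length_Suc_conv)
  have "lincomb M ss (map2 (\<oplus>\<^bsub>A\<^esub>) as' bs') = lincomb M ss as' \<oplus>\<^bsub>M\<^esub> lincomb M ss bs'"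
    using Cons ab by auto
  moreover have "lincomb M ss as' \<in> carrier M" "lincomb M ss bs' \<in> carrier M"
    "s \<star>\<^bsub>M\<^esub> a \<in> carrier M" "s \<star>\<^bsub>M\<^esub> b \<in> carrier M"
    using Cons.prems ab by (auto intro!: lincomb_closed rsmult_closed)
  ultimately show ?case
    using Cons.prems ab by (simp add: rsmult_add_r M.a_ac)
qed simp

lemma lincomb_smult:
  "\<lbrakk>set ss \<subseteq> carrier M; length as = length ss; set as \<subseteq> carrier A; c \<in> carrier A\<rbrakk>
    \<Longrightarrow> lincomb M ss as \<star>\<^bsub>M\<^esub> c = lincomb M ss (map (\<lambda>a. a \<otimes>\<^bsub>A\<^esub> c) as)"
proof (induction ss arbitrary: as)
  case Nil
  then show ?case by (simp add: rsmult_zero_l)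
next
  case (Cons s ss)
  then obtain a as' where a: "as = a # as'"
    by (auto simp: length_Suc_conv)
  then show ?case
    using Cons by (simp add: rsmult_add_l rsmult_assoc rsmult_closed lincomb_closed)
qed

lemma lincomb_zero:
  "set ss \<subseteq> carrier M \<Longrightarrow> lincomb M ss (replicate (length ss) \<zero>\<^bsub>A\<^esub>) = \<zero>\<^bsub>M\<^esub>"
  by (induction ss) (auto simp: rsmult_zero_r)

lemma lincomb_minus:
  "\<lbrakk>set ss \<subseteq> carrier M; length as = length ss; set as \<subseteq> carrier A\<rbrakk>
    \<Longrightarrow> \<ominus>\<^bsub>M\<^esub> lincomb M ss as = lincomb M ss (map (\<lambda>a. \<ominus>\<^bsub>A\<^esub> a) as)"
proof (induction ss arbitrary: as)
  case (Cons s ss)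
  then obtain a as' where a: "as = a # as'"
    by (auto simp: length_Suc_conv)
  then show ?case
    using Cons by (simp add: rsmult_minus_r M.minus_add rsmult_closed lincomb_closed)
qed simp

lemma lincomb_generator:
  "\<lbrakk>set ss \<subseteq> carrier M; s \<in> set ss\<rbrakk>
    \<Longrightarrow> \<exists>as. length as = length ss \<and> set as \<subseteq> carrier A \<and> lincomb M ss as = s"
proof (induction ss)
  case (Cons t ss)
  show ?case
  proof (cases "s = t")
    case True
    then show ?thesis
      using Cons.prems
      by (intro exI[of _ "\<one>\<^bsub>A\<^esub> # replicate (length ss) \<zero>\<^bsub>A\<^esub>"])
        (auto simp: rsmult_one lincomb_zero)
  next
    case False
    then obtain as where "length as = length ss" "set as \<subseteq> carrier A" "lincomb M ss as = s"
      using Cons by auto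
    then show ?thesis
      using Cons.prems
      by (intro exI[of _ "\<zero>\<^bsub>A\<^esub> # as"]) (auto simp: rsmult_zero_r)
  qed
qed simp

lemma rsubmodule_lincombs:
  assumes "set ss \<subseteq> carrier M"
  shows "rsubmodule A M (lincomb M ss ` {as. length as = length ss \<and> set as \<subseteq> carrier A})"
    (is "rsubmodule A M (_ ` ?L)")
proof -
  have map2L: "map2 (\<oplus>\<^bsub>A\<^esub>) as bs \<in> ?L" if "as \<in> ?L" "bs \<in> ?L" for as bs
    using that by (fastforce dest: set_zip_leftD set_zip_rightD)
  have "subgroup (lincomb M ss ` ?L) (add_monoid M)"
  proof (intro group.subgroupI)
    show "group (add_monoid M)" by (rule M.add.group_axioms)
    show "lincomb M ss ` ?L \<subseteq> carrier (add_monoid M)"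
      using assms lincomb_closed by auto
    have "replicate (length ss) \<zero>\<^bsub>A\<^esub> \<in> ?L" by auto
    then show "lincomb M ss ` ?L \<noteq> {}" by blast
  next
    fix x assume "x \<in> lincomb M ss ` ?L"
    then obtain as where as: "as \<in> ?L" "x = lincomb M ss as" by blast
    then have "\<ominus>\<^bsub>M\<^esub> x = lincomb M ss (map (\<lambda>a. \<ominus>\<^bsub>A\<^esub> a) as)"
      using lincomb_minus assms by auto
    moreover have "map (\<lambda>a. \<ominus>\<^bsub>A\<^esub> a) as \<in> ?L" using as by auto
    ultimately show "inv\<^bsub>add_monoid M\<^esub> x \<in> lincomb M ss ` ?L"
      by (auto simp: a_inv_def)
  next
    fix x y assume "x \<in> lincomb M ss ` ?L" "y \<in> lincomb M ss ` ?L"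
    then obtain as bs where ab: "as \<in> ?L" "x = lincomb M ss as" "bs \<in> ?L" "y = lincomb M ss bs"
      by blast
    then have "x \<oplus>\<^bsub>M\<^esub> y = lincomb M ss (map2 (\<oplus>\<^bsub>A\<^esub>) as bs)"
      using lincomb_add assms by auto
    then show "x \<otimes>\<^bsub>add_monoid M\<^esub> y \<in> lincomb M ss ` ?L"
      using map2L ab by auto
  qed
  moreover have "x \<star>\<^bsub>M\<^esub> c \<in> lincomb M ss ` ?L"
    if x: "x \<in> lincomb M ss ` ?L" and c: "c \<in> carrier A" for x c
  proof -
    obtain as where as: "as \<in> ?L" "x = lincomb M ss as" using x by blast
    then have "x \<star>\<^bsub>M\<^esub> c = lincomb M ss (map (\<lambda>a. a \<otimes>\<^bsub>A\<^esub> c) as)"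
      using lincomb_smult assms c by auto
    moreover have "map (\<lambda>a. a \<otimes>\<^bsub>A\<^esub> c) as \<in> ?L" using as c by auto
    ultimately show ?thesis by blast
  qed
  ultimately show ?thesis by (simp add: rsubmodule_def)
qed

lemma transport:
  fixes \<psi> :: "'m \<Rightarrow> 'n"
  assumes inj: "inj_on \<psi> (carrier M)" and fg: "finitely_generated A M"
  shows "\<exists>N :: ('a, 'n) rmodule.
    right_module A N \<and> finitely_generated A N \<and> rmod_isomorphic A M N"
proof -
  define \<theta> where "\<theta> = inv_into (carrier M) \<psi>"
  define N :: "('a, 'n) rmodule" where
    "N = \<lparr>carrier = \<psi> ` carrier M, monoid.mult = undefined, one = undefined, ring.zero = \<psi> \<zero>\<^bsub>M\<^esub>,
       add = (\<lambda>x y. \<psi> (\<theta> x \<oplus>\<^bsub>M\<^esub> \<theta> y)), rsmult = (\<lambda>x a. \<psi> (\<theta> x \<star>\<^bsub>M\<^esub> a))\<rparr>"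
  have \<theta>: "\<theta> (\<psi> x) = x" if "x \<in> carrier M" for x
    using that inj by (simp add: \<theta>_def)
  have N_simps: "carrier N = \<psi> ` carrier M" "\<zero>\<^bsub>N\<^esub> = \<psi> \<zero>\<^bsub>M\<^esub>"
    "\<And>x y. x \<oplus>\<^bsub>N\<^esub> y = \<psi> (\<theta> x \<oplus>\<^bsub>M\<^esub> \<theta> y)" "\<And>x a. x \<star>\<^bsub>N\<^esub> a = \<psi> (\<theta> x \<star>\<^bsub>M\<^esub> a)"
    by (simp_all add: N_def)
  have "abelian_group N"
  proof (rule abelian_groupI)
    fix x assume "x \<in> carrier N"
    then obtain u where u: "u \<in> carrier M" "x = \<psi> u" by (auto simp: N_simps)
    then show "\<exists>y\<in>carrier N. y \<oplus>\<^bsub>N\<^esub> x = \<zero>\<^bsub>N\<^esub>"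
      by (intro bexI[of _ "\<psi> (\<ominus>\<^bsub>M\<^esub> u)"]) (auto simp: N_simps \<theta> M.l_neg)
  qed (auto simp: N_simps \<theta> M.a_ac)
  then have N: "right_module A N"
    by (intro right_module.intro right_module_axioms.intro A.ring_axioms)
      (auto simp: N_simps \<theta> rsmult_closed rsmult_add_l rsmult_add_r rsmult_assoc rsmult_one)
  interpret N: right_module A N by (rule N)
  have "restrict \<psi> (carrier M) \<in> rhom A M N"
    by (auto simp: rhom_def N_simps \<theta> rsmult_closed)
  moreover have "bij_betw (restrict \<psi> (carrier M)) (carrier M) (carrier N)"
    using inj by (simp add: N_simps bij_betw_def)
  ultimately have iso: "rmod_isomorphic A M N"
    unfolding rmod_isomorphic_def by (intro bexI[of _ "restrict \<psi> (carrier M)"])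
  obtain S where S: "finite S" "S \<subseteq> carrier M" "rspan A M S = carrier M"
    using fg by (auto simp: finitely_generated_def)
  have whole: "V = carrier N" if V: "rsubmodule A N V" "\<psi> ` S \<subseteq> V" for V
  proof -
    have sub: "subgroup V (add_monoid N)" and sm: "\<And>x a. x \<in> V \<Longrightarrow> a \<in> carrier A \<Longrightarrow> x \<star>\<^bsub>N\<^esub> a \<in> V"
      using V by (auto simp: rsubmodule_def)
    have VN: "V \<subseteq> carrier N" using subgroup.subset[OF sub] by simp
    define U where "U = {x \<in> carrier M. \<psi> x \<in> V}"
    have "subgroup U (add_monoid M)"
    proof (intro group.subgroupI)
      show "group (add_monoid M)" by (rule M.add.group_axioms)
      show "U \<subseteq> carrier (add_monoid M)" by (auto simp: U_def)
      show "U \<noteq> {}"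
        using subgroup.one_closed[OF sub] by (auto simp: U_def N_simps)
    next
      fix x assume x: "x \<in> U"
      have "inv\<^bsub>add_monoid N\<^esub> (\<psi> x) \<in> V"
        using x subgroup.m_inv_closed[OF sub] by (auto simp: U_def)
      moreover have "\<ominus>\<^bsub>N\<^esub> (\<psi> x) = \<psi> (\<ominus>\<^bsub>M\<^esub> x)"
        using x by (intro N.minus_equality) (auto simp: U_def N_simps \<theta> M.l_neg)
      ultimately show "inv\<^bsub>add_monoid M\<^esub> x \<in> U"
        using x by (auto simp: U_def simp flip: a_inv_def)
    next
      fix x y assume xy: "x \<in> U" "y \<in> U"
      then have "\<psi> x \<oplus>\<^bsub>N\<^esub> \<psi> y \<in> V"
        using subgroup.m_closed[OF sub] by (auto simp: U_def)
      then show "x \<otimes>\<^bsub>add_monoid M\<^esub> y \<in> U"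
        using xy by (auto simp: U_def N_simps \<theta>)
    qed
    moreover have "x \<star>\<^bsub>M\<^esub> a \<in> U" if "x \<in> U" "a \<in> carrier A" for x a
      using that sm[of "\<psi> x" a] by (auto simp: U_def N_simps \<theta> rsmult_closed)
    ultimately have "rsubmodule A M U" by (simp add: rsubmodule_def)
    moreover have "S \<subseteq> U" using S V by (auto simp: U_def)
    ultimately have "carrier M \<subseteq> U" using S(3) by (auto simp: rspan_def)
    then show ?thesis using VN by (auto simp: U_def N_simps)
  qed
  have "rsubmodule A N (carrier N)"
    unfolding rsubmodule_def
    using group.subgroup_self[OF N.add.group_axioms] N.rsmult_closed by simp
  moreover have "\<psi> ` S \<subseteq> carrier N" using S by (auto simp: N_simps)
  ultimately have "{U. rsubmodule A N U \<and> \<psi> ` S \<subseteq> U} = {carrier N}"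
    using whole by blast
  then have "rspan A N (\<psi> ` S) = carrier N"
    by (simp add: rspan_def)
  then have "finitely_generated A N"
    unfolding finitely_generated_def
    using S by (intro exI[of _ "\<psi> ` S"]) (auto simp: N_simps)
  then show ?thesis using N iso by blast
qed

end

lemma fg_module_in_modA:
  fixes M :: "('a, 'm) rmodule"
  assumes "right_module A M" and "finitely_generated A M"
  shows "\<exists>N\<in>modA A. rmod_isomorphic A M N"
proof -
  note lin = rsubmodule_lincombs[OF assms(1)] lincomb_generator[OF assms(1)]
  obtain S where S: "finite S" "S \<subseteq> carrier M" "rspan A M S = carrier M"
    using assms by (auto simp: finitely_generated_def)
  obtain ss where ss: "set ss = S" using S(1) finite_list by auto
  define L where "L = {as. length as = length ss \<and> set as \<subseteq> carrier A}"
  have "rsubmodule A M (lincomb M ss ` L)"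
    unfolding L_def using S ss by (intro lin(1)) auto
  moreover have "S \<subseteq> lincomb M ss ` L"
    using lin(2)[of ss] S ss by (force simp: L_def)
  ultimately have "carrier M \<subseteq> lincomb M ss ` L"
    using S(3) by (auto simp: rspan_def)
  then have "inj_on (inv_into L (lincomb M ss)) (carrier M)"
    by (rule inj_on_inv_into)
  from transport[OF assms(1) this assms(2)] show ?thesis
    by (auto simp: modA_def)
qed

end

theory Submission
  imports Defs
begin

text \<open>A stable equivalence \<open>\<alpha>\<close> permutes the isomorphism classes of modules without projective
  summands, because such modules are determined by their stable isomorphism classes: by Fitting's
  lemma, an endomorphism of such a module that factors through a projective module is nilpotent,
  so the two composites of mutually inverse stable isomorphisms are automorphisms. It remains to
  see that \<open>\<alpha>\<close> maps relations to relations. As an equivalence, \<open>\<alpha>\<close> preserves products in the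
  stable category, hence direct sums of modules up to projective summands. For a perfect exact
  sequence without split summands the relation is the hypothesis on \<open>\<alpha>\<close>, and a split summand
  contributes only relations that come from direct sums.\<close>

section \<open>Homomorphisms and submodules\<close>

text \<open>No additivity of \<alpha> is assumed; products are the right tool because they are
  defined by composition alone. Removing a split summand leaves the setting of the hypothesis in two
  ways. The summand may cut across \<open>Y\<close> and \<open>P\<close> in the middle term, so the
  remaining middle term has to be decomposed afresh into a part without projective summands and a
  projective part; and the pieces of the sequence are compared with modules that do have projective
  summands. The class of the image is therefore defined for every module of \<open>modA\<close>. A
  projective module then has the class of the zero module, which is itself a relation, since the
  zero sequence gives [0] - [0] + [0]. All bookkeeping happens in the free groups, where the lifts
  of \<alpha> and \<beta> are already mutually inverse; quotients appear only at the very end.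
  Finite dimension enters only through finite length, which is expressed by a strictly monotone
  bounded function on submodules instead of composition series. Direct sums have pairs as elements
  while objects of \<open>modA\<close> have lists, so decompositions are handled through structure
  maps and moved along isomorphisms.\<close>

lemma right_module_ring: "right_module A M \<Longrightarrow> ring A"
  by (simp add: right_module_def)

lemma rhom_closed: "f \<in> rhom A M N \<Longrightarrow> x \<in> carrier M \<Longrightarrow> f x \<in> carrier N"
  by (auto simp: rhom_def)

lemma rhom_add:
  "f \<in> rhom A M N \<Longrightarrow> x \<in> carrier M \<Longrightarrow> y \<in> carrier M \<Longrightarrow> f (x \<oplus>\<^bsub>M\<^esub> y) = f x \<oplus>\<^bsub>N\<^esub> f y"
  by (simp add: rhom_def)

lemma rhom_smult:
  "f \<in> rhom A M N \<Longrightarrow> x \<in> carrier M \<Longrightarrow> a \<in> carrier A \<Longrightarrow> f (x \<star>\<^bsub>M\<^esub> a) = f x \<star>\<^bsub>N\<^esub> a"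
  by (simp add: rhom_def)

lemma rhom_extensional: "f \<in> rhom A M N \<Longrightarrow> f \<in> extensional (carrier M)"
  by (auto simp: rhom_def PiE_def)

lemma rhom_eqI:
  "\<lbrakk>f \<in> rhom A M N; g \<in> rhom A M N'; \<And>x. x \<in> carrier M \<Longrightarrow> f x = g x\<rbrakk> \<Longrightarrow> f = g"
  by (rule extensionalityI[of f "carrier M"]) (simp_all add: rhom_extensional)

lemma rhom_restrictI:
  assumes "right_module A M" and "\<And>x. x \<in> carrier M \<Longrightarrow> f x \<in> carrier N"
    and "\<And>x y. x \<in> carrier M \<Longrightarrow> y \<in> carrier M \<Longrightarrow> f (x \<oplus>\<^bsub>M\<^esub> y) = f x \<oplus>\<^bsub>N\<^esub> f y"
    and "\<And>x a. x \<in> carrier M \<Longrightarrow> a \<in> carrier A \<Longrightarrow> f (x \<star>\<^bsub>M\<^esub> a) = f x \<star>\<^bsub>N\<^esub> a"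
  shows "restrict f (carrier M) \<in> rhom A M N"
proof -
  interpret M: right_module A M by fact
  show ?thesis using assms(2-) by (auto simp: rhom_def M.rsmult_closed)
qed

lemma rhom_compose:
  assumes "right_module A L" and "f \<in> rhom A L M" and "g \<in> rhom A M N"
  shows "compose (carrier L) g f \<in> rhom A L N"
  unfolding compose_def using assms
  by (intro rhom_restrictI) (simp_all add: rhom_closed rhom_add rhom_smult)

lemma rhom_id: "right_module A M \<Longrightarrow> (\<lambda>x\<in>carrier M. x) \<in> rhom A M M"
  by (intro rhom_restrictI) simp_all

lemma rhom_zero:
  assumes "right_module A M" and "right_module A N" and "f \<in> rhom A M N"
  shows "f \<zero>\<^bsub>M\<^esub> = \<zero>\<^bsub>N\<^esub>"
proof -
  interpret M: right_module A M by fact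
  interpret N: right_module A N by fact
  have "f \<zero>\<^bsub>M\<^esub> \<oplus>\<^bsub>N\<^esub> f \<zero>\<^bsub>M\<^esub> = f \<zero>\<^bsub>M\<^esub>"
    using rhom_add[OF assms(3), of "\<zero>\<^bsub>M\<^esub>" "\<zero>\<^bsub>M\<^esub>"] by simp
  then show ?thesis
    using rhom_closed[OF assms(3)] by (simp add: N.add.r_cancel_one)
qed

lemma rhom_minus:
  assumes "right_module A M" and "right_module A N" and "f \<in> rhom A M N" and "x \<in> carrier M"
  shows "f (\<ominus>\<^bsub>M\<^esub> x) = \<ominus>\<^bsub>N\<^esub> f x"
proof -
  interpret M: right_module A M by fact
  interpret N: right_module A N by fact
  have "f (\<ominus>\<^bsub>M\<^esub> x) \<oplus>\<^bsub>N\<^esub> f x = \<zero>\<^bsub>N\<^esub>"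
    using rhom_add[OF assms(3), of "\<ominus>\<^bsub>M\<^esub> x" x] assms rhom_zero[OF assms(1-3)]
    by (simp add: M.l_neg)
  then show ?thesis
    using rhom_closed[OF assms(3)] assms(4) by (simp add: N.minus_equality)
qed

lemma rhom_zero_map:
  assumes "right_module A M" and "right_module A N"
  shows "(\<lambda>x\<in>carrier M. \<zero>\<^bsub>N\<^esub>) \<in> rhom A M N"
proof -
  interpret N: right_module A N by fact
  show ?thesis
    by (intro rhom_restrictI assms(1)) (simp_all add: rsmult_zero_l[OF assms(2)])
qed

lemma rhom_sum:
  assumes "right_module A M" and "right_module A N" and "f \<in> rhom A M N" and "g \<in> rhom A M N"
  shows "(\<lambda>x\<in>carrier M. f x \<oplus>\<^bsub>N\<^esub> g x) \<in> rhom A M N"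
proof -
  interpret N: right_module A N by fact
  show ?thesis
    using assms(3,4) by (intro rhom_restrictI assms(1))
      (simp_all add: rhom_closed rhom_add rhom_smult N.a_ac N.rsmult_add_l)
qed

lemma rsmult_minus_l:
  fixes M :: "('a, 'm) rmodule"
  assumes "right_module A M" and "x \<in> carrier M" and "a \<in> carrier A"
  shows "(\<ominus>\<^bsub>M\<^esub> x) \<star>\<^bsub>M\<^esub> a = \<ominus>\<^bsub>M\<^esub> (x \<star>\<^bsub>M\<^esub> a)"
proof -
  interpret M: right_module A M by fact
  have "(\<ominus>\<^bsub>M\<^esub> x) \<star>\<^bsub>M\<^esub> a \<oplus>\<^bsub>M\<^esub> x \<star>\<^bsub>M\<^esub> a = \<zero>\<^bsub>M\<^esub>"
    using assms M.rsmult_add_l[of "\<ominus>\<^bsub>M\<^esub> x" x a] rsmult_zero_l[OF assms(1), of a]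
    by (simp add: M.l_neg)
  then show ?thesis using assms by (simp add: M.minus_equality M.rsmult_closed)
qed

lemma rhom_uminus:
  assumes "right_module A M" and "right_module A N" and "f \<in> rhom A M N"
  shows "(\<lambda>x\<in>carrier M. \<ominus>\<^bsub>N\<^esub> f x) \<in> rhom A M N"
proof -
  interpret N: right_module A N by fact
  show ?thesis
    using assms(3) by (intro rhom_restrictI assms(1))
      (simp_all add: rhom_closed rhom_add rhom_smult N.minus_add rsmult_minus_l[OF assms(2)])
qed

lemma rhom_inj_onI:
  assumes "right_module A M" and "right_module A N" and "f \<in> rhom A M N"
    and "\<And>x. x \<in> carrier M \<Longrightarrow> f x = \<zero>\<^bsub>N\<^esub> \<Longrightarrow> x = \<zero>\<^bsub>M\<^esub>"
  shows "inj_on f (carrier M)"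
proof (rule inj_onI)
  interpret M: right_module A M by fact
  interpret N: right_module A N by fact
  fix x y assume xy: "x \<in> carrier M" "y \<in> carrier M" "f x = f y"
  then have "f (x \<oplus>\<^bsub>M\<^esub> \<ominus>\<^bsub>M\<^esub> y) = \<zero>\<^bsub>N\<^esub>"
    using assms(1-3) by (simp add: rhom_add rhom_minus N.r_neg rhom_closed)
  then have "x \<oplus>\<^bsub>M\<^esub> \<ominus>\<^bsub>M\<^esub> y = \<zero>\<^bsub>M\<^esub>"
    using assms(4) xy by simp
  then show "x = y"
    using xy M.minus_equality[of x "\<ominus>\<^bsub>M\<^esub> y"] by simp
qed

lemma rhom_inverse:
  assumes "right_module A M" and "right_module A N"
    and "f \<in> rhom A M N" and "bij_betw f (carrier M) (carrier N)"
  obtains g where "g \<in> rhom A N M" and "bij_betw g (carrier N) (carrier M)"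
    and "\<And>x. x \<in> carrier M \<Longrightarrow> g (f x) = x" and "\<And>y. y \<in> carrier N \<Longrightarrow> f (g y) = y"
proof -
  interpret M: right_module A M by fact
  define g where "g = inv_into (carrier M) f"
  have gf: "g (f x) = x" if "x \<in> carrier M" for x
    using that assms(4) by (simp add: g_def bij_betw_def)
  have fg: "f (g y) = y" and gM: "g y \<in> carrier M" if "y \<in> carrier N" for y
    using that assms(4) by (auto simp: g_def bij_betw_def f_inv_into_f intro: inv_into_into)
  have "restrict g (carrier N) \<in> rhom A N M"
  proof (rule rhom_restrictI)
    fix x y assume "x \<in> carrier N" "y \<in> carrier N"
    then have "g (f (g x \<oplus>\<^bsub>M\<^esub> g y)) = g x \<oplus>\<^bsub>M\<^esub> g y"
      by (intro gf) (simp add: gM)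
    then show "g (x \<oplus>\<^bsub>N\<^esub> y) = g x \<oplus>\<^bsub>M\<^esub> g y"
      using \<open>x \<in> _\<close> \<open>y \<in> _\<close> by (simp add: rhom_add[OF assms(3)] gM fg)
  next
    fix x a assume "x \<in> carrier N" "a \<in> carrier A"
    then have "g (f (g x \<star>\<^bsub>M\<^esub> a)) = g x \<star>\<^bsub>M\<^esub> a"
      by (intro gf) (simp add: gM M.rsmult_closed)
    then show "g (x \<star>\<^bsub>N\<^esub> a) = g x \<star>\<^bsub>M\<^esub> a"
      using \<open>x \<in> _\<close> \<open>a \<in> _\<close> by (simp add: rhom_smult[OF assms(3)] gM fg)
  qed (use assms(2) gM in auto)
  moreover have "bij_betw (restrict g (carrier N)) (carrier N) (carrier M)"
    using bij_betw_inv_into[OF assms(4)] by (simp add: g_def bij_betw_restrict_eq)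
  ultimately show thesis
    by (rule that) (use assms(3) gf fg in \<open>auto simp: rhom_closed\<close>)
qed

lemma bij_betwI_inverse:
  assumes "f \<in> rhom A M N" and "g \<in> rhom A N M"
    and "\<And>x. x \<in> carrier M \<Longrightarrow> g (f x) = x" and "\<And>y. y \<in> carrier N \<Longrightarrow> f (g y) = y"
  shows "bij_betw f (carrier M) (carrier N)"
  using assms by (intro bij_betwI[where g = g]) (auto simp: rhom_closed)

lemma rmod_isomorphic_refl: "right_module A M \<Longrightarrow> rmod_isomorphic A M M"
  unfolding rmod_isomorphic_def
  by (rule bexI[of _ "\<lambda>x\<in>carrier M. x"]) (auto intro: rhom_id simp: bij_betw_def inj_on_def)

lemma rmod_isomorphic_sym:
  "right_module A M \<Longrightarrow> right_module A N \<Longrightarrow> rmod_isomorphic A M N \<Longrightarrow> rmod_isomorphic A N M"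
  unfolding rmod_isomorphic_def by (metis rhom_inverse)

lemma rmod_isomorphic_trans:
  assumes "right_module A L" and "rmod_isomorphic A L M" and "rmod_isomorphic A M N"
  shows "rmod_isomorphic A L N"
proof -
  obtain f g where "f \<in> rhom A L M" "bij_betw f (carrier L) (carrier M)"
    and "g \<in> rhom A M N" "bij_betw g (carrier M) (carrier N)"
    using assms by (auto simp: rmod_isomorphic_def)
  then have "compose (carrier L) g f \<in> rhom A L N"
    and "bij_betw (compose (carrier L) g f) (carrier L) (carrier N)"
    using assms(1) by (auto intro: rhom_compose bij_betw_compose)
  then show ?thesis by (auto simp: rmod_isomorphic_def)
qed

lemma rsubmoduleD:
  assumes "rsubmodule A M U"
  shows "U \<subseteq> carrier M" and "\<zero>\<^bsub>M\<^esub> \<in> U" and "\<And>x y. x \<in> U \<Longrightarrow> y \<in> U \<Longrightarrow> x \<oplus>\<^bsub>M\<^esub> y \<in> U"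
    and "\<And>x. x \<in> U \<Longrightarrow> \<ominus>\<^bsub>M\<^esub> x \<in> U" and "\<And>x a. x \<in> U \<Longrightarrow> a \<in> carrier A \<Longrightarrow> x \<star>\<^bsub>M\<^esub> a \<in> U"
  using assms subgroup.subset[of U "add_monoid M"] subgroup.one_closed[of U "add_monoid M"]
    subgroup.m_closed[of U "add_monoid M"] subgroup.m_inv_closed[of U "add_monoid M"]
  by (auto simp: rsubmodule_def a_inv_def)

text \<open>Negation needs no separate hypothesis, being the action of -1.\<close>

lemma rsubmoduleI:
  assumes "right_module A M" and "U \<subseteq> carrier M" and "\<zero>\<^bsub>M\<^esub> \<in> U"
    and "\<And>x y. x \<in> U \<Longrightarrow> y \<in> U \<Longrightarrow> x \<oplus>\<^bsub>M\<^esub> y \<in> U"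
    and smult: "\<And>x a. x \<in> U \<Longrightarrow> a \<in> carrier A \<Longrightarrow> x \<star>\<^bsub>M\<^esub> a \<in> U"
  shows "rsubmodule A M U"
proof -
  interpret M: right_module A M by fact
  have "\<ominus>\<^bsub>M\<^esub> x \<in> U" if "x \<in> U" for x
  proof -
    have "\<ominus>\<^bsub>M\<^esub> x = x \<star>\<^bsub>M\<^esub> (\<ominus>\<^bsub>A\<^esub> \<one>\<^bsub>A\<^esub>)"
      using that assms(1,2) by (simp add: rsmult_minus_r M.rsmult_one subset_eq)
    then show ?thesis using smult[OF that, of "\<ominus>\<^bsub>A\<^esub> \<one>\<^bsub>A\<^esub>"] by simp
  qed
  then have "subgroup U (add_monoid M)"
    using assms by (intro group.subgroupI M.add.group_axioms) (auto simp: a_inv_def)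
  then show ?thesis using smult by (simp add: rsubmodule_def)
qed

lemma right_module_sub:
  assumes "right_module A M" and "rsubmodule A M U"
  shows "right_module A (M\<lparr>carrier := U\<rparr>)"
proof -
  interpret M: right_module A M by fact
  note U = rsubmoduleD[OF assms(2)]
  have c: "x \<in> carrier M" if "x \<in> U" for x using that U(1) by auto
  have "abelian_group (M\<lparr>carrier := U\<rparr>)"
  proof (rule abelian_groupI)
    fix x assume "x \<in> carrier (M\<lparr>carrier := U\<rparr>)"
    then show "\<exists>y\<in>carrier (M\<lparr>carrier := U\<rparr>). y \<oplus>\<^bsub>M\<lparr>carrier := U\<rparr>\<^esub> x = \<zero>\<^bsub>M\<lparr>carrier := U\<rparr>\<^esub>"
      using U by (intro bexI[of _ "\<ominus>\<^bsub>M\<^esub> x"]) (auto simp: M.l_neg c)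
  qed (use U in \<open>auto simp: c M.a_ac\<close>)
  then show ?thesis
    using M.ring_axioms U
    by (intro right_module.intro right_module_axioms.intro)
      (auto simp: c M.rsmult_add_l M.rsmult_add_r M.rsmult_assoc M.rsmult_one)
qed

lemma rsubmodule_sub_iff:
  assumes "right_module A M" and "rsubmodule A M U"
  shows "rsubmodule A (M\<lparr>carrier := U\<rparr>) V \<longleftrightarrow> rsubmodule A M V \<and> V \<subseteq> U"
proof
  assume V: "rsubmodule A (M\<lparr>carrier := U\<rparr>) V"
  note V' = rsubmoduleD[OF V]
  show "rsubmodule A M V \<and> V \<subseteq> U"
    using V' rsubmoduleD(1)[OF assms(2)] by (auto intro!: rsubmoduleI assms(1))
next
  assume "rsubmodule A M V \<and> V \<subseteq> U"
  then show "rsubmodule A (M\<lparr>carrier := U\<rparr>) V"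
    using rsubmoduleD[of A M V] by (intro rsubmoduleI right_module_sub assms) auto
qed

lemma rsubmodule_carrier: "right_module A M \<Longrightarrow> rsubmodule A M (carrier M)"
proof -
  assume *: "right_module A M"
  interpret M: right_module A M by fact
  show ?thesis by (rule rsubmoduleI[OF *]) (auto simp: M.rsmult_closed)
qed

lemma rsubmodule_zero: "right_module A M \<Longrightarrow> rsubmodule A M {\<zero>\<^bsub>M\<^esub>}"
proof -
  assume *: "right_module A M"
  interpret M: right_module A M by fact
  show ?thesis by (rule rsubmoduleI[OF *]) (auto simp: rsmult_zero_l[OF *])
qed

lemma rsubmodule_vimage:
  assumes "right_module A M" and "right_module A N" and "f \<in> rhom A M N" and "rsubmodule A N V"
  shows "rsubmodule A M {x \<in> carrier M. f x \<in> V}"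
proof -
  interpret M: right_module A M by fact
  show ?thesis
    using assms rsubmoduleD[OF assms(4)]
    by (intro rsubmoduleI) (auto simp: rhom_add rhom_smult M.rsmult_closed rhom_zero[OF assms(1-3)])
qed

lemma rsubmodule_image:
  assumes "right_module A M" and "right_module A N" and "f \<in> rhom A M N" and "rsubmodule A M U"
  shows "rsubmodule A N (f ` U)"
proof (rule rsubmoduleI)
  note U = rsubmoduleD[OF assms(4)]
  show "f ` U \<subseteq> carrier N" using U(1) assms(3) by (auto simp: rhom_closed)
  show "\<zero>\<^bsub>N\<^esub> \<in> f ` U" using U(2) rhom_zero[OF assms(1-3)] by (metis imageI)
  fix x a assume "x \<in> f ` U"
  then obtain u where u: "u \<in> U" "x = f u" by blast
  {
    assume "a \<in> carrier A"
    then show "x \<star>\<^bsub>N\<^esub> a \<in> f ` U"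
      using u U by (intro image_eqI[of _ _ "u \<star>\<^bsub>M\<^esub> a"]) (auto simp: rhom_smult[OF assms(3)])
  }
  fix y assume "y \<in> f ` U"
  then obtain v where "v \<in> U" "y = f v" by blast
  moreover have "f (u \<oplus>\<^bsub>M\<^esub> v) = f u \<oplus>\<^bsub>N\<^esub> f v"
    using u U(1) \<open>v \<in> U\<close> by (intro rhom_add[OF assms(3)]) auto
  ultimately show "x \<oplus>\<^bsub>N\<^esub> y \<in> f ` U"
    using u U(3) by (metis imageI)
qed (rule assms)

lemma rhom_sub_incl:
  "right_module A M \<Longrightarrow> rsubmodule A M U \<Longrightarrow> (\<lambda>x\<in>U. x) \<in> rhom A (M\<lparr>carrier := U\<rparr>) M"
  using rhom_restrictI[OF right_module_sub, of A M U "\<lambda>x. x" M] rsubmoduleD(1)[of A M U] by auto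

lemma rhom_restrict_sub:
  assumes "right_module A M" and "rsubmodule A M U" and "f \<in> rhom A M N"
  shows "restrict f U \<in> rhom A (M\<lparr>carrier := U\<rparr>) N"
  using rhom_restrictI[OF right_module_sub[OF assms(1,2)], of f N] rsubmoduleD(1)[OF assms(2)] assms(3)
  by (auto simp: rhom_closed rhom_add rhom_smult subset_eq)

lemma rhom_into_sub:
  "f \<in> rhom A M (N\<lparr>carrier := V\<rparr>)" if "f \<in> rhom A M N" and "f ` carrier M \<subseteq> V"
  using that by (auto simp: rhom_def PiE_def)


section \<open>Finitely generated modules\<close>

lemma rspan_eq_carrierI:
  assumes "right_module A M" and "S \<subseteq> carrier M"
    and "\<And>U. rsubmodule A M U \<Longrightarrow> S \<subseteq> U \<Longrightarrow> carrier M \<subseteq> U"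
  shows "rspan A M S = carrier M"
  using assms rsubmodule_carrier[OF assms(1)] unfolding rspan_def by blast

lemma rspan_eq_carrierD:
  "rspan A M S = carrier M \<Longrightarrow> rsubmodule A M U \<Longrightarrow> S \<subseteq> U \<Longrightarrow> carrier M \<subseteq> U"
  by (auto simp: rspan_def)

lemma finitely_generated_image:
  assumes "right_module A M" and "right_module A N" and f: "f \<in> rhom A M N"
    and surj: "f ` carrier M = carrier N" and "finitely_generated A M"
  shows "finitely_generated A N"
proof -
  obtain S where S: "finite S" "S \<subseteq> carrier M" "rspan A M S = carrier M"
    using assms(5) by (auto simp: finitely_generated_def)
  have "rspan A N (f ` S) = carrier N"
  proof (rule rspan_eq_carrierI[OF assms(2)])
    fix U assume "rsubmodule A N U" "f ` S \<subseteq> U"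
    then have "carrier M \<subseteq> {x \<in> carrier M. f x \<in> U}"
      using S by (intro rspan_eq_carrierD[OF S(3)] rsubmodule_vimage[OF assms(1,2) f]) auto
    then show "carrier N \<subseteq> U" unfolding surj[symmetric] by auto
  qed (use S(2) surj in auto)
  moreover have "finite (f ` S)" "f ` S \<subseteq> carrier N" using S surj by auto
  ultimately show ?thesis unfolding finitely_generated_def by blast
qed

lemma modA_module: "M \<in> modA A \<Longrightarrow> right_module A M"
  and modA_fg: "M \<in> modA A \<Longrightarrow> finitely_generated A M"
  by (simp_all add: modA_def)

section \<open>Biproducts\<close>

text \<open>Stated through structure maps and with three independent element types, so that the same
  facts apply to direct sums of pairs, to internal decompositions and to their copies with list
  carriers.\<close>

definition biproduct :: "('a, 'r) ring_scheme \<Rightarrow>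
    ('a, 'm) rmodule \<Rightarrow> ('a, 'n) rmodule \<Rightarrow> ('a, 's) rmodule \<Rightarrow>
    ('m \<Rightarrow> 's) \<Rightarrow> ('n \<Rightarrow> 's) \<Rightarrow> ('s \<Rightarrow> 'm) \<Rightarrow> ('s \<Rightarrow> 'n) \<Rightarrow> bool" where
  "biproduct A M N S i j p q \<longleftrightarrow>
     i \<in> rhom A M S \<and> j \<in> rhom A N S \<and> p \<in> rhom A S M \<and> q \<in> rhom A S N \<and>
     (\<forall>x\<in>carrier M. p (i x) = x \<and> q (i x) = \<zero>\<^bsub>N\<^esub>) \<and>
     (\<forall>y\<in>carrier N. p (j y) = \<zero>\<^bsub>M\<^esub> \<and> q (j y) = y) \<and>
     (\<forall>s\<in>carrier S. i (p s) \<oplus>\<^bsub>S\<^esub> j (q s) = s)"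

lemma biproductD:
  assumes "biproduct A M N S i j p q"
  shows "i \<in> rhom A M S" "j \<in> rhom A N S" "p \<in> rhom A S M" "q \<in> rhom A S N"
    "\<And>x. x \<in> carrier M \<Longrightarrow> p (i x) = x" "\<And>x. x \<in> carrier M \<Longrightarrow> q (i x) = \<zero>\<^bsub>N\<^esub>"
    "\<And>y. y \<in> carrier N \<Longrightarrow> p (j y) = \<zero>\<^bsub>M\<^esub>" "\<And>y. y \<in> carrier N \<Longrightarrow> q (j y) = y"
    "\<And>s. s \<in> carrier S \<Longrightarrow> i (p s) \<oplus>\<^bsub>S\<^esub> j (q s) = s"
  using assms by (auto simp: biproduct_def)

lemma biproduct_closed:
  assumes "biproduct A M N S i j p q"
  shows "\<And>x. x \<in> carrier M \<Longrightarrow> i x \<in> carrier S" "\<And>y. y \<in> carrier N \<Longrightarrow> j y \<in> carrier S"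
    "\<And>s. s \<in> carrier S \<Longrightarrow> p s \<in> carrier M" "\<And>s. s \<in> carrier S \<Longrightarrow> q s \<in> carrier N"
  using biproductD(1-4)[OF assms] by (simp_all add: rhom_closed)

lemma biproduct_swap:
  assumes "right_module A S" and "biproduct A M N S i j p q"
  shows "biproduct A N M S j i q p"
proof -
  interpret S: right_module A S by fact
  show ?thesis
    using biproductD[OF assms(2)] unfolding biproduct_def
    by (auto simp: S.a_comm rhom_closed)
qed

lemma biproduct_surj:
  assumes "biproduct A M N S i j p q"
  shows "p ` carrier S = carrier M" and "q ` carrier S = carrier N"
proof -
  note b = biproductD[OF assms]
  show "p ` carrier S = carrier M"
  proof
    show "p ` carrier S \<subseteq> carrier M" using rhom_closed[OF b(3)] by auto
    show "carrier M \<subseteq> p ` carrier S"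
      using b(5) rhom_closed[OF b(1)] by (metis image_eqI subsetI)
  qed
  show "q ` carrier S = carrier N"
  proof
    show "q ` carrier S \<subseteq> carrier N" using rhom_closed[OF b(4)] by auto
    show "carrier N \<subseteq> q ` carrier S"
      using b(8) rhom_closed[OF b(2)] by (metis image_eqI subsetI)
  qed
qed

text \<open>The projections are chosen elementwise. Trivial intersection makes the two components
  unique (\<open>uniq\<close>), and uniqueness alone shows that the choice is additive and linear
  and that it is the identity or zero on each summand.\<close>

lemma biproduct_of_internal:
  assumes M: "right_module A M" and "internal_direct_sum A M U V"
  obtains p q where
    "biproduct A (M\<lparr>carrier := U\<rparr>) (M\<lparr>carrier := V\<rparr>) M (\<lambda>x\<in>U. x) (\<lambda>x\<in>V. x) p q"
proof -
  interpret M: right_module A M by fact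
  have U: "rsubmodule A M U" and V: "rsubmodule A M V"
    and UV: "U \<inter> V = {\<zero>\<^bsub>M\<^esub>}" and sum: "U <+>\<^bsub>M\<^esub> V = carrier M"
    using assms(2) by (auto simp: internal_direct_sum_def)
  note U' = rsubmoduleD[OF U] and V' = rsubmoduleD[OF V]
  have uc: "x \<in> carrier M" if "x \<in> U" for x using that U'(1) by auto
  have vc: "x \<in> carrier M" if "x \<in> V" for x using that V'(1) by auto
  have uniq: "u = u' \<and> v = v'"
    if "u \<in> U" "u' \<in> U" "v \<in> V" "v' \<in> V" "u \<oplus>\<^bsub>M\<^esub> v = u' \<oplus>\<^bsub>M\<^esub> v'" for u u' v v'
  proof -
    \<comment> \<open>This difference equals \<open>v'\<close> minus \<open>v\<close>, hence lies in
      both summands and vanishes.\<close>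
    have "\<ominus>\<^bsub>M\<^esub> u' \<oplus>\<^bsub>M\<^esub> u = \<ominus>\<^bsub>M\<^esub> u' \<oplus>\<^bsub>M\<^esub> (u \<oplus>\<^bsub>M\<^esub> v) \<oplus>\<^bsub>M\<^esub> \<ominus>\<^bsub>M\<^esub> v"
      using that(1-4) by (simp add: uc vc M.a_assoc M.r_neg)
    also have "\<dots> = \<ominus>\<^bsub>M\<^esub> u' \<oplus>\<^bsub>M\<^esub> (u' \<oplus>\<^bsub>M\<^esub> v') \<oplus>\<^bsub>M\<^esub> \<ominus>\<^bsub>M\<^esub> v"
      using that(5) by simp
    also have "\<dots> = v' \<oplus>\<^bsub>M\<^esub> \<ominus>\<^bsub>M\<^esub> v"
      using that(1-4) by (simp add: uc vc M.r_neg1)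
    finally have "\<ominus>\<^bsub>M\<^esub> u' \<oplus>\<^bsub>M\<^esub> u = v' \<oplus>\<^bsub>M\<^esub> \<ominus>\<^bsub>M\<^esub> v" .
    moreover have "\<ominus>\<^bsub>M\<^esub> u' \<oplus>\<^bsub>M\<^esub> u \<in> U" "v' \<oplus>\<^bsub>M\<^esub> \<ominus>\<^bsub>M\<^esub> v \<in> V" using that U' V' by auto
    ultimately have "\<ominus>\<^bsub>M\<^esub> u' \<oplus>\<^bsub>M\<^esub> u = \<zero>\<^bsub>M\<^esub>" "v' \<oplus>\<^bsub>M\<^esub> \<ominus>\<^bsub>M\<^esub> v = \<zero>\<^bsub>M\<^esub>" using UV by auto
    then show ?thesis
      using that M.minus_equality[of "\<ominus>\<^bsub>M\<^esub> u'" u] M.minus_equality[of v' "\<ominus>\<^bsub>M\<^esub> v"]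
      by (auto simp: uc vc)
  qed
  have "\<forall>s\<in>carrier M. \<exists>u v. u \<in> U \<and> v \<in> V \<and> s = u \<oplus>\<^bsub>M\<^esub> v"
    using sum unfolding set_add_def set_mult_def by force
  then obtain p q where pq: "\<And>s. s \<in> carrier M \<Longrightarrow> p s \<in> U \<and> q s \<in> V \<and> s = p s \<oplus>\<^bsub>M\<^esub> q s"
    by metis
  have add: "p (x \<oplus>\<^bsub>M\<^esub> y) = p x \<oplus>\<^bsub>M\<^esub> p y \<and> q (x \<oplus>\<^bsub>M\<^esub> y) = q x \<oplus>\<^bsub>M\<^esub> q y"
    if "x \<in> carrier M" "y \<in> carrier M" for x y
  proof (rule uniq)
    have "x \<oplus>\<^bsub>M\<^esub> y = (p x \<oplus>\<^bsub>M\<^esub> q x) \<oplus>\<^bsub>M\<^esub> (p y \<oplus>\<^bsub>M\<^esub> q y)" using pq that by simp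
    also have "\<dots> = (p x \<oplus>\<^bsub>M\<^esub> p y) \<oplus>\<^bsub>M\<^esub> (q x \<oplus>\<^bsub>M\<^esub> q y)"
      using that pq by (simp add: M.a_ac uc vc)
    finally show "p (x \<oplus>\<^bsub>M\<^esub> y) \<oplus>\<^bsub>M\<^esub> q (x \<oplus>\<^bsub>M\<^esub> y) = \<dots>"
      using pq[of "x \<oplus>\<^bsub>M\<^esub> y"] that by (metis M.a_closed)
  qed (use that pq U' V' in auto)
  have smult: "p (x \<star>\<^bsub>M\<^esub> a) = p x \<star>\<^bsub>M\<^esub> a \<and> q (x \<star>\<^bsub>M\<^esub> a) = q x \<star>\<^bsub>M\<^esub> a"
    if "x \<in> carrier M" "a \<in> carrier A" for x a
  proof (rule uniq)
    have "x \<star>\<^bsub>M\<^esub> a = (p x \<oplus>\<^bsub>M\<^esub> q x) \<star>\<^bsub>M\<^esub> a" using pq that by simp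
    also have "\<dots> = p x \<star>\<^bsub>M\<^esub> a \<oplus>\<^bsub>M\<^esub> q x \<star>\<^bsub>M\<^esub> a"
      using that pq by (intro M.rsmult_add_l) (auto simp: uc vc)
    finally show "p (x \<star>\<^bsub>M\<^esub> a) \<oplus>\<^bsub>M\<^esub> q (x \<star>\<^bsub>M\<^esub> a) = \<dots>"
      using pq[of "x \<star>\<^bsub>M\<^esub> a"] that by (metis M.rsmult_closed)
  qed (use that pq U' V' in \<open>auto simp: M.rsmult_closed\<close>)
  have pU: "p x = x \<and> q x = \<zero>\<^bsub>M\<^esub>" if "x \<in> U" for x
    using that pq[of x] U' V' by (intro uniq) (auto simp: uc)
  have qV: "p x = \<zero>\<^bsub>M\<^esub> \<and> q x = x" if "x \<in> V" for x
    using that pq[of x] U' V' by (intro uniq) (auto simp: vc)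
  have "restrict p (carrier M) \<in> rhom A M (M\<lparr>carrier := U\<rparr>)"
    and "restrict q (carrier M) \<in> rhom A M (M\<lparr>carrier := V\<rparr>)"
    using pq add smult by (auto intro!: rhom_restrictI[OF M])
  then have "biproduct A (M\<lparr>carrier := U\<rparr>) (M\<lparr>carrier := V\<rparr>) M (\<lambda>x\<in>U. x) (\<lambda>x\<in>V. x)
      (restrict p (carrier M)) (restrict q (carrier M))"
    using pq pU qV unfolding biproduct_def
    by (auto simp: rhom_sub_incl[OF M U] rhom_sub_incl[OF M V] uc vc)
  then show thesis by (rule that)
qed

lemma direct_sum_simps [simp]:
  "carrier (direct_sum M N) = carrier M \<times> carrier N"
  "\<zero>\<^bsub>direct_sum M N\<^esub> = (\<zero>\<^bsub>M\<^esub>, \<zero>\<^bsub>N\<^esub>)"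
  "(x, y) \<oplus>\<^bsub>direct_sum M N\<^esub> (x', y') = (x \<oplus>\<^bsub>M\<^esub> x', y \<oplus>\<^bsub>N\<^esub> y')"
  "(x, y) \<star>\<^bsub>direct_sum M N\<^esub> a = (x \<star>\<^bsub>M\<^esub> a, y \<star>\<^bsub>N\<^esub> a)"
  by (simp_all add: direct_sum_def)

lemma right_module_direct_sum:
  assumes "right_module A M" and "right_module A N"
  shows "right_module A (direct_sum M N)"
proof -
  interpret M: right_module A M by fact
  interpret N: right_module A N by fact
  have "abelian_group (direct_sum M N)"
  proof (rule abelian_groupI)
    fix x assume "x \<in> carrier (direct_sum M N)"
    then obtain u v where "x = (u, v)" "u \<in> carrier M" "v \<in> carrier N" by auto
    then show "\<exists>y\<in>carrier (direct_sum M N). y \<oplus>\<^bsub>direct_sum M N\<^esub> x = \<zero>\<^bsub>direct_sum M N\<^esub>"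
      by (intro bexI[of _ "(\<ominus>\<^bsub>M\<^esub> u, \<ominus>\<^bsub>N\<^esub> v)"]) (auto simp: M.l_neg N.l_neg)
  qed (auto simp: M.a_ac N.a_ac)
  then show ?thesis
    using M.ring_axioms
    by (intro right_module.intro right_module_axioms.intro)
      (auto simp: M.rsmult_closed N.rsmult_closed M.rsmult_add_l N.rsmult_add_l M.rsmult_add_r
        N.rsmult_add_r M.rsmult_assoc N.rsmult_assoc M.rsmult_one N.rsmult_one)
qed

lemma biproduct_direct_sum:
  assumes "right_module A M" and "right_module A N"
  shows "biproduct A M N (direct_sum M N)
    (\<lambda>x\<in>carrier M. (x, \<zero>\<^bsub>N\<^esub>)) (\<lambda>y\<in>carrier N. (\<zero>\<^bsub>M\<^esub>, y))
    (restrict fst (carrier M \<times> carrier N)) (restrict snd (carrier M \<times> carrier N))"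
proof -
  interpret M: right_module A M by fact
  interpret N: right_module A N by fact
  note S = right_module_direct_sum[OF assms]
  have "(\<lambda>x\<in>carrier M. (x, \<zero>\<^bsub>N\<^esub>)) \<in> rhom A M (direct_sum M N)"
    by (rule rhom_restrictI[OF assms(1)]) (auto simp: rsmult_zero_l[OF assms(2)])
  moreover have "(\<lambda>y\<in>carrier N. (\<zero>\<^bsub>M\<^esub>, y)) \<in> rhom A N (direct_sum M N)"
    by (rule rhom_restrictI[OF assms(2)]) (auto simp: rsmult_zero_l[OF assms(1)])
  moreover have "restrict fst (carrier M \<times> carrier N) \<in> rhom A (direct_sum M N) M"
    "restrict snd (carrier M \<times> carrier N) \<in> rhom A (direct_sum M N) N"
    using rhom_restrictI[OF S, of fst M] rhom_restrictI[OF S, of snd N] by auto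
  ultimately show ?thesis unfolding biproduct_def by auto
qed

lemma biproduct_fg:
  assumes M: "right_module A M" and N: "right_module A N" and S: "right_module A S"
    and "biproduct A M N S i j p q" and "finitely_generated A M" and "finitely_generated A N"
  shows "finitely_generated A S"
proof -
  note b = biproductD[OF assms(4)]
  obtain G H where G: "finite G" "G \<subseteq> carrier M" "rspan A M G = carrier M"
    and H: "finite H" "H \<subseteq> carrier N" "rspan A N H = carrier N"
    using assms by (auto simp: finitely_generated_def)
  have GH: "i ` G \<union> j ` H \<subseteq> carrier S"
    using G(2) H(2) b(1,2) by (auto simp: rhom_closed subset_eq)
  have "rspan A S (i ` G \<union> j ` H) = carrier S"
  proof (rule rspan_eq_carrierI[OF S GH])
    fix U assume U: "rsubmodule A S U" "i ` G \<union> j ` H \<subseteq> U"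
    have "carrier M \<subseteq> {x \<in> carrier M. i x \<in> U}"
      using G U by (intro rspan_eq_carrierD[OF G(3)] rsubmodule_vimage[OF M S b(1)]) auto
    moreover have "carrier N \<subseteq> {x \<in> carrier N. j x \<in> U}"
      using H U by (intro rspan_eq_carrierD[OF H(3)] rsubmodule_vimage[OF N S b(2)]) auto
    ultimately have "i (p s) \<oplus>\<^bsub>S\<^esub> j (q s) \<in> U" if "s \<in> carrier S" for s
      using that rhom_closed[OF b(3) that] rhom_closed[OF b(4) that]
      by (intro rsubmoduleD(3)[OF U(1)]) auto
    then show "carrier S \<subseteq> U" using b(9) by force
  qed
  then show ?thesis
    unfolding finitely_generated_def using G(1) H(1) GH by (intro exI[of _ "i ` G \<union> j ` H"]) simp
qed

lemma rmod_isomorphicE: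
  assumes "right_module A M" and "right_module A N" and "rmod_isomorphic A M N"
  obtains h k where "h \<in> rhom A M N" and "k \<in> rhom A N M"
    and "\<And>x. x \<in> carrier M \<Longrightarrow> k (h x) = x" and "\<And>y. y \<in> carrier N \<Longrightarrow> h (k y) = y"
  using assms rhom_inverse unfolding rmod_isomorphic_def by metis

text \<open>Conjugating the four structure maps with the isomorphisms. This moves decompositions
  from pairs, or from submodules of modules of pairs, to objects of \<open>modA\<close>.\<close>

lemma biproduct_transport:
  assumes M: "right_module A M" and N: "right_module A N" and S: "right_module A S"
    and M': "right_module A M'" and N': "right_module A N'" and S': "right_module A S'"
    and "biproduct A M N S i j p q"
    and "rmod_isomorphic A M M'" and "rmod_isomorphic A N N'" and "rmod_isomorphic A S S'"
  obtains i' j' p' q' where "biproduct A M' N' S' i' j' p' q'"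
proof -
  note b = biproductD[OF assms(7)]
  obtain e e' where e: "e \<in> rhom A M M'" "e' \<in> rhom A M' M"
    "\<And>x. x \<in> carrier M \<Longrightarrow> e' (e x) = x" "\<And>x. x \<in> carrier M' \<Longrightarrow> e (e' x) = x"
    using rmod_isomorphicE[OF M M' assms(8)] by metis
  obtain d d' where d: "d \<in> rhom A N N'" "d' \<in> rhom A N' N"
    "\<And>x. x \<in> carrier N \<Longrightarrow> d' (d x) = x" "\<And>x. x \<in> carrier N' \<Longrightarrow> d (d' x) = x"
    using rmod_isomorphicE[OF N N' assms(9)] by metis
  obtain h k where h: "h \<in> rhom A S S'" "k \<in> rhom A S' S"
    "\<And>x. x \<in> carrier S \<Longrightarrow> k (h x) = x" "\<And>x. x \<in> carrier S' \<Longrightarrow> h (k x) = x"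
    using rmod_isomorphicE[OF S S' assms(10)] by metis
  note [simp] = biproduct_closed[OF assms(7)]
    rhom_closed[OF e(1)] rhom_closed[OF e(2)] rhom_closed[OF d(1)] rhom_closed[OF d(2)]
    rhom_closed[OF h(1)] rhom_closed[OF h(2)] compose_eq b(5-8) e(3,4) d(3,4) h(3,4)
    rhom_zero[OF M M' e(1)] rhom_zero[OF N N' d(1)]
  define i' where "i' = compose (carrier M') h (compose (carrier M') i e')"
  define j' where "j' = compose (carrier N') h (compose (carrier N') j d')"
  define p' where "p' = compose (carrier S') e (compose (carrier S') p k)"
  define q' where "q' = compose (carrier S') d (compose (carrier S') q k)"
  have "i' \<in> rhom A M' S'" "j' \<in> rhom A N' S'" "p' \<in> rhom A S' M'" "q' \<in> rhom A S' N'"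
    unfolding i'_def j'_def p'_def q'_def
    by (rule rhom_compose[OF M' rhom_compose[OF M' e(2) b(1)] h(1)]
      rhom_compose[OF N' rhom_compose[OF N' d(2) b(2)] h(1)]
      rhom_compose[OF S' rhom_compose[OF S' h(2) b(3)] e(1)]
      rhom_compose[OF S' rhom_compose[OF S' h(2) b(4)] d(1)])+
  moreover have "i' (p' s) \<oplus>\<^bsub>S'\<^esub> j' (q' s) = s" if "s \<in> carrier S'" for s
    using that by (simp add: i'_def j'_def p'_def q'_def rhom_add[OF h(1), symmetric] b(9))
  ultimately have "biproduct A M' N' S' i' j' p' q'"
    unfolding biproduct_def by (simp add: i'_def j'_def p'_def q'_def)
  then show thesis by (rule that)
qed

lemma biproduct_exists:
  assumes "M \<in> modA A" and "N \<in> modA A"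
  obtains S i j p q where "S \<in> modA A" and "biproduct A M N S i j p q"
proof -
  note M = modA_module[OF assms(1)] and N = modA_module[OF assms(2)]
  note D = right_module_direct_sum[OF M N] and bip = biproduct_direct_sum[OF M N]
  have "finitely_generated A (direct_sum M N)"
    by (rule biproduct_fg[OF M N D bip]) (simp_all add: modA_fg assms)
  then obtain S where S: "S \<in> modA A" and iso: "rmod_isomorphic A (direct_sum M N) S"
    using fg_module_in_modA[OF D] by metis
  show thesis
    using biproduct_transport[OF M N D M N modA_module[OF S] bip rmod_isomorphic_refl[OF M]
        rmod_isomorphic_refl[OF N] iso] that[OF S] by metis
qed

text \<open>The mutually inverse maps are \<open>i' p + j' q\<close> and
  \<open>i p' + j q'\<close>.\<close>

lemma biproduct_unique:
  assumes M: "right_module A M" and N: "right_module A N"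
    and S: "right_module A S" and S': "right_module A S'"
    and "biproduct A M N S i j p q" and "biproduct A M N S' i' j' p' q'"
  shows "rmod_isomorphic A S S'"
proof -
  note b = biproductD[OF assms(5)] and b' = biproductD[OF assms(6)]
  interpret M: right_module A M by (rule M)
  interpret N: right_module A N by (rule N)
  note [simp] = biproduct_closed[OF assms(5)]
    biproduct_closed[OF assms(6)]
    compose_eq b(5-8) b'(5-8) rhom_add[OF b(3)] rhom_add[OF b(4)] rhom_add[OF b'(3)] rhom_add[OF b'(4)]
  define h where "h = (\<lambda>s\<in>carrier S. compose (carrier S) i' p s \<oplus>\<^bsub>S'\<^esub> compose (carrier S) j' q s)"
  define k where "k = (\<lambda>s\<in>carrier S'. compose (carrier S') i p' s \<oplus>\<^bsub>S\<^esub> compose (carrier S') j q' s)"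
  have h: "h \<in> rhom A S S'"
    unfolding h_def by (rule rhom_sum[OF S S' rhom_compose[OF S b(3) b'(1)] rhom_compose[OF S b(4) b'(2)]])
  have k: "k \<in> rhom A S' S"
    unfolding k_def by (rule rhom_sum[OF S' S rhom_compose[OF S' b'(3) b(1)] rhom_compose[OF S' b'(4) b(2)]])
  have "k (h s) = s" if "s \<in> carrier S" for s
  proof -
    have "k (h s) = i (p' (h s)) \<oplus>\<^bsub>S\<^esub> j (q' (h s))" using that rhom_closed[OF h] by (simp add: k_def)
    then show ?thesis using that b(9)[OF that] by (simp add: h_def)
  qed
  moreover have "h (k s) = s" if "s \<in> carrier S'" for s
  proof -
    have "h (k s) = i' (p (k s)) \<oplus>\<^bsub>S'\<^esub> j' (q (k s))" using that rhom_closed[OF k] by (simp add: h_def)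
    then show ?thesis using that b'(9)[OF that] by (simp add: k_def)
  qed
  ultimately show ?thesis
    unfolding rmod_isomorphic_def using bij_betwI_inverse[OF h k] h by metis
qed

text \<open>A summand is finitely generated as the image of the whole module under its
  projection.\<close>

lemma modA_summand:
  assumes M: "M \<in> modA A" and "internal_direct_sum A M U V"
  shows "M\<lparr>carrier := U\<rparr> \<in> modA A" and "M\<lparr>carrier := V\<rparr> \<in> modA A"
proof -
  note M' = modA_module[OF M]
  have U: "rsubmodule A M U" and V: "rsubmodule A M V"
    using assms(2) by (auto simp: internal_direct_sum_def)
  obtain p q where bip: "biproduct A (M\<lparr>carrier := U\<rparr>) (M\<lparr>carrier := V\<rparr>) M (\<lambda>x\<in>U. x) (\<lambda>x\<in>V. x) p q"
    using biproduct_of_internal[OF M' assms(2)] .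
  note b = biproductD[OF bip]
  have "finitely_generated A (M\<lparr>carrier := U\<rparr>)" "finitely_generated A (M\<lparr>carrier := V\<rparr>)"
    using finitely_generated_image[OF M' right_module_sub[OF M' U] b(3) biproduct_surj(1)[OF bip]]
      finitely_generated_image[OF M' right_module_sub[OF M' V] b(4) biproduct_surj(2)[OF bip]]
      modA_fg[OF M] by simp_all
  then show "M\<lparr>carrier := U\<rparr> \<in> modA A" "M\<lparr>carrier := V\<rparr> \<in> modA A"
    using right_module_sub[OF M' U] right_module_sub[OF M' V] by (simp_all add: modA_def)
qed

section \<open>Finite length\<close>

text \<open>A rank function that grows along strict inclusions bounds the length of every chain of
  submodules. The least \<open>n\<close> is the usual length of the module, yet no composition
  series or Jordan-Hoelder theorem is involved.\<close>

definition length_bound :: "('a, 'r) ring_scheme \<Rightarrow> ('a, 'm) rmodule \<Rightarrow> nat \<Rightarrow> bool" where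
  "length_bound A M n \<longleftrightarrow> (\<exists>d :: 'm set \<Rightarrow> nat.
     (\<forall>U V. rsubmodule A M U \<and> rsubmodule A M V \<and> U \<subset> V \<longrightarrow> d U < d V) \<and>
     (\<forall>U. rsubmodule A M U \<longrightarrow> d U \<le> n))"

definition len :: "('a, 'r) ring_scheme \<Rightarrow> ('a, 'm) rmodule \<Rightarrow> nat" where
  "len A M = (LEAST n. length_bound A M n)"

definition finite_length :: "('a, 'r) ring_scheme \<Rightarrow> ('a, 'm) rmodule \<Rightarrow> bool" where
  "finite_length A M \<longleftrightarrow> (\<exists>n. length_bound A M n)"

text \<open>A rank function that is optimal for \<open>M\<close>, restricted to the submodules of
  \<open>U\<close>, is bounded by its value at \<open>U\<close>, and this lies strictly below its
  value at the whole of \<open>M\<close>.\<close>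

lemma len_sub_less:
  assumes M: "right_module A M" and "finite_length A M"
    and U: "rsubmodule A M U" and "U \<noteq> carrier M"
  shows "len A (M\<lparr>carrier := U\<rparr>) < len A M"
proof -
  have "length_bound A M (len A M)"
    unfolding len_def using assms(2) by (auto simp: finite_length_def intro: LeastI)
  then obtain d where d: "\<And>U V. rsubmodule A M U \<Longrightarrow> rsubmodule A M V \<Longrightarrow> U \<subset> V \<Longrightarrow> d U < d V"
    and n: "\<And>U. rsubmodule A M U \<Longrightarrow> d U \<le> len A M"
    unfolding length_bound_def by blast
  have "d V \<le> d U" if "rsubmodule A M V" "V \<subseteq> U" for V
    using d[OF that(1) U] that(2) by (metis le_less psubsetI)
  then have "length_bound A (M\<lparr>carrier := U\<rparr>) (d U)"
    unfolding length_bound_def using d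
    by (intro exI[of _ d]) (simp add: rsubmodule_sub_iff[OF M U])
  then have "len A (M\<lparr>carrier := U\<rparr>) \<le> d U"
    unfolding len_def by (rule Least_le)
  also have "d U < d (carrier M)"
    using assms(4) rsubmoduleD(1)[OF U] by (intro d U rsubmodule_carrier M) auto
  also have "\<dots> \<le> len A M"
    by (rule n[OF rsubmodule_carrier[OF M]])
  finally show ?thesis .
qed

lemma len_sub_le:
  assumes "right_module A M" and "finite_length A M" and "rsubmodule A M U"
  shows "len A (M\<lparr>carrier := U\<rparr>) \<le> len A M"
  using len_sub_less[OF assms] by (cases "U = carrier M") auto

section \<open>Finite dimension over the base field bounds the length\<close>

lemma (in abelian_group) add_diff_cancel:
  assumes "x \<in> carrier G" and "y \<in> carrier G" and "z \<in> carrier G"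
  shows "(x \<oplus> y) \<oplus> (z \<oplus> \<ominus> y) = x \<oplus> z" and "(x \<oplus> z) \<oplus> \<ominus> (x \<oplus> y) = z \<oplus> \<ominus> y"
proof -
  have "(x \<oplus> y) \<oplus> (z \<oplus> \<ominus> y) = (x \<oplus> y) \<oplus> (\<ominus> y \<oplus> z)"
    using assms by (simp add: a_comm)
  also have "\<dots> = x \<oplus> (y \<oplus> (\<ominus> y \<oplus> z))"
    using assms by (simp add: a_assoc)
  finally show *: "(x \<oplus> y) \<oplus> (z \<oplus> \<ominus> y) = x \<oplus> z"
    using assms by (simp add: r_neg2)
  have "(x \<oplus> z) \<oplus> \<ominus> (x \<oplus> y) = ((x \<oplus> y) \<oplus> (z \<oplus> \<ominus> y)) \<oplus> \<ominus> (x \<oplus> y)"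
    by (simp only: *)
  also have "\<dots> = (z \<oplus> \<ominus> y) \<oplus> ((x \<oplus> y) \<oplus> \<ominus> (x \<oplus> y))"
    using assms by (simp only: a_comm[of "x \<oplus> y" "z \<oplus> \<ominus> y"]
      a_assoc[of "z \<oplus> \<ominus> y" "x \<oplus> y"] a_closed a_inv_closed)
  finally show "(x \<oplus> z) \<oplus> \<ominus> (x \<oplus> y) = z \<oplus> \<ominus> y"
    using assms by (simp add: r_neg del: minus_add)
qed

text \<open>The span with coefficients in a subset \<open>D\<close> of the ring, acting from the
  right. Recursion on the list of generators exhibits the filtration by spans of final
  segments.\<close>

primrec kspan :: "'a set \<Rightarrow> ('a, 'm) rmodule \<Rightarrow> 'm list \<Rightarrow> 'm set" where
  "kspan D M [] = {\<zero>\<^bsub>M\<^esub>}"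
| "kspan D M (b # bs) = {b \<star>\<^bsub>M\<^esub> c \<oplus>\<^bsub>M\<^esub> n | c n. c \<in> D \<and> n \<in> kspan D M bs}"

text \<open>The number of steps of the filtration of \<open>M\<close> by the spans of the final segments of the
  list that are hit by \<open>U\<close>; for a division ring \<open>D\<close> this is the dimension of \<open>U\<close>.\<close>

primrec jumps :: "'a set \<Rightarrow> ('a, 'm) rmodule \<Rightarrow> 'm list \<Rightarrow> 'm set \<Rightarrow> nat" where
  "jumps D M [] U = 0"
| "jumps D M (b # bs) U =
     (if \<exists>n\<in>kspan D M bs. b \<oplus>\<^bsub>M\<^esub> n \<in> U then 1 else 0) + jumps D M bs U"

text \<open>The assumptions make \<open>D\<close> a subring of \<open>A\<close> in which nonzero
  elements have right inverses. It stands for the copy of the base field inside the algebra, so that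
  \<open>M\<close> need not be equipped with a second structure as a vector space.\<close>

context
  fixes A :: "('a, 'r) ring_scheme" and M :: "('a, 'm) rmodule" and D :: "'a set"
  assumes module: "right_module A M"
    and D: "D \<subseteq> carrier A" "\<zero>\<^bsub>A\<^esub> \<in> D" "\<one>\<^bsub>A\<^esub> \<in> D"
      "\<And>c e. c \<in> D \<Longrightarrow> e \<in> D \<Longrightarrow> c \<oplus>\<^bsub>A\<^esub> e \<in> D" "\<And>c e. c \<in> D \<Longrightarrow> e \<in> D \<Longrightarrow> c \<otimes>\<^bsub>A\<^esub> e \<in> D"
      "\<And>c. c \<in> D \<Longrightarrow> \<ominus>\<^bsub>A\<^esub> c \<in> D"
      "\<And>c. c \<in> D \<Longrightarrow> c \<noteq> \<zero>\<^bsub>A\<^esub> \<Longrightarrow> \<exists>e\<in>D. c \<otimes>\<^bsub>A\<^esub> e = \<one>\<^bsub>A\<^esub>"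
begin

interpretation M: right_module A M by (rule module)

lemma D_carrier: "c \<in> D \<Longrightarrow> c \<in> carrier A"
  using D(1) by auto

lemma kspan_subset: "set bs \<subseteq> carrier M \<Longrightarrow> kspan D M bs \<subseteq> carrier M"
  by (induction bs) (auto simp: M.rsmult_closed D_carrier)

lemma kspan_zero: "set bs \<subseteq> carrier M \<Longrightarrow> \<zero>\<^bsub>M\<^esub> \<in> kspan D M bs"
  using D(2) by (induction bs) (force simp: rsmult_zero_r[OF module])+

lemma kspan_add:
  "set bs \<subseteq> carrier M \<Longrightarrow> x \<in> kspan D M bs \<Longrightarrow> y \<in> kspan D M bs \<Longrightarrow> x \<oplus>\<^bsub>M\<^esub> y \<in> kspan D M bs"
proof (induction bs arbitrary: x y)
  case (Cons b bs)
  then obtain c n e m where x: "x = b \<star>\<^bsub>M\<^esub> c \<oplus>\<^bsub>M\<^esub> n" "c \<in> D" "n \<in> kspan D M bs"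
    and y: "y = b \<star>\<^bsub>M\<^esub> e \<oplus>\<^bsub>M\<^esub> m" "e \<in> D" "m \<in> kspan D M bs" by auto
  have "n \<in> carrier M" "m \<in> carrier M" "b \<in> carrier M" "c \<in> carrier A" "e \<in> carrier A"
    using x y Cons.prems kspan_subset[of bs] by (auto simp: D_carrier)
  then have "x \<oplus>\<^bsub>M\<^esub> y = b \<star>\<^bsub>M\<^esub> (c \<oplus>\<^bsub>A\<^esub> e) \<oplus>\<^bsub>M\<^esub> (n \<oplus>\<^bsub>M\<^esub> m)"
    using x y by (simp add: M.rsmult_add_r M.rsmult_closed M.a_ac)
  moreover have "n \<oplus>\<^bsub>M\<^esub> m \<in> kspan D M bs" using Cons x y by simp
  ultimately show ?case using D(4) x y by auto
qed simp

lemma kspan_smult: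
  "set bs \<subseteq> carrier M \<Longrightarrow> x \<in> kspan D M bs \<Longrightarrow> c \<in> D \<Longrightarrow> x \<star>\<^bsub>M\<^esub> c \<in> kspan D M bs"
proof (induction bs arbitrary: x)
  case Nil
  then show ?case by (simp add: rsmult_zero_l[OF module] D_carrier)
next
  case (Cons b bs)
  then obtain e m where x: "x = b \<star>\<^bsub>M\<^esub> e \<oplus>\<^bsub>M\<^esub> m" "e \<in> D" "m \<in> kspan D M bs" by auto
  have "m \<in> carrier M" "b \<in> carrier M" "c \<in> carrier A" "e \<in> carrier A"
    using x Cons.prems kspan_subset[of bs] by (auto simp: D_carrier)
  then have "x \<star>\<^bsub>M\<^esub> c = b \<star>\<^bsub>M\<^esub> (e \<otimes>\<^bsub>A\<^esub> c) \<oplus>\<^bsub>M\<^esub> m \<star>\<^bsub>M\<^esub> c"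
    using x by (simp add: M.rsmult_add_l M.rsmult_closed M.rsmult_assoc)
  moreover have "m \<star>\<^bsub>M\<^esub> c \<in> kspan D M bs" "e \<otimes>\<^bsub>A\<^esub> c \<in> D"
    using Cons x D(5) by auto
  ultimately show ?case by auto
qed

lemma kspan_minus:
  assumes "set bs \<subseteq> carrier M" and "x \<in> kspan D M bs"
  shows "\<ominus>\<^bsub>M\<^esub> x \<in> kspan D M bs"
proof -
  have "x \<in> carrier M" using assms kspan_subset by auto
  then have "\<ominus>\<^bsub>M\<^esub> x = x \<star>\<^bsub>M\<^esub> (\<ominus>\<^bsub>A\<^esub> \<one>\<^bsub>A\<^esub>)"
    by (simp add: rsmult_minus_r[OF module] M.rsmult_one)
  then show ?thesis using kspan_smult[OF assms] D(3,6) by simp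
qed

lemma kspan_generator:
  "set bs \<subseteq> carrier M \<Longrightarrow> b \<in> set bs \<Longrightarrow> c \<in> D \<Longrightarrow> b \<star>\<^bsub>M\<^esub> c \<in> kspan D M bs"
proof (induction bs)
  case (Cons b' bs)
  show ?case
  proof (cases "b = b'")
    case True
    moreover have "b \<star>\<^bsub>M\<^esub> c \<oplus>\<^bsub>M\<^esub> \<zero>\<^bsub>M\<^esub> = b \<star>\<^bsub>M\<^esub> c"
      using Cons.prems by (auto simp: D_carrier M.rsmult_closed)
    moreover have "\<zero>\<^bsub>M\<^esub> \<in> kspan D M bs" using Cons.prems kspan_zero by auto
    ultimately show ?thesis using Cons.prems(3) by force
  next
    case False
    then have "b \<star>\<^bsub>M\<^esub> c \<in> kspan D M bs" using Cons by auto
    moreover from this have "b' \<star>\<^bsub>M\<^esub> \<zero>\<^bsub>A\<^esub> \<oplus>\<^bsub>M\<^esub> b \<star>\<^bsub>M\<^esub> c = b \<star>\<^bsub>M\<^esub> c"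
      using Cons.prems kspan_subset[of bs] by (auto simp: rsmult_zero_r[OF module])
    ultimately show ?thesis using D(2) by force
  qed
qed simp

lemma jumps_le: "jumps D M bs U \<le> length bs"
  by (induction bs) auto

lemma jumps_mono: "U \<subseteq> V \<Longrightarrow> jumps D M bs U \<le> jumps D M bs V"
  by (induction bs) (auto simp: subset_eq)

text \<open>This replaces the comparison of dimensions. By induction along the filtration, an
  element of \<open>V\<close> is reduced by an element of \<open>U\<close> with the same leading
  term until only a remainder in the span of the tail is left.\<close>

lemma jumps_eq_imp_subset:
  assumes "rsubmodule A M U" and "rsubmodule A M V" and "U \<subseteq> V"
  shows "set bs \<subseteq> carrier M \<Longrightarrow> jumps D M bs U = jumps D M bs V \<Longrightarrow> V \<inter> kspan D M bs \<subseteq> U"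
proof (induction bs)
  case Nil
  then show ?case using rsubmoduleD(2)[OF assms(1)] by auto
next
  case (Cons b bs)
  note U = rsubmoduleD[OF assms(1)] and V = rsubmoduleD[OF assms(2)]
  note bs = kspan_subset[of bs]
  let ?J = "\<lambda>W. \<exists>n\<in>kspan D M bs. b \<oplus>\<^bsub>M\<^esub> n \<in> W"
  have "?J U \<Longrightarrow> ?J V" using assms(3) by blast
  \<comment> \<open>Both summands of the count are monotone in the submodule, so equal totals force
    equality at every step of the filtration.\<close>
  then have J: "?J U \<longleftrightarrow> ?J V" and eq: "jumps D M bs U = jumps D M bs V"
    using Cons.prems(2) jumps_mono[OF assms(3), of bs] by (auto split: if_splits)
  have IH: "V \<inter> kspan D M bs \<subseteq> U" using Cons.IH Cons.prems eq by auto
  show ?case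
  proof
    fix x assume "x \<in> V \<inter> kspan D M (b # bs)"
    then obtain c n where x: "x \<in> V" "x = b \<star>\<^bsub>M\<^esub> c \<oplus>\<^bsub>M\<^esub> n" "c \<in> D" "n \<in> kspan D M bs" by auto
    have car: "b \<in> carrier M" "n \<in> carrier M" "c \<in> carrier A" "set bs \<subseteq> carrier M"
      using x Cons.prems bs by (auto simp: D_carrier)
    show "x \<in> U"
    proof (cases "c = \<zero>\<^bsub>A\<^esub>")
      case True
      then have "x = n" using x car by (simp add: rsmult_zero_r[OF module])
      then show ?thesis using IH x by auto
    next
      case False
      then obtain e where e: "e \<in> D" "c \<otimes>\<^bsub>A\<^esub> e = \<one>\<^bsub>A\<^esub>" using D(7) x by blast
      \<comment> \<open>Multiplying by the inverse \<open>e\<close> of the leading coefficient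
        \<open>c\<close> turns \<open>x\<close> into an element of \<open>V\<close> with leading
        term \<open>b\<close>. Thus \<open>V\<close> has a jump here, and \<open>U\<close> has one
        as well.\<close>
      have "x \<star>\<^bsub>M\<^esub> e = b \<star>\<^bsub>M\<^esub> c \<star>\<^bsub>M\<^esub> e \<oplus>\<^bsub>M\<^esub> n \<star>\<^bsub>M\<^esub> e"
        unfolding x(2) using e car by (intro M.rsmult_add_l) (auto simp: D_carrier M.rsmult_closed)
      also have "b \<star>\<^bsub>M\<^esub> c \<star>\<^bsub>M\<^esub> e = b"
        using e car by (simp add: M.rsmult_assoc[symmetric] D_carrier M.rsmult_one)
      finally have "b \<oplus>\<^bsub>M\<^esub> n \<star>\<^bsub>M\<^esub> e \<in> V" using V(5)[OF x(1), of e] e by (simp add: D_carrier)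
      then have "?J V" using kspan_smult[of bs n e] x car e by blast
      then obtain m where m: "m \<in> kspan D M bs" "b \<oplus>\<^bsub>M\<^esub> m \<in> U" using J by blast
      \<comment> \<open>What remains of \<open>x\<close> after subtracting the element
        \<open>b + m\<close> of \<open>U\<close> times \<open>c\<close>: the leading terms cancel,
        and \<open>w\<close> still lies in \<open>V\<close>.\<close>
      define w where "w = n \<oplus>\<^bsub>M\<^esub> \<ominus>\<^bsub>M\<^esub> (m \<star>\<^bsub>M\<^esub> c)"
      have mc: "m \<in> carrier M" "m \<star>\<^bsub>M\<^esub> c \<in> carrier M" "b \<star>\<^bsub>M\<^esub> c \<in> carrier M"
        using m car bs by (auto simp: M.rsmult_closed)
      have bm: "(b \<oplus>\<^bsub>M\<^esub> m) \<star>\<^bsub>M\<^esub> c = b \<star>\<^bsub>M\<^esub> c \<oplus>\<^bsub>M\<^esub> m \<star>\<^bsub>M\<^esub> c"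
        using mc car by (simp add: M.rsmult_add_l)
      have xw: "x = (b \<oplus>\<^bsub>M\<^esub> m) \<star>\<^bsub>M\<^esub> c \<oplus>\<^bsub>M\<^esub> w"
        unfolding bm x(2) w_def using mc car by (simp add: M.add_diff_cancel)
      have "w \<in> kspan D M bs"
        unfolding w_def using x m car by (intro kspan_add kspan_minus kspan_smult) auto
      moreover have "w = x \<oplus>\<^bsub>M\<^esub> \<ominus>\<^bsub>M\<^esub> ((b \<oplus>\<^bsub>M\<^esub> m) \<star>\<^bsub>M\<^esub> c)"
        unfolding bm x(2) w_def using mc car by (simp add: M.add_diff_cancel)
      then have "w \<in> V" using x(1) m(2) V U(5)[OF m(2) car(3)] assms(3) by auto
      ultimately have "w \<in> U" using IH by auto
      then show ?thesis unfolding xw using U m(2) car by auto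
    qed
  qed
qed

lemma length_bound_kspan:
  assumes "set bs \<subseteq> carrier M" and "carrier M \<subseteq> kspan D M bs"
  shows "length_bound A M (length bs)"
  unfolding length_bound_def
proof (intro exI[of _ "jumps D M bs"] conjI allI impI)
  fix U V assume *: "rsubmodule A M U \<and> rsubmodule A M V \<and> U \<subset> V"
  then have "V \<inter> kspan D M bs = V" "U \<subseteq> V" "\<not> V \<subseteq> U"
    using assms(2) rsubmoduleD(1)[of A M V] by auto
  then have "jumps D M bs U \<noteq> jumps D M bs V"
    using jumps_eq_imp_subset[of U V bs] assms(1) * by metis
  then show "jumps D M bs U < jumps D M bs V"
    using jumps_mono[OF \<open>U \<subseteq> V\<close>, of bs] by simp
qed (rule jumps_le)

end

text \<open>If finitely many \<open>t\<close> generate \<open>M\<close> over \<open>A\<close> and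
  finitely many \<open>s\<close> span \<open>A\<close> over the field, then the products of
  \<open>t\<close> with \<open>s\<close> span \<open>M\<close> over the field.\<close>

lemma (in fd_algebra) finite_length_modA:
  assumes "M \<in> modA A"
  shows "finite_length A M"
proof -
  note M = modA_module[OF assms]
  interpret M: right_module A M by (rule M)
  \<comment> \<open>The scalar multiples of the unit, a copy of the base field in
    \<open>A\<close>.\<close>
  define D where "D = (\<lambda>c. c \<odot>\<^bsub>A\<^esub> \<one>\<^bsub>A\<^esub>) ` carrier K"
  have mult: "(c \<odot>\<^bsub>A\<^esub> \<one>\<^bsub>A\<^esub>) \<otimes>\<^bsub>A\<^esub> (e \<odot>\<^bsub>A\<^esub> \<one>\<^bsub>A\<^esub>) = (c \<otimes>\<^bsub>K\<^esub> e) \<odot>\<^bsub>A\<^esub> \<one>\<^bsub>A\<^esub>"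
    if "c \<in> carrier K" "e \<in> carrier K" for c e
    using that smult_mult_l[of c "\<one>\<^bsub>A\<^esub>" "e \<odot>\<^bsub>A\<^esub> \<one>\<^bsub>A\<^esub>"] by (simp add: smult_assoc1)
  have Dsub: "D \<subseteq> carrier A" by (auto simp: D_def)
  have D0: "\<zero>\<^bsub>A\<^esub> \<in> D"
    unfolding D_def by (rule image_eqI[of _ _ "\<zero>\<^bsub>K\<^esub>"]) (auto simp: smult_l_null)
  have D1: "\<one>\<^bsub>A\<^esub> \<in> D"
    unfolding D_def by (rule image_eqI[of _ _ "\<one>\<^bsub>K\<^esub>"]) auto
  have Dadd: "x \<oplus>\<^bsub>A\<^esub> y \<in> D" if "x \<in> D" "y \<in> D" for x y
    using that unfolding D_def
    by (auto simp: smult_l_distr[symmetric] intro!: image_eqI[OF refl])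
  have Dmult: "x \<otimes>\<^bsub>A\<^esub> y \<in> D" if "x \<in> D" "y \<in> D" for x y
    using that unfolding D_def by (auto simp: mult)
  have Dneg: "\<ominus>\<^bsub>A\<^esub> x \<in> D" if "x \<in> D" for x
    using that unfolding D_def by (auto simp: smult_l_minus[symmetric] intro!: image_eqI[OF refl])
  have Dinv: "\<exists>y\<in>D. x \<otimes>\<^bsub>A\<^esub> y = \<one>\<^bsub>A\<^esub>" if "x \<in> D" "x \<noteq> \<zero>\<^bsub>A\<^esub>" for x
  proof -
    obtain c where c: "c \<in> carrier K" "x = c \<odot>\<^bsub>A\<^esub> \<one>\<^bsub>A\<^esub>" using \<open>x \<in> D\<close> by (auto simp: D_def)
    then have "c \<noteq> \<zero>\<^bsub>K\<^esub>" using that by (auto simp: smult_l_null)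
    then have "c \<in> Units K" using c(1) by (simp add: K.field_Units)
    then show ?thesis
      using c by (intro bexI[of _ "inv\<^bsub>K\<^esub> c \<odot>\<^bsub>A\<^esub> \<one>\<^bsub>A\<^esub>"]) (auto simp: mult D_def)
  qed
  note Dall = M Dsub D0 D1 Dadd Dmult Dneg Dinv
  obtain S where S: "finite S" "S \<subseteq> carrier A"
    "\<And>x. x \<in> carrier A \<Longrightarrow> \<exists>c\<in>S \<rightarrow> carrier K. x = (\<Oplus>\<^bsub>A\<^esub>s\<in>S. c s \<odot>\<^bsub>A\<^esub> s)"
    using finite_dim by blast
  obtain T where T: "finite T" "T \<subseteq> carrier M" "rspan A M T = carrier M"
    using modA_fg[OF assms] by (auto simp: finitely_generated_def)
  have "finite ((\<lambda>(t, s). t \<star>\<^bsub>M\<^esub> s) ` (T \<times> S))" using S(1) T(1) by simp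
  then obtain bs where bs: "set bs = (\<lambda>(t, s). t \<star>\<^bsub>M\<^esub> s) ` (T \<times> S)"
    using finite_list by metis
  have bsM: "set bs \<subseteq> carrier M"
    unfolding bs using S(2) T(2) M.rsmult_closed by (auto simp: subset_eq)
  note ks = kspan_zero[OF Dall bsM] kspan_add[OF Dall bsM] kspan_generator[OF Dall bsM]
    kspan_subset[OF Dall bsM]
  have gen: "t \<star>\<^bsub>M\<^esub> a \<in> kspan D M bs" if t: "t \<in> T" and a: "a \<in> carrier A" for t a
  proof -
    obtain c where c: "c \<in> S \<rightarrow> carrier K" "a = (\<Oplus>\<^bsub>A\<^esub>s\<in>S. c s \<odot>\<^bsub>A\<^esub> s)"
      using S(3)[OF a] by metis
    have tM: "t \<in> carrier M" using t T by auto
    \<comment> \<open>Stated for all finite parts \<open>F\<close> of \<open>S\<close>, so that the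
      sum expressing \<open>a\<close> can be built up one term at a time.\<close>
    have "F \<subseteq> S \<Longrightarrow> t \<star>\<^bsub>M\<^esub> (\<Oplus>\<^bsub>A\<^esub>s\<in>F. c s \<odot>\<^bsub>A\<^esub> s) \<in> kspan D M bs" if "finite F" for F
      using that
    proof (induction F rule: finite_induct)
      case empty
      then show ?case using ks(1) tM by (simp add: rsmult_zero_r[OF M])
    next
      case (insert s F)
      have cs: "c s \<in> carrier K" "s \<in> carrier A" "s \<in> S" using insert c S(2) by auto
      have F: "(\<lambda>s. c s \<odot>\<^bsub>A\<^esub> s) \<in> F \<rightarrow> carrier A" using insert c S(2) by auto
      have "t \<star>\<^bsub>M\<^esub> (\<Oplus>\<^bsub>A\<^esub>s\<in>insert s F. c s \<odot>\<^bsub>A\<^esub> s) =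
          t \<star>\<^bsub>M\<^esub> (c s \<odot>\<^bsub>A\<^esub> s) \<oplus>\<^bsub>M\<^esub> t \<star>\<^bsub>M\<^esub> (\<Oplus>\<^bsub>A\<^esub>s\<in>F. c s \<odot>\<^bsub>A\<^esub> s)"
        using insert F cs tM by (simp add: M.rsmult_add_r A.finsum_closed)
      moreover have "t \<star>\<^bsub>M\<^esub> (c s \<odot>\<^bsub>A\<^esub> s) = (t \<star>\<^bsub>M\<^esub> s) \<star>\<^bsub>M\<^esub> (c s \<odot>\<^bsub>A\<^esub> \<one>\<^bsub>A\<^esub>)"
        using cs tM smult_mult_r[of "c s" s "\<one>\<^bsub>A\<^esub>"] by (simp add: M.rsmult_assoc[symmetric])
      moreover have "(t \<star>\<^bsub>M\<^esub> s) \<star>\<^bsub>M\<^esub> (c s \<odot>\<^bsub>A\<^esub> \<one>\<^bsub>A\<^esub>) \<in> kspan D M bs"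
        using cs t by (intro ks(3)) (auto simp: D_def bs)
      ultimately show ?case using insert ks(2) by simp
    qed
    from this[OF S(1) subset_refl] show ?thesis using c by simp
  qed
  \<comment> \<open>The span is not visibly stable under \<open>A\<close>. The set of elements all
    of whose multiples lie in the span is, so it is a submodule containing the generators; the
    multiple by one then gives the claim.\<close>
  have "carrier M \<subseteq> {x \<in> carrier M. \<forall>a\<in>carrier A. x \<star>\<^bsub>M\<^esub> a \<in> kspan D M bs}"
  proof (rule rspan_eq_carrierD[OF T(3)])
    show "rsubmodule A M {x \<in> carrier M. \<forall>a\<in>carrier A. x \<star>\<^bsub>M\<^esub> a \<in> kspan D M bs}"
      by (rule rsubmoduleI[OF M])
        (auto simp: M.rsmult_closed rsmult_zero_l[OF M] M.rsmult_add_l M.rsmult_assoc[symmetric]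
          ks(1,2))
    show "T \<subseteq> {x \<in> carrier M. \<forall>a\<in>carrier A. x \<star>\<^bsub>M\<^esub> a \<in> kspan D M bs}"
      using gen T(2) by auto
  qed
  then have "carrier M \<subseteq> kspan D M bs"
    using M.rsmult_one by force
  from length_bound_kspan[OF Dall bsM this] show ?thesis
    by (auto simp: finite_length_def)
qed

section \<open>Fitting's lemma\<close>

lemma funpow_rhom:
  assumes "right_module A M" and "f \<in> rhom A M M"
  shows "restrict (f ^^ n) (carrier M) \<in> rhom A M M"
proof -
  have c: "(f ^^ n) x \<in> carrier M" if "x \<in> carrier M" for x n
    using that assms(2) by (induction n) (auto simp: rhom_closed)
  show ?thesis
  proof (rule rhom_restrictI[OF assms(1) c])
    fix x y assume "x \<in> carrier M" "y \<in> carrier M"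
    then show "(f ^^ n) (x \<oplus>\<^bsub>M\<^esub> y) = (f ^^ n) x \<oplus>\<^bsub>M\<^esub> (f ^^ n) y"
      by (induction n) (auto simp: rhom_add[OF assms(2)] c)
  next
    fix x a assume "x \<in> carrier M" "a \<in> carrier A"
    then show "(f ^^ n) (x \<star>\<^bsub>M\<^esub> a) = (f ^^ n) x \<star>\<^bsub>M\<^esub> a"
      by (induction n) (auto simp: rhom_smult[OF assms(2)] c)
  qed
qed

text \<open>Images of the powers decrease and kernels increase. From the point on where both are
  stable, image and kernel of a power are complementary.\<close>

lemma fitting:
  assumes M: "right_module A M" and "finite_length A M" and f: "f \<in> rhom A M M"
  obtains n where "n > 0"
    and "internal_direct_sum A M ((f ^^ n) ` carrier M) {x \<in> carrier M. (f ^^ n) x = \<zero>\<^bsub>M\<^esub>}"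
proof -
  interpret M: right_module A M by (rule M)
  obtain N where "length_bound A M N"
    using assms(2) by (auto simp: finite_length_def)
  then obtain d where d: "\<And>U V. rsubmodule A M U \<Longrightarrow> rsubmodule A M V \<Longrightarrow> U \<subset> V \<Longrightarrow> d U < d V"
    and N: "\<And>U. rsubmodule A M U \<Longrightarrow> d U \<le> N"
    unfolding length_bound_def by blast
  define I where "I n = (f ^^ n) ` carrier M" for n
  define J where "J n = {x \<in> carrier M. (f ^^ n) x = \<zero>\<^bsub>M\<^esub>}" for n
  note f0 = rhom_zero[OF M M f]
  have I: "rsubmodule A M (I n)" for n
    using rsubmodule_image[OF M M funpow_rhom[OF M f] rsubmodule_carrier[OF M], of n]
    by (simp add: I_def)
  have J: "rsubmodule A M (J n)" for n
    using rsubmodule_vimage[OF M M funpow_rhom[OF M f] rsubmodule_zero[OF M], of n]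
    by (simp add: J_def cong: conj_cong)
  have fM: "(f ^^ n) x \<in> carrier M" if "x \<in> carrier M" for x n
    using that f by (induction n) (auto simp: rhom_closed)
  have Isub: "I (n + m) \<subseteq> I n" for n m
    using fM by (auto simp: I_def funpow_add)
  have pow0: "(f ^^ m) \<zero>\<^bsub>M\<^esub> = \<zero>\<^bsub>M\<^esub>" for m
    by (induction m) (auto simp: f0)
  have Jsub: "J n \<subseteq> J (n + m)" for n m
  proof -
    have "(f ^^ (n + m)) x = (f ^^ m) ((f ^^ n) x)" for x
      by (metis add.commute comp_apply funpow_add)
    then show ?thesis by (auto simp: J_def pow0)
  qed
  have dmono: "d U \<le> d V" if "rsubmodule A M U" "rsubmodule A M V" "U \<subseteq> V" for U V
    using d[of U V] that by (metis le_less psubsetI)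
  \<comment> \<open>One number that records both chains. It is monotone in \<open>n\<close> and at
    most \<open>2 * N\<close>, so it attains a maximum, and from there on neither chain changes. The
    subtraction does not truncate, because \<open>N\<close> bounds \<open>d\<close>.\<close>
  define g where "g n = d (J n) + (N - d (I n))" for n
  have "\<exists>n. \<forall>m. g m \<le> g n"
  proof -
    have "\<forall>m. g m < Suc (2 * N)"
    proof
      fix m show "g m < Suc (2 * N)" using N[OF J, of m] by (auto simp: g_def)
    qed
    then have "\<exists>n. True \<and> (\<forall>m. True \<longrightarrow> g m \<le> g n)"
      by (intro ex_has_greatest_nat[of "\<lambda>_. True" 0 g "Suc (2 * N)"]) simp_all
    then show ?thesis by simp
  qed
  then obtain n where n: "\<And>m. g m \<le> g n" by blast
  have stable: "I (n + m) = I n \<and> J (n + m) = J n" for m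
  proof -
    have "d (I (n + m)) \<le> d (I n)" "d (J n) \<le> d (J (n + m))" "d (I n) \<le> N"
      by (rule dmono[OF I I Isub] dmono[OF J J Jsub] N[OF I])+
    then have "d (I (n + m)) = d (I n)" "d (J (n + m)) = d (J n)"
      using n[of "n + m"] by (auto simp: g_def)
    then show ?thesis
      using d[OF I I, of "n + m" n] d[OF J J, of n "n + m"] Isub[of n m] Jsub[of n m]
      by (metis less_irrefl psubsetI)
  qed
  \<comment> \<open>The successor makes the exponent positive, which allows one factor
    \<open>f\<close> to be split off later.\<close>
  define k where "k = Suc n"
  have kk: "I (k + k) = I k" "J (k + k) = J k"
    using stable[of "Suc 0"] stable[of "Suc (Suc n)"] by (auto simp: k_def)
  have "I k \<inter> J k = {\<zero>\<^bsub>M\<^esub>}"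
  proof -
    have "y = \<zero>\<^bsub>M\<^esub>" if "y \<in> I k" "y \<in> J k" for y
    proof -
      obtain x where x: "x \<in> carrier M" "y = (f ^^ k) x"
        using \<open>y \<in> I k\<close> unfolding I_def by blast
      then have "x \<in> J (k + k)" using that(2) by (simp add: J_def funpow_add)
      then have "x \<in> J k" by (simp only: kk)
      then show ?thesis using x by (simp add: J_def)
    qed
    then show ?thesis using rsubmoduleD(2)[OF I] rsubmoduleD(2)[OF J] by auto
  qed
  moreover have "I k <+>\<^bsub>M\<^esub> J k = carrier M"
  proof
    show "I k <+>\<^bsub>M\<^esub> J k \<subseteq> carrier M"
      using rsubmoduleD(1)[OF I, of k] rsubmoduleD(1)[OF J, of k]
      by (auto simp: set_add_def set_mult_def)
    show "carrier M \<subseteq> I k <+>\<^bsub>M\<^esub> J k"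
    proof
      fix x assume x: "x \<in> carrier M"
      \<comment> \<open>Since the images are stable, the k-th power at \<open>x\<close> equals the
        2k-th power at some \<open>y\<close>. Then \<open>x\<close> differs from the k-th power at
        \<open>y\<close> by an element of the kernel.\<close>
      then have "(f ^^ k) x \<in> I (k + k)" unfolding kk by (auto simp: I_def)
      then obtain y where y: "y \<in> carrier M" "(f ^^ k) x = (f ^^ k) ((f ^^ k) y)"
        unfolding I_def funpow_add by auto
      let ?z = "x \<oplus>\<^bsub>M\<^esub> \<ominus>\<^bsub>M\<^esub> (f ^^ k) y"
      note fk = funpow_rhom[OF M f, of k]
      have "(f ^^ k) ?z = (f ^^ k) x \<oplus>\<^bsub>M\<^esub> \<ominus>\<^bsub>M\<^esub> (f ^^ k) ((f ^^ k) y)"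
        using rhom_add[OF fk, of x "\<ominus>\<^bsub>M\<^esub> (f ^^ k) y"] rhom_minus[OF M M fk, of "(f ^^ k) y"] x y fM
        by simp
      also have "\<dots> = \<zero>\<^bsub>M\<^esub>" using x y fM by (simp add: M.r_neg)
      finally have "?z \<in> J k" using x y fM by (simp add: J_def)
      moreover have "x = (f ^^ k) y \<oplus>\<^bsub>M\<^esub> ?z"
        using x y fM by (simp add: M.a_comm[of x] M.r_neg2)
      moreover have "(f ^^ k) y \<in> I k" using y by (simp add: I_def)
      ultimately show "x \<in> I k <+>\<^bsub>M\<^esub> J k"
        by (auto simp: set_add_def set_mult_def)
    qed
  qed
  ultimately have "internal_direct_sum A M (I k) (J k)"
    using I J by (simp add: internal_direct_sum_def)
  then show thesis by (intro that[of k]) (simp_all add: k_def I_def J_def)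
qed

text \<open>The powers of an injective endomorphism are injective, so the kernel part in Fitting's
  decomposition is zero and the image of a positive power, which lies in the image of
  \<open>f\<close>, is everything.\<close>

lemma inj_endo_bij:
  assumes M: "right_module A M" and "finite_length A M" and f: "f \<in> rhom A M M"
    and inj: "inj_on f (carrier M)"
  shows "bij_betw f (carrier M) (carrier M)"
proof -
  interpret M: right_module A M by (rule M)
  obtain n where n: "n > 0"
    "internal_direct_sum A M ((f ^^ n) ` carrier M) {x \<in> carrier M. (f ^^ n) x = \<zero>\<^bsub>M\<^esub>}"
    using fitting[OF assms(1-3)] .
  have fM: "(f ^^ n) x \<in> carrier M" if "x \<in> carrier M" for x n
    using that f by (induction n) (auto simp: rhom_closed)
  have "(f ^^ n) x = \<zero>\<^bsub>M\<^esub> \<Longrightarrow> x = \<zero>\<^bsub>M\<^esub>" if "x \<in> carrier M" for x n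
    using that
  proof (induction n)
    case (Suc n)
    then show ?case
      using inj_onD[OF inj, of "(f ^^ n) x" "\<zero>\<^bsub>M\<^esub>"] rhom_zero[OF M M f] fM by simp
  qed simp
  then have "{x \<in> carrier M. (f ^^ n) x = \<zero>\<^bsub>M\<^esub>} \<subseteq> {\<zero>\<^bsub>M\<^esub>}" by blast
  then have "{x \<in> carrier M. (f ^^ n) x = \<zero>\<^bsub>M\<^esub>} = {\<zero>\<^bsub>M\<^esub>}"
    using n(2) unfolding internal_direct_sum_def by blast
  then have "carrier M \<subseteq> (f ^^ n) ` carrier M <+>\<^bsub>M\<^esub> {\<zero>\<^bsub>M\<^esub>}"
    using n(2) unfolding internal_direct_sum_def by simp
  also have "\<dots> \<subseteq> (f ^^ n) ` carrier M"
  proof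
    fix y assume "y \<in> (f ^^ n) ` carrier M <+>\<^bsub>M\<^esub> {\<zero>\<^bsub>M\<^esub>}"
    then obtain x where "x \<in> carrier M" "y = (f ^^ n) x \<oplus>\<^bsub>M\<^esub> \<zero>\<^bsub>M\<^esub>"
      unfolding set_add_def set_mult_def by force
    then show "y \<in> (f ^^ n) ` carrier M" using fM[of x n] by simp
  qed
  also have "\<dots> \<subseteq> f ` carrier M"
  proof
    obtain m where "n = Suc m" using n(1) by (cases n) auto
    fix y assume "y \<in> (f ^^ n) ` carrier M"
    then obtain x where "x \<in> carrier M" "y = f ((f ^^ m) x)" using \<open>n = Suc m\<close> by auto
    then show "y \<in> f ` carrier M" using fM[of x m] by blast
  qed
  finally have "carrier M \<subseteq> f ` carrier M" .
  moreover have "f ` carrier M \<subseteq> carrier M" using rhom_closed[OF f] by blast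
  ultimately show ?thesis
    using inj by (simp add: bij_betw_def)
qed

section \<open>Projective modules\<close>

lemma projA_modA: "P \<in> projA A \<Longrightarrow> P \<in> modA A"
  by (simp add: projA_def)

lemma projA_module: "P \<in> projA A \<Longrightarrow> right_module A P"
  by (simp add: projA_modA modA_module)

lemma projA_lift:
  assumes "P \<in> projA A" and "M \<in> modA A" and "N \<in> modA A"
    and "g \<in> rhom A M N" and "g ` carrier M = carrier N" and "f \<in> rhom A P N"
  obtains h where "h \<in> rhom A P M" and "\<And>x. x \<in> carrier P \<Longrightarrow> g (h x) = f x"
proof -
  obtain h where h: "h \<in> rhom A P M" "compose (carrier P) g h = f"
    using assms unfolding projA_def by blast
  show thesis
    by (rule that[OF h(1)]) (use h(2) in \<open>auto simp: compose_eq\<close>)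
qed

lemma projAI:
  assumes "P \<in> modA A"
    and lift: "\<And>M N g f. M \<in> modA A \<Longrightarrow> N \<in> modA A \<Longrightarrow> g \<in> rhom A M N \<Longrightarrow> f \<in> rhom A P N \<Longrightarrow>
      g ` carrier M = carrier N \<Longrightarrow> \<exists>h\<in>rhom A P M. \<forall>x\<in>carrier P. g (h x) = f x"
  shows "P \<in> projA A"
proof -
  have "\<exists>h\<in>rhom A P M. compose (carrier P) g h = f"
    if *: "M \<in> modA A" "N \<in> modA A" "g \<in> rhom A M N" "f \<in> rhom A P N" "g ` carrier M = carrier N"
    for M N g f
  proof -
    obtain h where h: "h \<in> rhom A P M" "\<forall>x\<in>carrier P. g (h x) = f x"
      using lift[OF *] by metis
    have "compose (carrier P) g h = f"
      by (rule rhom_eqI[OF rhom_compose[OF modA_module[OF assms(1)] h(1) *(3)] *(4)])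
        (simp add: compose_eq h(2))
    then show ?thesis using h(1) by metis
  qed
  then show ?thesis unfolding projA_def using assms(1) by simp
qed

lemma projA_retract:
  assumes P: "P \<in> projA A" and N: "N \<in> modA A"
    and u: "u \<in> rhom A N P" and v: "v \<in> rhom A P N"
    and vu: "\<And>x. x \<in> carrier N \<Longrightarrow> v (u x) = x"
  shows "N \<in> projA A"
proof (rule projAI[OF N])
  fix M L g f
  assume *: "M \<in> modA A" "L \<in> modA A" "g \<in> rhom A M L" "f \<in> rhom A N L"
    "g ` carrier M = carrier L"
  obtain h where h: "h \<in> rhom A P M"
    "\<And>x. x \<in> carrier P \<Longrightarrow> g (h x) = compose (carrier P) f v x"
    using projA_lift[OF P *(1,2,3,5) rhom_compose[OF projA_module[OF P] v *(4)]] by metis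
  show "\<exists>h\<in>rhom A N M. \<forall>x\<in>carrier N. g (h x) = f x"
    by (rule bexI[OF _ rhom_compose[OF modA_module[OF N] u h(1)]])
      (simp add: compose_eq h(2) rhom_closed[OF u] vu)
qed

lemma projA_biproduct:
  assumes P: "P \<in> projA A" and Q: "Q \<in> projA A" and S: "S \<in> modA A"
    and "biproduct A P Q S i j p q"
  shows "S \<in> projA A"
proof (rule projAI[OF S])
  note b = biproductD[OF assms(4)] and S' = modA_module[OF S]
  fix M N g f
  assume *: "M \<in> modA A" "N \<in> modA A" "g \<in> rhom A M N" "f \<in> rhom A S N"
    "g ` carrier M = carrier N"
  note M = modA_module[OF *(1)]
  obtain h where h: "h \<in> rhom A P M"
    "\<And>x. x \<in> carrier P \<Longrightarrow> g (h x) = compose (carrier P) f i x"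
    using projA_lift[OF P *(1,2,3,5) rhom_compose[OF projA_module[OF P] b(1) *(4)]] by metis
  obtain k where k: "k \<in> rhom A Q M"
    "\<And>x. x \<in> carrier Q \<Longrightarrow> g (k x) = compose (carrier Q) f j x"
    using projA_lift[OF Q *(1,2,3,5) rhom_compose[OF projA_module[OF Q] b(2) *(4)]] by metis
  show "\<exists>h\<in>rhom A S M. \<forall>x\<in>carrier S. g (h x) = f x"
  proof (rule bexI[OF _ rhom_sum[OF S' M rhom_compose[OF S' b(3) h(1)] rhom_compose[OF S' b(4) k(1)]]],
      rule ballI)
    fix x assume x: "x \<in> carrier S"
    then have c: "p x \<in> carrier P" "q x \<in> carrier Q" using b(3,4) by (simp_all add: rhom_closed)
    have "g (h (p x) \<oplus>\<^bsub>M\<^esub> k (q x)) = f (i (p x)) \<oplus>\<^bsub>N\<^esub> f (j (q x))"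
      using c by (simp add: rhom_add[OF *(3)] rhom_closed[OF h(1)] rhom_closed[OF k(1)]
        h(2) k(2) compose_eq)
    also have "\<dots> = f x"
      using c by (simp add: rhom_add[OF *(4), symmetric] rhom_closed[OF b(1)] rhom_closed[OF b(2)]
        b(9)[OF x])
    finally show "g ((\<lambda>x\<in>carrier S. compose (carrier S) h p x \<oplus>\<^bsub>M\<^esub> compose (carrier S) k q x) x) = f x"
      using x by (simp add: compose_eq)
  qed
qed

lemma zero_modA:
  assumes "M \<in> modA A"
  shows "M\<lparr>carrier := {\<zero>\<^bsub>M\<^esub>}\<rparr> \<in> modA A"
proof -
  note M = right_module_sub[OF modA_module[OF assms] rsubmodule_zero[OF modA_module[OF assms]]]
  have "rspan A (M\<lparr>carrier := {\<zero>\<^bsub>M\<^esub>}\<rparr>) {} = carrier (M\<lparr>carrier := {\<zero>\<^bsub>M\<^esub>}\<rparr>)"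
    by (rule rspan_eq_carrierI[OF M]) (use rsubmoduleD(2) in force)+
  then have "finitely_generated A (M\<lparr>carrier := {\<zero>\<^bsub>M\<^esub>}\<rparr>)"
    unfolding finitely_generated_def by (intro exI[of _ "{}"]) simp
  then show ?thesis using M by (simp add: modA_def)
qed

lemma zero_projA:
  assumes "Z \<in> modA A" and "carrier Z = {\<zero>\<^bsub>Z\<^esub>}"
  shows "Z \<in> projA A"
proof (rule projAI[OF assms(1)])
  note Z = modA_module[OF assms(1)]
  fix M N g f
  assume *: "M \<in> modA A" "N \<in> modA A" "g \<in> rhom A M N" "f \<in> rhom A Z N"
  note M = modA_module[OF *(1)] and N = modA_module[OF *(2)]
  show "\<exists>h\<in>rhom A Z M. \<forall>x\<in>carrier Z. g (h x) = f x"
    by (rule bexI[OF _ rhom_zero_map[OF Z M]])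
      (simp add: assms(2) rhom_zero[OF M N *(3)] rhom_zero[OF Z N *(4)])
qed

text \<open>The zero module is cut out of a given object and so has carriers of the right
  type.\<close>

lemma zero_object:
  assumes "M \<in> modA A"
  obtains Z where "Z \<in> projA A" and "carrier Z = {\<zero>\<^bsub>Z\<^esub>}"
  using zero_projA[OF zero_modA[OF assms]] that[of "M\<lparr>carrier := {\<zero>\<^bsub>M\<^esub>}\<rparr>"] by simp

text \<open>Serves to write a module in the form \<open>Y\<close> plus a projective module when
  there is no projective part.\<close>

lemma biproduct_zero:
  assumes M: "right_module A M" and Z: "right_module A Z" and "carrier Z = {\<zero>\<^bsub>Z\<^esub>}"
  shows "biproduct A M Z M (\<lambda>x\<in>carrier M. x) (\<lambda>x\<in>carrier Z. \<zero>\<^bsub>M\<^esub>)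
    (\<lambda>x\<in>carrier M. x) (\<lambda>x\<in>carrier M. \<zero>\<^bsub>Z\<^esub>)"
proof -
  interpret M: right_module A M by (rule M)
  show ?thesis
    unfolding biproduct_def
    using rhom_id[OF M] rhom_zero_map[OF M Z] rhom_zero_map[OF Z M] assms(3) by simp
qed


section \<open>Homomorphisms factoring through projectives\<close>

lemma factor_projI:
  assumes "right_module A M" and "P \<in> projA A" and "u \<in> rhom A M P" and "v \<in> rhom A P N"
    and "f \<in> rhom A M N" and "\<And>x. x \<in> carrier M \<Longrightarrow> f x = v (u x)"
  shows "f \<in> factor_proj A M N"
proof -
  have "f = compose (carrier M) v u"
    by (rule rhom_eqI[OF assms(5) rhom_compose[OF assms(1,3,4)]]) (simp add: compose_eq assms(6))
  then show ?thesis unfolding factor_proj_def using assms(2-4) by blast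
qed

lemma factor_projE:
  assumes "f \<in> factor_proj A M N"
  obtains P u v where "P \<in> projA A" and "u \<in> rhom A M P" and "v \<in> rhom A P N"
    and "\<And>x. x \<in> carrier M \<Longrightarrow> f x = v (u x)"
proof -
  obtain P u v where "P \<in> projA A" "u \<in> rhom A M P" "v \<in> rhom A P N" "f = compose (carrier M) v u"
    using assms unfolding factor_proj_def by blast
  then show thesis by (intro that[of P u v]) (simp_all add: compose_eq)
qed

lemma factor_proj_rhom: "right_module A M \<Longrightarrow> f \<in> factor_proj A M N \<Longrightarrow> f \<in> rhom A M N"
  unfolding factor_proj_def by (auto intro: rhom_compose)

lemma factor_proj_compose_left:
  assumes M: "right_module A M" and "f \<in> factor_proj A M N" and g: "g \<in> rhom A N L"
  shows "compose (carrier M) g f \<in> factor_proj A M L"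
proof -
  obtain P u v where P: "P \<in> projA A" "u \<in> rhom A M P" "v \<in> rhom A P N"
    "\<And>x. x \<in> carrier M \<Longrightarrow> f x = v (u x)" using factor_projE[OF assms(2)] by metis
  show ?thesis
    by (rule factor_projI[OF M P(1,2) rhom_compose[OF projA_module[OF P(1)] P(3) g]
          rhom_compose[OF M factor_proj_rhom[OF M assms(2)] g]])
      (simp add: compose_eq P(4) rhom_closed[OF P(2)])
qed

lemma factor_proj_compose_right:
  assumes L: "right_module A L" and M: "right_module A M"
    and e: "e \<in> rhom A L M" and "f \<in> factor_proj A M N"
  shows "compose (carrier L) f e \<in> factor_proj A L N"
proof -
  obtain P u v where P: "P \<in> projA A" "u \<in> rhom A M P" "v \<in> rhom A P N"
    "\<And>x. x \<in> carrier M \<Longrightarrow> f x = v (u x)" using factor_projE[OF assms(4)] by metis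
  show ?thesis
    by (rule factor_projI[OF L P(1) rhom_compose[OF L e P(2)] P(3)
          rhom_compose[OF L e factor_proj_rhom[OF M assms(4)]]])
      (simp add: compose_eq P(4) rhom_closed[OF e])
qed

text \<open>The sum factors through the direct sum of the two projective modules.\<close>

lemma factor_proj_sum:
  assumes M: "right_module A M" and N: "right_module A N"
    and f: "f \<in> factor_proj A M N" and g: "g \<in> factor_proj A M N"
  shows "(\<lambda>x\<in>carrier M. f x \<oplus>\<^bsub>N\<^esub> g x) \<in> factor_proj A M N"
proof -
  obtain P u v where P: "P \<in> projA A" "u \<in> rhom A M P" "v \<in> rhom A P N"
    "\<And>x. x \<in> carrier M \<Longrightarrow> f x = v (u x)" using factor_projE[OF f] by metis
  obtain P' u' v' where P': "P' \<in> projA A" "u' \<in> rhom A M P'" "v' \<in> rhom A P' N"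
    "\<And>x. x \<in> carrier M \<Longrightarrow> g x = v' (u' x)" using factor_projE[OF g] by metis
  obtain S i j p q where S: "S \<in> modA A" and bip: "biproduct A P P' S i j p q"
    using biproduct_exists[OF P(1)[THEN projA_modA] P'(1)[THEN projA_modA]] .
  note b = biproductD[OF bip] and Sm = modA_module[OF S]
  interpret S: right_module A S by (rule Sm)
  interpret N: right_module A N by (rule N)
  interpret P: right_module A P by (rule projA_module[OF P(1)])
  interpret P': right_module A P' by (rule projA_module[OF P'(1)])
  note [simp] = rhom_closed[OF P(2)] rhom_closed[OF P(3)] rhom_closed[OF P'(2)] rhom_closed[OF P'(3)]
    biproduct_closed[OF bip] compose_eq b(5-8)
  show ?thesis
  proof (rule factor_projI[OF M projA_biproduct[OF P(1) P'(1) S bip]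
      rhom_sum[OF M Sm rhom_compose[OF M P(2) b(1)] rhom_compose[OF M P'(2) b(2)]]
      rhom_sum[OF Sm N rhom_compose[OF Sm b(3) P(3)] rhom_compose[OF Sm b(4) P'(3)]]
      rhom_sum[OF M N factor_proj_rhom[OF M f] factor_proj_rhom[OF M g]]])
  qed (simp add: P(4) P'(4) rhom_add[OF b(3)] rhom_add[OF b(4)])
qed

lemma factor_proj_zero:
  assumes M: "M \<in> modA A" and N: "right_module A N"
  shows "(\<lambda>x\<in>carrier M. \<zero>\<^bsub>N\<^esub>) \<in> factor_proj A M N"
proof -
  note M' = modA_module[OF M]
  obtain Z where Z: "Z \<in> projA A" "carrier Z = {\<zero>\<^bsub>Z\<^esub>}" using zero_object[OF M] .
  note Zm = projA_module[OF Z(1)]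
  show ?thesis
    by (rule factor_projI[OF M' Z(1) rhom_zero_map[OF M' Zm] rhom_zero_map[OF Zm N]
        rhom_zero_map[OF M' N]]) (simp add: Z(2))
qed

lemma factor_proj_uminus:
  assumes M: "right_module A M" and N: "right_module A N" and f: "f \<in> factor_proj A M N"
  shows "(\<lambda>x\<in>carrier M. \<ominus>\<^bsub>N\<^esub> f x) \<in> factor_proj A M N"
proof -
  note fh = factor_proj_rhom[OF M f]
  have "(\<lambda>x\<in>carrier M. \<ominus>\<^bsub>N\<^esub> f x) =
      compose (carrier M) (\<lambda>x\<in>carrier N. \<ominus>\<^bsub>N\<^esub> (\<lambda>x\<in>carrier N. x) x) f"
    using rhom_closed[OF fh] by (auto simp: compose_def)
  then show ?thesis
    using factor_proj_compose_left[OF M f rhom_uminus[OF N N rhom_id[OF N]]] by simp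
qed


section \<open>Modules without projective summands\<close>

lemma nonproj_modA: "M \<in> nonproj_mod A \<Longrightarrow> M \<in> modA A"
  by (simp add: nonproj_mod_def)

text \<open>If \<open>f\<close> factors through a projective module, then so does the automorphism that its powers
  induce on the bijective part of the Fitting decomposition, which is therefore projective.\<close>

lemma (in fd_algebra) nonproj_fixpoint_zero:
  assumes M: "M \<in> nonproj_mod A" and f: "f \<in> factor_proj A M M"
    and x: "x \<in> carrier M" "f x = x"
  shows "x = \<zero>\<^bsub>M\<^esub>"
proof -
  note M' = nonproj_modA[OF M] and Mm = modA_module[OF nonproj_modA[OF M]]
  interpret M: right_module A M by (rule Mm)
  note fh = factor_proj_rhom[OF Mm f]
  obtain n where n: "n > 0"
    "internal_direct_sum A M ((f ^^ n) ` carrier M) {x \<in> carrier M. (f ^^ n) x = \<zero>\<^bsub>M\<^esub>}"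
    using fitting[OF Mm finite_length_modA[OF M'] fh] .
  define h where "h = restrict (f ^^ n) (carrier M)"
  have h: "h \<in> rhom A M M" unfolding h_def by (rule funpow_rhom[OF Mm fh])
  define U where "U = h ` carrier M"
  define V where "V = {x \<in> carrier M. h x = \<zero>\<^bsub>M\<^esub>}"
  have UV: "internal_direct_sum A M U V"
    using n(2) by (simp add: U_def V_def h_def cong: conj_cong)
  have Usub: "rsubmodule A M U" and UV0: "U \<inter> V = {\<zero>\<^bsub>M\<^esub>}" and sum: "U <+>\<^bsub>M\<^esub> V = carrier M"
    using UV by (simp_all add: internal_direct_sum_def)
  note UM = subsetD[OF rsubmoduleD(1)[OF Usub]]
  let ?U = "M\<lparr>carrier := U\<rparr>"
  have Um: "right_module A ?U" by (rule right_module_sub[OF Mm Usub])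
  \<comment> \<open>The automorphism that the power \<open>h\<close> of \<open>f\<close> induces on
    its own image.\<close>
  define g where "g = restrict h U"
  have g: "g \<in> rhom A ?U ?U"
    unfolding g_def
    by (rule rhom_into_sub[OF rhom_restrict_sub[OF Mm Usub h]]) (use UM in \<open>auto simp: U_def\<close>)
  have "bij_betw g (carrier ?U) (carrier ?U)"
  proof (rule bij_betw_imageI)
    show "inj_on g (carrier ?U)"
    proof (rule rhom_inj_onI[OF Um Um g])
      fix x assume "x \<in> carrier ?U" "g x = \<zero>\<^bsub>?U\<^esub>"
      then have "x \<in> U \<inter> V" using UM by (simp add: g_def V_def)
      then show "x = \<zero>\<^bsub>?U\<^esub>" using UV0 by simp
    qed
    show "g ` carrier ?U = carrier ?U"
    proof
      show "g ` carrier ?U \<subseteq> carrier ?U" using rhom_closed[OF g] by blast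
      show "carrier ?U \<subseteq> g ` carrier ?U"
      proof
        fix y assume "y \<in> carrier ?U"
        then obtain z where z: "z \<in> carrier M" "y = h z" by (auto simp: U_def)
        then obtain u v where uv: "u \<in> U" "v \<in> V" "z = u \<oplus>\<^bsub>M\<^esub> v"
          using sum unfolding set_add_def set_mult_def by force
        then have "y = h u"
          using z(2) rhom_add[OF h, of u v] UM[of u] rhom_closed[OF h, of u] by (simp add: V_def)
        then show "y \<in> g ` carrier ?U" using uv(1) by (simp add: g_def)
      qed
    qed
  qed
  then obtain r where r: "r \<in> rhom A ?U ?U" "\<And>x. x \<in> carrier ?U \<Longrightarrow> r (g x) = x"
    using rhom_inverse[OF Um Um g] by metis
  obtain P u v where P: "P \<in> projA A" "u \<in> rhom A M P" "v \<in> rhom A P M"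
    "\<And>x. x \<in> carrier M \<Longrightarrow> f x = v (u x)" using factor_projE[OF f] by metis
  obtain m where m: "n = Suc m" using n(1) by (cases n) auto
  note fm = funpow_rhom[OF Mm fh, of m] and Pm = projA_module[OF P(1)]
  \<comment> \<open>One factor \<open>f\<close> of the power passes through \<open>P\<close>: the
    other \<open>m\<close> factors and then \<open>u\<close> go into \<open>u'\<close>, so that
    \<open>v\<close> after \<open>u'\<close> is \<open>h\<close> on \<open>U\<close>.\<close>
  define u' where "u' = compose U (compose (carrier M) u (restrict (f ^^ m) (carrier M))) (\<lambda>x\<in>U. x)"
  have u': "u' \<in> rhom A ?U P"
    unfolding u'_def
    using rhom_compose[OF Um rhom_sub_incl[OF Mm Usub] rhom_compose[OF Mm fm P(2)]] by simp
  have hU: "h \<in> rhom A M ?U"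
    by (rule rhom_into_sub[OF h]) (simp add: U_def)
  \<comment> \<open>The map \<open>v\<close> need not end in \<open>U\<close>, so \<open>h\<close>
    is applied once more to land there. The composite with \<open>u'\<close> is then the square of
    \<open>g\<close>, which accounts for the two inverses \<open>r\<close>.\<close>
  define v' where "v' = compose (carrier P) r (compose (carrier P) r (compose (carrier P) h v))"
  have v': "v' \<in> rhom A P ?U"
    unfolding v'_def
    by (rule rhom_compose[OF Pm rhom_compose[OF Pm rhom_compose[OF Pm P(3) hU] r(1)] r(1)])
  have "v' (u' y) = y" if y: "y \<in> carrier ?U" for y
  proof -
    have yM: "y \<in> carrier M" "(f ^^ m) y \<in> carrier M"
      using y UM rhom_closed[OF fm, of y] by auto
    have "v (u' y) = h y"
      using y yM P(4)[OF yM(2)] by (simp add: u'_def h_def m compose_eq)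
    moreover have "h y = g y" "h (g y) = g (g y)"
      using y rhom_closed[OF g, of y] by (simp_all add: g_def)
    ultimately have "v' (u' y) = r (r (g (g y)))"
      using rhom_closed[OF u' y] by (simp add: v'_def compose_eq)
    then show ?thesis using y rhom_closed[OF g, of y] by (simp add: r(2))
  qed
  from projA_retract[OF P(1) modA_summand(1)[OF M' UV] u' v' this]
  have "U = {\<zero>\<^bsub>M\<^esub>}"
    using M UV unfolding nonproj_mod_def no_proj_summand_def by blast
  moreover have "(f ^^ k) x = x" for k
    using x by (induction k) auto
  then have "x \<in> U" unfolding U_def h_def using x(1) by (metis imageI restrict_apply')
  ultimately show ?thesis by simp
qed

text \<open>Converse of the preceding criterion: the projection onto a projective summand, viewed as
  an endomorphism, factors through that summand and fixes it pointwise.\<close>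

lemma nonproj_modI:
  assumes M: "M \<in> modA A"
    and fix0: "\<And>f x. f \<in> factor_proj A M M \<Longrightarrow> x \<in> carrier M \<Longrightarrow> f x = x \<Longrightarrow> x = \<zero>\<^bsub>M\<^esub>"
  shows "M \<in> nonproj_mod A"
proof -
  note Mm = modA_module[OF M]
  have "U = {\<zero>\<^bsub>M\<^esub>}" if UV: "internal_direct_sum A M U V" and U: "M\<lparr>carrier := U\<rparr> \<in> projA A" for U V
  proof -
    obtain p q where
      "biproduct A (M\<lparr>carrier := U\<rparr>) (M\<lparr>carrier := V\<rparr>) M (\<lambda>x\<in>U. x) (\<lambda>x\<in>V. x) p q"
      using biproduct_of_internal[OF Mm UV] .
    note b = biproductD[OF this]
    have Usub: "rsubmodule A M U" using UV by (simp add: internal_direct_sum_def)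
    have "compose (carrier M) (\<lambda>x\<in>U. x) p \<in> factor_proj A M M"
      using factor_projI[OF Mm U b(3,1) rhom_compose[OF Mm b(3,1)]] by (simp add: compose_eq)
    moreover have "compose (carrier M) (\<lambda>x\<in>U. x) p x = x" if "x \<in> U" for x
      using that b(5)[of x] subsetD[OF rsubmoduleD(1)[OF Usub] that] by (simp add: compose_eq)
    ultimately have "U \<subseteq> {\<zero>\<^bsub>M\<^esub>}"
      using fix0 rsubmoduleD(1)[OF Usub] by blast
    then show ?thesis using rsubmoduleD(2)[OF Usub] by blast
  qed
  then show ?thesis using M unfolding nonproj_mod_def no_proj_summand_def by blast
qed

text \<open>An element of the kernel of \<open>p + 1\<close> is a fixed point of \<open>-p\<close>,
  hence zero; finite length turns injectivity into bijectivity.\<close>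

lemma (in fd_algebra) nonproj_bij:
  assumes M: "M \<in> nonproj_mod A" and p: "p \<in> factor_proj A M M" and h: "h \<in> rhom A M M"
    and hp: "\<And>x. x \<in> carrier M \<Longrightarrow> h x = p x \<oplus>\<^bsub>M\<^esub> x"
  shows "bij_betw h (carrier M) (carrier M)"
proof -
  note M' = nonproj_modA[OF M] and Mm = modA_module[OF nonproj_modA[OF M]]
  interpret M: right_module A M by (rule Mm)
  note ph = factor_proj_rhom[OF Mm p]
  have "inj_on h (carrier M)"
  proof (rule rhom_inj_onI[OF Mm Mm h])
    fix x assume x: "x \<in> carrier M" "h x = \<zero>\<^bsub>M\<^esub>"
    then have "x \<oplus>\<^bsub>M\<^esub> p x = \<zero>\<^bsub>M\<^esub>" using hp rhom_closed[OF ph] by (simp add: M.a_comm)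
    then have "\<ominus>\<^bsub>M\<^esub> p x = x"
      using x rhom_closed[OF ph] by (intro M.minus_equality) simp_all
    then show "x = \<zero>\<^bsub>M\<^esub>"
      using x by (intro nonproj_fixpoint_zero[OF M factor_proj_uminus[OF Mm Mm p]]) simp_all
  qed
  then show ?thesis
    by (rule inj_endo_bij[OF Mm finite_length_modA[OF M'] h])
qed

text \<open>Instead of Krull-Schmidt, the fixed point criterion is used together with Gaussian
  elimination: \<open>f\<close> is a matrix whose entries factor through projectives, and the
  equation for the first coordinate can be solved.\<close>

lemma (in fd_algebra) nonproj_biproduct:
  assumes M: "M \<in> nonproj_mod A" and N: "N \<in> nonproj_mod A" and S: "S \<in> modA A"
    and "biproduct A M N S i j p q"
  shows "S \<in> nonproj_mod A"
proof (rule nonproj_modI[OF S])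
  note b = biproductD[OF assms(4)]
  note Mm = modA_module[OF nonproj_modA[OF M]] and Nm = modA_module[OF nonproj_modA[OF N]]
    and Sm = modA_module[OF S]
  interpret M: right_module A M by (rule Mm)
  interpret N: right_module A N by (rule Nm)
  interpret S: right_module A S by (rule Sm)
  fix f s assume f: "f \<in> factor_proj A S S" and s: "s \<in> carrier S" "f s = s"
  note fh = factor_proj_rhom[OF Sm f]
  note [simp] = biproduct_closed[OF assms(4)]
    rhom_closed[OF fh] compose_eq
  \<comment> \<open>The four matrix entries of \<open>f\<close> with respect to \<open>M\<close> and
    \<open>N\<close>.\<close>
  define a where "a = compose (carrier M) (compose (carrier S) p f) i"
  define c where "c = compose (carrier M) (compose (carrier S) q f) i"
  define d where "d = compose (carrier N) (compose (carrier S) p f) j"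
  define e where "e = compose (carrier N) (compose (carrier S) q f) j"
  note pf = factor_proj_compose_left[OF Sm f b(3)] and qf = factor_proj_compose_left[OF Sm f b(4)]
  have a: "a \<in> factor_proj A M M" and c: "c \<in> factor_proj A M N"
    and d: "d \<in> factor_proj A N M" and e: "e \<in> factor_proj A N N"
    unfolding a_def c_def d_def e_def
    by (intro factor_proj_compose_right[OF Mm Sm b(1)] factor_proj_compose_right[OF Nm Sm b(2)] pf qf)+
  note ah = factor_proj_rhom[OF Mm a] and ch = factor_proj_rhom[OF Mm c]
    and dh = factor_proj_rhom[OF Nm d] and eh = factor_proj_rhom[OF Nm e]
  define x where "x = p s"
  define y where "y = q s"
  have xy: "x \<in> carrier M" "y \<in> carrier N" using s by (simp_all add: x_def y_def)
  have s_eq: "s = i x \<oplus>\<^bsub>S\<^esub> j y" using b(9)[OF s(1)] by (simp add: x_def y_def)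
  have fs: "s = f (i x) \<oplus>\<^bsub>S\<^esub> f (j y)"
    using s(2) rhom_add[OF fh, of "i x" "j y"] xy by (simp add: s_eq[symmetric])
  have x_eq: "x = a x \<oplus>\<^bsub>M\<^esub> d y"
    using arg_cong[OF fs, of p] xy by (simp add: rhom_add[OF b(3)] a_def d_def x_def[symmetric])
  have y_eq: "y = c x \<oplus>\<^bsub>N\<^esub> e y"
    using arg_cong[OF fs, of q] xy by (simp add: rhom_add[OF b(4)] c_def e_def y_def[symmetric])
  define a' where "a' = (\<lambda>x\<in>carrier M. \<ominus>\<^bsub>M\<^esub> a x)"
  have a': "a' \<in> factor_proj A M M" unfolding a'_def by (rule factor_proj_uminus[OF Mm Mm a])
  \<comment> \<open>This is \<open>1 - a\<close>, an automorphism of \<open>M\<close>. With its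
    inverse \<open>k\<close>, the first row of \<open>f s = s\<close> becomes
    \<open>x = k (d y)\<close>.\<close>
  define h where "h = (\<lambda>x\<in>carrier M. a' x \<oplus>\<^bsub>M\<^esub> (\<lambda>x\<in>carrier M. x) x)"
  have h: "h \<in> rhom A M M"
    unfolding h_def by (rule rhom_sum[OF Mm Mm factor_proj_rhom[OF Mm a'] rhom_id[OF Mm]])
  have "bij_betw h (carrier M) (carrier M)"
    by (rule nonproj_bij[OF M a' h]) (simp add: h_def)
  then obtain k where k: "k \<in> rhom A M M" "\<And>x. x \<in> carrier M \<Longrightarrow> k (h x) = x"
    using rhom_inverse[OF Mm Mm h] by metis
  have "h x = \<ominus>\<^bsub>M\<^esub> a x \<oplus>\<^bsub>M\<^esub> x"
    using xy by (simp add: h_def a'_def)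
  also have "\<dots> = \<ominus>\<^bsub>M\<^esub> a x \<oplus>\<^bsub>M\<^esub> (a x \<oplus>\<^bsub>M\<^esub> d y)"
    using x_eq by simp
  also have "\<dots> = d y"
    using xy rhom_closed[OF ah] rhom_closed[OF dh] by (simp add: M.r_neg1)
  finally have x_k: "x = k (d y)" using k(2)[OF xy(1)] by simp
  \<comment> \<open>Substituting \<open>x\<close> in the second row: \<open>y\<close> is a fixed
    point of \<open>c k d + e\<close>, which again factors through a projective module.\<close>
  define l where "l = (\<lambda>y\<in>carrier N. compose (carrier N) c (compose (carrier N) k d) y \<oplus>\<^bsub>N\<^esub> e y)"
  have "l \<in> factor_proj A N N"
    unfolding l_def
    by (intro factor_proj_sum[OF Nm Nm _ e] factor_proj_compose_left[OF Nm _ ch]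
        factor_proj_compose_left[OF Nm d k(1)])
  moreover have "l y = y" using xy(2) y_eq x_k by (simp add: l_def)
  ultimately have y0: "y = \<zero>\<^bsub>N\<^esub>" using nonproj_fixpoint_zero[OF N] xy(2) by simp
  then have x0: "x = \<zero>\<^bsub>M\<^esub>" using x_k rhom_zero[OF Nm Mm dh] rhom_zero[OF Mm Mm k(1)] by simp
  show "s = \<zero>\<^bsub>S\<^esub>"
    unfolding s_eq y0 x0 using rhom_zero[OF Mm Sm b(1)] rhom_zero[OF Nm Sm b(2)] by simp
qed

text \<open>Isomorphism in the stable category in terms of representatives: \<open>p\<close> and
  \<open>q\<close> are the deviations of the two composites from the identities.
  \<open>isomorphic_stable_mod_iff\<close> gives the categorical meaning.\<close>

definition stably_isomorphic :: "('a, 'r) ring_scheme \<Rightarrow> 'a obj \<Rightarrow> 'a obj \<Rightarrow> bool" where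
  "stably_isomorphic A M N \<longleftrightarrow> (\<exists>f\<in>rhom A M N. \<exists>g\<in>rhom A N M.
     \<exists>p\<in>factor_proj A M M. \<exists>q\<in>factor_proj A N N.
     (\<forall>x\<in>carrier M. g (f x) = p x \<oplus>\<^bsub>M\<^esub> x) \<and> (\<forall>y\<in>carrier N. f (g y) = q y \<oplus>\<^bsub>N\<^esub> y))"

lemma (in fd_algebra) stably_isomorphic_nonproj:
  assumes M: "M \<in> nonproj_mod A" and N: "N \<in> nonproj_mod A" and "stably_isomorphic A M N"
  shows "rmod_isomorphic A M N"
proof -
  note Mm = modA_module[OF nonproj_modA[OF M]] and Nm = modA_module[OF nonproj_modA[OF N]]
  obtain f g p q where f: "f \<in> rhom A M N" and g: "g \<in> rhom A N M"
    and p: "p \<in> factor_proj A M M" "\<And>x. x \<in> carrier M \<Longrightarrow> g (f x) = p x \<oplus>\<^bsub>M\<^esub> x"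
    and q: "q \<in> factor_proj A N N" "\<And>y. y \<in> carrier N \<Longrightarrow> f (g y) = q y \<oplus>\<^bsub>N\<^esub> y"
    using assms(3) unfolding stably_isomorphic_def by metis
  have gf: "bij_betw (compose (carrier M) g f) (carrier M) (carrier M)"
    by (rule nonproj_bij[OF M p(1) rhom_compose[OF Mm f g]]) (simp add: compose_eq p(2))
  have fg: "bij_betw (compose (carrier N) f g) (carrier N) (carrier N)"
    by (rule nonproj_bij[OF N q(1) rhom_compose[OF Nm g f]]) (simp add: compose_eq q(2))
  have "inj_on f (carrier M)"
    using bij_betw_imp_inj_on[OF gf] by (metis (mono_tags, lifting) compose_eq inj_on_def)
  moreover have "f ` carrier M = carrier N"
  proof
    show "f ` carrier M \<subseteq> carrier N" using rhom_closed[OF f] by blast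
    show "carrier N \<subseteq> f ` carrier M"
    proof
      fix y assume "y \<in> carrier N"
      then obtain z where "z \<in> carrier N" "y = compose (carrier N) f g z"
        using bij_betw_imp_surj_on[OF fg] by blast
      then show "y \<in> f ` carrier M" using rhom_closed[OF g] by (simp add: compose_eq)
    qed
  qed
  ultimately show ?thesis
    unfolding rmod_isomorphic_def bij_betw_def using f by metis
qed

text \<open>Regroups U + (Y + P) as Y + (P + U), which collects projective summands that are split
  off one after the other.\<close>

lemma biproduct_assoc:
  assumes U: "right_module A U" and V: "right_module A V" and M: "right_module A M"
    and Y: "right_module A Y" and P: "right_module A P" and Q: "right_module A Q"
    and "biproduct A U V M i j p q" and "biproduct A Y P V i' j' p' q'"
    and "biproduct A P U Q i'' j'' p'' q''"
  obtains I J F G where "biproduct A Y Q M I J F G"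
proof -
  note b = biproductD[OF assms(7)] and b' = biproductD[OF assms(8)]
    and b'' = biproductD[OF assms(9)]
  interpret U: right_module A U by (rule U)
  interpret V: right_module A V by (rule V)
  interpret M: right_module A M by (rule M)
  interpret Y: right_module A Y by (rule Y)
  interpret P: right_module A P by (rule P)
  interpret Q: right_module A Q by (rule Q)
  note [simp] = biproduct_closed[OF assms(7)]
    biproduct_closed[OF assms(8)]
    rhom_closed[OF b''(1)] rhom_closed[OF b''(2)] rhom_closed[OF b''(3)] rhom_closed[OF b''(4)]
    compose_eq b(5-8) b'(5-8) b''(5-8)
    rhom_add[OF b(1)] rhom_add[OF b(2)] rhom_add[OF b(3)] rhom_add[OF b(4)]
    rhom_add[OF b'(1)] rhom_add[OF b'(2)] rhom_add[OF b'(3)] rhom_add[OF b'(4)]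
    rhom_add[OF b''(1)] rhom_add[OF b''(2)] rhom_add[OF b''(3)] rhom_add[OF b''(4)]
    rhom_zero[OF U M b(1)] rhom_zero[OF V M b(2)] rhom_zero[OF M U b(3)] rhom_zero[OF M V b(4)]
    rhom_zero[OF Y V b'(1)] rhom_zero[OF P V b'(2)] rhom_zero[OF V Y b'(3)] rhom_zero[OF V P b'(4)]
    rhom_zero[OF P Q b''(1)] rhom_zero[OF U Q b''(2)] rhom_zero[OF Q P b''(3)] rhom_zero[OF Q U b''(4)]
  define I where "I = compose (carrier Y) j i'"
  define J where "J = (\<lambda>z\<in>carrier Q. compose (carrier Q) j (compose (carrier Q) j' p'') z \<oplus>\<^bsub>M\<^esub>
    compose (carrier Q) i q'' z)"
  define F where "F = compose (carrier M) p' q"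
  define G where "G = (\<lambda>z\<in>carrier M. compose (carrier M) i'' (compose (carrier M) q' q) z \<oplus>\<^bsub>Q\<^esub>
    compose (carrier M) j'' p z)"
  have "I \<in> rhom A Y M" "J \<in> rhom A Q M" "F \<in> rhom A M Y" "G \<in> rhom A M Q"
    unfolding I_def J_def F_def G_def
    by (rule rhom_compose[OF Y b'(1) b(2)] rhom_compose[OF M b(4) b'(3)]
      rhom_sum[OF Q M rhom_compose[OF Q rhom_compose[OF Q b''(3) b'(2)] b(2)]
        rhom_compose[OF Q b''(4) b(1)]]
      rhom_sum[OF M Q rhom_compose[OF M rhom_compose[OF M b(4) b'(4)] b''(1)]
        rhom_compose[OF M b(3) b''(2)]])+
  moreover have "I (F m) \<oplus>\<^bsub>M\<^esub> J (G m) = m" if m: "m \<in> carrier M" for m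
  proof -
    have "I (F m) \<oplus>\<^bsub>M\<^esub> J (G m) = j (i' (p' (q m))) \<oplus>\<^bsub>M\<^esub> (j (j' (q' (q m))) \<oplus>\<^bsub>M\<^esub> i (p m))"
      using m by (simp add: I_def F_def J_def G_def)
    also have "\<dots> = j (i' (p' (q m)) \<oplus>\<^bsub>V\<^esub> j' (q' (q m))) \<oplus>\<^bsub>M\<^esub> i (p m)"
      using m by (simp add: M.a_assoc)
    also have "\<dots> = j (q m) \<oplus>\<^bsub>M\<^esub> i (p m)"
      using m by (subst b'(9)) simp_all
    finally show ?thesis
      using m b(9)[OF m] by (simp add: M.a_comm)
  qed
  moreover have "G (J z) = z" if "z \<in> carrier Q" for z
    using that b''(9)[OF that] by (simp add: G_def J_def)
  ultimately have "biproduct A Y Q M I J F G"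
    unfolding biproduct_def by (simp add: I_def J_def F_def G_def)
  then show thesis by (rule that)
qed

text \<open>As long as there is a nonzero projective summand \<open>U\<close>, pass to its
  complement \<open>V\<close>, which is strictly shorter, and add \<open>U\<close> to the projective
  part found there.\<close>

lemma (in fd_algebra) nonproj_decomposition:
  assumes "M \<in> modA A"
  obtains Y P i j p q where "Y \<in> nonproj_mod A" and "P \<in> projA A" and "biproduct A Y P M i j p q"
proof -
  have "\<exists>Y P i j p q. Y \<in> nonproj_mod A \<and> P \<in> projA A \<and> biproduct A Y P M i j p q"
    using assms
  proof (induction "len A M" arbitrary: M rule: less_induct)
    case less
    note Mm = modA_module[OF less.prems]
    show ?case
    proof (cases "no_proj_summand A M")
      case True
      obtain Z where Z: "Z \<in> projA A" "carrier Z = {\<zero>\<^bsub>Z\<^esub>}" using zero_object[OF less.prems] .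
      have "M \<in> nonproj_mod A" using True less.prems by (simp add: nonproj_mod_def)
      then show ?thesis
        using Z(1) biproduct_zero[OF Mm projA_module[OF Z(1)] Z(2)] by metis
    next
      case False
      then obtain U V where UV: "internal_direct_sum A M U V" and U: "M\<lparr>carrier := U\<rparr> \<in> projA A"
        and U0: "U \<noteq> {\<zero>\<^bsub>M\<^esub>}"
        unfolding no_proj_summand_def by metis
      let ?U = "M\<lparr>carrier := U\<rparr>" and ?V = "M\<lparr>carrier := V\<rparr>"
      have sub: "rsubmodule A M U" "rsubmodule A M V" "U \<inter> V = {\<zero>\<^bsub>M\<^esub>}"
        using UV by (simp_all add: internal_direct_sum_def)
      have "V \<noteq> carrier M" using sub U0 rsubmoduleD(1)[OF sub(1)] by auto
      then have "len A ?V < len A M"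
        by (rule len_sub_less[OF Mm finite_length_modA[OF less.prems] sub(2)])
      note V = modA_summand(2)[OF less.prems UV]
      obtain Y P i j p q where Y: "Y \<in> nonproj_mod A" and P: "P \<in> projA A"
        and b: "biproduct A Y P ?V i j p q"
        using less.hyps[OF \<open>len A ?V < len A M\<close> V] by metis
      obtain p' q' where b': "biproduct A ?U ?V M (\<lambda>x\<in>U. x) (\<lambda>x\<in>V. x) p' q'"
        using biproduct_of_internal[OF Mm UV] .
      obtain Q i'' j'' p'' q'' where Q: "Q \<in> modA A" and b'': "biproduct A P ?U Q i'' j'' p'' q''"
        using biproduct_exists[OF P[THEN projA_modA] U[THEN projA_modA]] .
      obtain I J F G where "biproduct A Y Q M I J F G"
        using biproduct_assoc[OF projA_module[OF U] modA_module[OF V] Mm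
            modA_module[OF nonproj_modA[OF Y]] projA_module[OF P] modA_module[OF Q] b' b b''] .
      then show ?thesis using Y projA_biproduct[OF P U Q b''] by metis
    qed
  qed
  then show thesis using that by metis
qed

text \<open>The inclusion and the projection of \<open>Y\<close> are mutually inverse up to
  \<open>j q\<close>, which factors through \<open>P\<close>.\<close>

lemma biproduct_proj_stably_isomorphic:
  assumes Y: "Y \<in> modA A" and P: "P \<in> projA A" and M: "M \<in> modA A"
    and "biproduct A Y P M i j p q"
  shows "stably_isomorphic A Y M" and "stably_isomorphic A M Y"
proof -
  note b = biproductD[OF assms(4)] and Ym = modA_module[OF Y] and Mm = modA_module[OF M]
  interpret Y: right_module A Y by (rule Ym)
  interpret M: right_module A M by (rule Mm)
  note [simp] = biproduct_closed[OF assms(4)]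
    compose_eq b(5-8)
  define r where "r = (\<lambda>x\<in>carrier M. \<ominus>\<^bsub>M\<^esub> compose (carrier M) j q x)"
  have "compose (carrier M) j q \<in> factor_proj A M M"
    by (rule factor_projI[OF Mm P b(4,2) rhom_compose[OF Mm b(4,2)]]) simp
  then have r: "r \<in> factor_proj A M M"
    unfolding r_def by (rule factor_proj_uminus[OF Mm Mm])
  have "i (p x) = r x \<oplus>\<^bsub>M\<^esub> x" if x: "x \<in> carrier M" for x
  proof -
    have "r x \<oplus>\<^bsub>M\<^esub> x = \<ominus>\<^bsub>M\<^esub> j (q x) \<oplus>\<^bsub>M\<^esub> (j (q x) \<oplus>\<^bsub>M\<^esub> i (p x))"
      using x b(9)[OF x] by (simp add: r_def M.a_comm)
    then show ?thesis using x by (simp add: M.r_neg1)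
  qed
  moreover have "p (i y) = (\<lambda>y\<in>carrier Y. \<zero>\<^bsub>Y\<^esub>) y \<oplus>\<^bsub>Y\<^esub> y" if "y \<in> carrier Y" for y
    using that by simp
  ultimately show "stably_isomorphic A Y M" "stably_isomorphic A M Y"
    unfolding stably_isomorphic_def
    using b(1,3) r factor_proj_zero[OF Y Ym] by metis+
qed

section \<open>Products and equivalences of categories\<close>

locale category =
  fixes C :: "('o, 'h) cat"
  assumes ident: "X \<in> Obj C \<Longrightarrow> Ident C X \<in> Hom C X X"
    and comp: "\<lbrakk>X \<in> Obj C; Y \<in> Obj C; Z \<in> Obj C; f \<in> Hom C X Y; g \<in> Hom C Y Z\<rbrakk>
      \<Longrightarrow> Comp C X Y Z g f \<in> Hom C X Z"
    and ident_left: "\<lbrakk>X \<in> Obj C; Y \<in> Obj C; f \<in> Hom C X Y\<rbrakk> \<Longrightarrow> Comp C X Y Y (Ident C Y) f = f"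
    and ident_right: "\<lbrakk>X \<in> Obj C; Y \<in> Obj C; f \<in> Hom C X Y\<rbrakk> \<Longrightarrow> Comp C X X Y f (Ident C X) = f"
    and assoc: "\<lbrakk>W \<in> Obj C; X \<in> Obj C; Y \<in> Obj C; Z \<in> Obj C;
        f \<in> Hom C W X; g \<in> Hom C X Y; h \<in> Hom C Y Z\<rbrakk>
      \<Longrightarrow> Comp C W X Z (Comp C X Y Z h g) f = Comp C W Y Z h (Comp C W X Y g f)"
begin

definition isomorphic :: "'o \<Rightarrow> 'o \<Rightarrow> bool" where
  "isomorphic X Y \<longleftrightarrow> (\<exists>f. iso_arr C X Y f)"

lemma iso_arrE:
  assumes "iso_arr C X Y f"
  obtains g where "f \<in> Hom C X Y" and "g \<in> Hom C Y X"
    and "Comp C X Y X g f = Ident C X" and "Comp C Y X Y f g = Ident C Y" and "iso_arr C Y X g"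
  using assms unfolding iso_arr_def by blast

lemma iso_arr_hom: "iso_arr C X Y f \<Longrightarrow> f \<in> Hom C X Y"
  by (simp add: iso_arr_def)

lemma isomorphic_sym: "isomorphic X Y \<Longrightarrow> isomorphic Y X"
  unfolding isomorphic_def iso_arr_def by metis

lemma iso_arr_compose:
  assumes X: "X \<in> Obj C" and Y: "Y \<in> Obj C" and Z: "Z \<in> Obj C"
    and "iso_arr C X Y f" and "iso_arr C Y Z g"
  shows "iso_arr C X Z (Comp C X Y Z g f)"
proof -
  obtain f' where f: "f \<in> Hom C X Y" "f' \<in> Hom C Y X"
    "Comp C X Y X f' f = Ident C X" "Comp C Y X Y f f' = Ident C Y"
    using iso_arrE[OF assms(4)] by metis
  obtain g' where g: "g \<in> Hom C Y Z" "g' \<in> Hom C Z Y"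
    "Comp C Y Z Y g' g = Ident C Y" "Comp C Z Y Z g g' = Ident C Z"
    using iso_arrE[OF assms(5)] by metis
  have "Comp C X Z X (Comp C Z Y X f' g') (Comp C X Y Z g f) =
      Comp C X Y X f' (Comp C X Z Y g' (Comp C X Y Z g f))"
    by (rule assoc[OF X Z Y X comp[OF X Y Z f(1) g(1)] g(2) f(2)])
  also have "Comp C X Z Y g' (Comp C X Y Z g f) = f"
    using assoc[OF X Y Z Y f(1) g(1,2)] by (simp add: g(3) ident_left[OF X Y f(1)])
  finally have 1: "Comp C X Z X (Comp C Z Y X f' g') (Comp C X Y Z g f) = Ident C X"
    by (simp add: f(3))
  have "Comp C Z X Z (Comp C X Y Z g f) (Comp C Z Y X f' g') =
      Comp C Z Y Z g (Comp C Z X Y f (Comp C Z Y X f' g'))"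
    by (rule assoc[OF Z X Y Z comp[OF Z Y X g(2) f(2)] f(1) g(1)])
  also have "Comp C Z X Y f (Comp C Z Y X f' g') = g'"
    using assoc[OF Z Y X Y g(2) f(2,1)] by (simp add: f(4) ident_left[OF Z Y g(2)])
  finally have 2: "Comp C Z X Z (Comp C X Y Z g f) (Comp C Z Y X f' g') = Ident C Z"
    by (simp add: g(4))
  show ?thesis
    unfolding iso_arr_def
    using 1 2 comp[OF X Y Z f(1) g(1)] comp[OF Z Y X g(2) f(2)] by blast
qed

lemma isomorphic_trans:
  "\<lbrakk>X \<in> Obj C; Y \<in> Obj C; Z \<in> Obj C; isomorphic X Y; isomorphic Y Z\<rbrakk> \<Longrightarrow> isomorphic X Z"
  unfolding isomorphic_def using iso_arr_compose by metis

lemma iso_cancel_right: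
  assumes X: "X \<in> Obj C" and Y: "Y \<in> Obj C" and Z: "Z \<in> Obj C" and "iso_arr C X Y e"
    and f: "f \<in> Hom C Y Z" and g: "g \<in> Hom C Y Z" and eq: "Comp C X Y Z f e = Comp C X Y Z g e"
  shows "f = g"
proof -
  obtain e' where e: "e \<in> Hom C X Y" "e' \<in> Hom C Y X" "Comp C Y X Y e e' = Ident C Y"
    using iso_arrE[OF assms(4)] by metis
  have "Comp C Y X Z (Comp C X Y Z h e) e' = h" if "h \<in> Hom C Y Z" for h
    using assoc[OF Y X Y Z e(2,1) that] by (simp add: e(3) ident_right[OF Y Z that])
  from this[OF f] this[OF g] eq show ?thesis by metis
qed

lemma iso_cancel_left:
  assumes X: "X \<in> Obj C" and Y: "Y \<in> Obj C" and Z: "Z \<in> Obj C" and "iso_arr C Y Z e"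
    and f: "f \<in> Hom C X Y" and g: "g \<in> Hom C X Y" and eq: "Comp C X Y Z e f = Comp C X Y Z e g"
  shows "f = g"
proof -
  obtain e' where e: "e \<in> Hom C Y Z" "e' \<in> Hom C Z Y" "Comp C Y Z Y e' e = Ident C Y"
    using iso_arrE[OF assms(4)] by metis
  have "Comp C X Z Y e' (Comp C X Y Z e h) = h" if "h \<in> Hom C X Y" for h
    using assoc[OF X Y Z Y that e(1,2)] by (simp add: e(3) ident_left[OF X Y that])
  from this[OF f] this[OF g] eq show ?thesis by metis
qed

definition is_product :: "'o \<Rightarrow> 'o \<Rightarrow> 'o \<Rightarrow> 'h \<Rightarrow> 'h \<Rightarrow> bool" where
  "is_product P X Y \<pi> \<rho> \<longleftrightarrow> \<pi> \<in> Hom C P X \<and> \<rho> \<in> Hom C P Y \<and>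
     (\<forall>W\<in>Obj C. \<forall>f\<in>Hom C W X. \<forall>g\<in>Hom C W Y.
        \<exists>h\<in>Hom C W P. Comp C W P X \<pi> h = f \<and> Comp C W P Y \<rho> h = g) \<and>
     (\<forall>W\<in>Obj C. \<forall>h\<in>Hom C W P. \<forall>k\<in>Hom C W P.
        Comp C W P X \<pi> h = Comp C W P X \<pi> k \<and> Comp C W P Y \<rho> h = Comp C W P Y \<rho> k \<longrightarrow> h = k)"

lemma is_productD:
  assumes "is_product P X Y \<pi> \<rho>"
  shows "\<pi> \<in> Hom C P X" and "\<rho> \<in> Hom C P Y"
    and "\<And>W f g. W \<in> Obj C \<Longrightarrow> f \<in> Hom C W X \<Longrightarrow> g \<in> Hom C W Y \<Longrightarrow>
      \<exists>h\<in>Hom C W P. Comp C W P X \<pi> h = f \<and> Comp C W P Y \<rho> h = g"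
    and "\<And>W h k. W \<in> Obj C \<Longrightarrow> h \<in> Hom C W P \<Longrightarrow> k \<in> Hom C W P \<Longrightarrow>
      Comp C W P X \<pi> h = Comp C W P X \<pi> k \<Longrightarrow> Comp C W P Y \<rho> h = Comp C W P Y \<rho> k \<Longrightarrow> h = k"
  using assms unfolding is_product_def by blast+

lemma is_product_unique:
  assumes P: "P \<in> Obj C" and Q: "Q \<in> Obj C" and X: "X \<in> Obj C" and Y: "Y \<in> Obj C"
    and "is_product P X Y \<pi> \<rho>" and "is_product Q X Y \<sigma> \<tau>"
  shows "isomorphic P Q"
proof -
  note p = is_productD[OF assms(5)] and q = is_productD[OF assms(6)]
  obtain h where h: "h \<in> Hom C P Q" "Comp C P Q X \<sigma> h = \<pi>" "Comp C P Q Y \<tau> h = \<rho>"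
    using q(3)[OF P p(1,2)] by metis
  obtain k where k: "k \<in> Hom C Q P" "Comp C Q P X \<pi> k = \<sigma>" "Comp C Q P Y \<rho> k = \<tau>"
    using p(3)[OF Q q(1,2)] by metis
  have "Comp C P Q P k h = Ident C P"
    by (rule p(4)[OF P comp[OF P Q P h(1) k(1)] ident[OF P]])
      (simp_all add: assoc[OF P Q P X h(1) k(1) p(1), symmetric]
        assoc[OF P Q P Y h(1) k(1) p(2), symmetric] h k ident_right[OF P X p(1)]
        ident_right[OF P Y p(2)])
  moreover have "Comp C Q P Q h k = Ident C Q"
    by (rule q(4)[OF Q comp[OF Q P Q k(1) h(1)] ident[OF Q]])
      (simp_all add: assoc[OF Q P Q X k(1) h(1) q(1), symmetric]
        assoc[OF Q P Q Y k(1) h(1) q(2), symmetric] h k ident_right[OF Q X q(1)]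
        ident_right[OF Q Y q(2)])
  ultimately show ?thesis
    unfolding isomorphic_def iso_arr_def using h(1) k(1) by metis
qed

text \<open>Needed because the chosen images without projective summands are only isomorphic to the
  values of the functor.\<close>

lemma is_product_iso_factors:
  assumes P: "P \<in> Obj C" and X: "X \<in> Obj C" and Y: "Y \<in> Obj C" and X': "X' \<in> Obj C"
    and Y': "Y' \<in> Obj C" and "is_product P X Y \<pi> \<rho>" and d: "iso_arr C X X' d" and e: "iso_arr C Y Y' e"
  shows "is_product P X' Y' (Comp C P X X' d \<pi>) (Comp C P Y Y' e \<rho>)"
proof -
  note p = is_productD[OF assms(6)]
  obtain d' where d': "d \<in> Hom C X X'" "d' \<in> Hom C X' X" "Comp C X' X X' d d' = Ident C X'"
    using iso_arrE[OF d] by metis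
  obtain e' where e': "e \<in> Hom C Y Y'" "e' \<in> Hom C Y' Y" "Comp C Y' Y Y' e e' = Ident C Y'"
    using iso_arrE[OF e] by metis
  have as: "Comp C W P X' (Comp C P X X' d \<pi>) h = Comp C W X X' d (Comp C W P X \<pi> h)"
    "Comp C W P Y' (Comp C P Y Y' e \<rho>) h = Comp C W Y Y' e (Comp C W P Y \<rho> h)"
    if "W \<in> Obj C" "h \<in> Hom C W P" for W h
    using assoc[OF that(1) P X X' that(2) p(1) d'(1)] assoc[OF that(1) P Y Y' that(2) p(2) e'(1)]
    by simp_all
  show ?thesis
    unfolding is_product_def
  proof (intro conjI ballI impI)
    show "Comp C P X X' d \<pi> \<in> Hom C P X'" "Comp C P Y Y' e \<rho> \<in> Hom C P Y'"
      using comp[OF P X X' p(1) d'(1)] comp[OF P Y Y' p(2) e'(1)] .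
  next
    fix W f g assume W: "W \<in> Obj C" and f: "f \<in> Hom C W X'" and g: "g \<in> Hom C W Y'"
    obtain h where h: "h \<in> Hom C W P" "Comp C W P X \<pi> h = Comp C W X' X d' f"
      "Comp C W P Y \<rho> h = Comp C W Y' Y e' g"
      using p(3)[OF W comp[OF W X' X f d'(2)] comp[OF W Y' Y g e'(2)]] by metis
    have "Comp C W X X' d (Comp C W X' X d' f) = f"
      using assoc[OF W X' X X' f d'(2,1)] ident_left[OF W X' f] by (simp add: d'(3))
    moreover have "Comp C W Y Y' e (Comp C W Y' Y e' g) = g"
      using assoc[OF W Y' Y Y' g e'(2,1)] ident_left[OF W Y' g] by (simp add: e'(3))
    ultimately show "\<exists>h\<in>Hom C W P. Comp C W P X' (Comp C P X X' d \<pi>) h = f \<and>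
        Comp C W P Y' (Comp C P Y Y' e \<rho>) h = g"
      using h as[OF W h(1)] by (intro bexI[OF _ h(1)]) simp
  next
    fix W h k assume W: "W \<in> Obj C" and h: "h \<in> Hom C W P" and k: "k \<in> Hom C W P"
      and eq: "Comp C W P X' (Comp C P X X' d \<pi>) h = Comp C W P X' (Comp C P X X' d \<pi>) k \<and>
        Comp C W P Y' (Comp C P Y Y' e \<rho>) h = Comp C W P Y' (Comp C P Y Y' e \<rho>) k"
    have "Comp C W P X \<pi> h = Comp C W P X \<pi> k"
      by (rule iso_cancel_left[OF W X X' d comp[OF W P X h p(1)] comp[OF W P X k p(1)]])
        (use eq as[OF W h] as[OF W k] in simp)
    moreover have "Comp C W P Y \<rho> h = Comp C W P Y \<rho> k"
      by (rule iso_cancel_left[OF W Y Y' e comp[OF W P Y h p(2)] comp[OF W P Y k p(2)]])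
        (use eq as[OF W h] as[OF W k] in simp)
    ultimately show "h = k" by (rule p(4)[OF W h k])
  qed
qed

end

section \<open>Functors and equivalences\<close>

lemma is_functorD:
  assumes "is_functor C D F"
  shows "\<And>X. X \<in> Obj C \<Longrightarrow> on_obj F X \<in> Obj D"
    and "\<And>X Y f. X \<in> Obj C \<Longrightarrow> Y \<in> Obj C \<Longrightarrow> f \<in> Hom C X Y \<Longrightarrow>
      on_arr F X Y f \<in> Hom D (on_obj F X) (on_obj F Y)"
    and "\<And>X. X \<in> Obj C \<Longrightarrow> on_arr F X X (Ident C X) = Ident D (on_obj F X)"
    and "\<And>X Y Z f g. X \<in> Obj C \<Longrightarrow> Y \<in> Obj C \<Longrightarrow> Z \<in> Obj C \<Longrightarrow> f \<in> Hom C X Y \<Longrightarrow> g \<in> Hom C Y Z \<Longrightarrow>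
      on_arr F X Z (Comp C X Y Z g f) =
      Comp D (on_obj F X) (on_obj F Y) (on_obj F Z) (on_arr F Y Z g) (on_arr F X Y f)"
  using assms unfolding is_functor_def by blast+

lemma is_functor_iso_arr:
  assumes F: "is_functor C D F" and X: "X \<in> Obj C" and Y: "Y \<in> Obj C" and f: "iso_arr C X Y f"
  shows "iso_arr D (on_obj F X) (on_obj F Y) (on_arr F X Y f)"
proof -
  note F' = is_functorD[OF F]
  obtain g where g: "f \<in> Hom C X Y" "g \<in> Hom C Y X" "Comp C X Y X g f = Ident C X"
    "Comp C Y X Y f g = Ident C Y"
    using f unfolding iso_arr_def by metis
  show ?thesis
    unfolding iso_arr_def
    using F'(2)[OF X Y g(1)] F'(2)[OF Y X g(2)] F'(3)[OF X] F'(3)[OF Y]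
      F'(4)[OF X Y X g(1,2)] F'(4)[OF Y X Y g(2,1)] g(3,4) by metis
qed

lemma quasi_inverse_sym: "quasi_inverse C D F G \<Longrightarrow> quasi_inverse D C G F"
  by (simp add: quasi_inverse_def)

locale equivalence = C: category C + D: category D
  for C :: "('o, 'h) cat" and D :: "('p, 'i) cat" +
  fixes F :: "('o, 'h, 'p, 'i) cat_functor" and G :: "('p, 'i, 'o, 'h) cat_functor"
  assumes quasi_inverse: "quasi_inverse C D F G"
begin

lemma is_functors: "is_functor C D F" "is_functor D C G"
  using quasi_inverse by (simp_all add: quasi_inverse_def)

lemmas F = is_functorD[OF is_functors(1)] and G = is_functorD[OF is_functors(2)]

lemma equivalence_sym: "equivalence D C G F"
  by (intro equivalence.intro C.category_axioms D.category_axioms equivalence_axioms.intro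
      quasi_inverse_sym[OF quasi_inverse])

lemma unit:
  obtains \<tau> where "\<And>X. X \<in> Obj C \<Longrightarrow> iso_arr C (on_obj G (on_obj F X)) X (\<tau> X)"
    and "\<And>X Y f. X \<in> Obj C \<Longrightarrow> Y \<in> Obj C \<Longrightarrow> f \<in> Hom C X Y \<Longrightarrow>
      Comp C (on_obj G (on_obj F X)) (on_obj G (on_obj F Y)) Y (\<tau> Y)
        (on_arr G (on_obj F X) (on_obj F Y) (on_arr F X Y f)) =
      Comp C (on_obj G (on_obj F X)) X Y f (\<tau> X)"
proof -
  obtain \<tau> where "\<forall>X\<in>Obj C. iso_arr C (on_obj G (on_obj F X)) X (\<tau> X)"
    "\<forall>X\<in>Obj C. \<forall>Y\<in>Obj C. \<forall>f\<in>Hom C X Y.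
      Comp C (on_obj G (on_obj F X)) (on_obj G (on_obj F Y)) Y (\<tau> Y)
        (on_arr G (on_obj F X) (on_obj F Y) (on_arr F X Y f)) =
      Comp C (on_obj G (on_obj F X)) X Y f (\<tau> X)"
    using quasi_inverse
    unfolding quasi_inverse_def naturally_isomorphic_def comp_functor_def id_functor_def
    by auto
  then show thesis by (intro that[of \<tau>]) simp_all
qed

lemma isomorphic_unit: "X \<in> Obj C \<Longrightarrow> C.isomorphic (on_obj G (on_obj F X)) X"
  using unit unfolding C.isomorphic_def by metis

lemma isomorphic_obj:
  "X \<in> Obj C \<Longrightarrow> Y \<in> Obj C \<Longrightarrow> C.isomorphic X Y \<Longrightarrow> D.isomorphic (on_obj F X) (on_obj F Y)"
  unfolding C.isomorphic_def D.isomorphic_def using is_functor_iso_arr[OF is_functors(1)] by metis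

text \<open>By naturality of the isomorphism \<open>\<tau>\<close> from \<open>G F\<close> to the
  identity, \<open>f\<close> is determined by \<open>G (F f)\<close>.\<close>

lemma faithful:
  assumes X: "X \<in> Obj C" and Y: "Y \<in> Obj C" and f: "f \<in> Hom C X Y" and g: "g \<in> Hom C X Y"
    and eq: "on_arr F X Y f = on_arr F X Y g"
  shows "f = g"
proof -
  obtain \<tau> where \<tau>: "\<And>X. X \<in> Obj C \<Longrightarrow> iso_arr C (on_obj G (on_obj F X)) X (\<tau> X)"
    "\<And>X Y f. X \<in> Obj C \<Longrightarrow> Y \<in> Obj C \<Longrightarrow> f \<in> Hom C X Y \<Longrightarrow>
      Comp C (on_obj G (on_obj F X)) (on_obj G (on_obj F Y)) Y (\<tau> Y)
        (on_arr G (on_obj F X) (on_obj F Y) (on_arr F X Y f)) =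
      Comp C (on_obj G (on_obj F X)) X Y f (\<tau> X)"
    using unit by metis
  show ?thesis
    by (rule C.iso_cancel_right[OF G(1)[OF F(1)[OF X]] X Y \<tau>(1)[OF X] f g])
      (simp add: \<tau>(2)[OF X Y f, symmetric] \<tau>(2)[OF X Y g, symmetric] eq)
qed

text \<open>The preimage is the conjugate of \<open>G h\<close> under \<open>\<tau>\<close>.
  Naturality gives \<open>G (F f) = G h\<close>, and \<open>G\<close> is faithful by the symmetric
  instance \<open>op\<close>.\<close>

lemma full:
  assumes X: "X \<in> Obj C" and Y: "Y \<in> Obj C" and h: "h \<in> Hom D (on_obj F X) (on_obj F Y)"
  obtains f where "f \<in> Hom C X Y" and "on_arr F X Y f = h"
proof -
  interpret op: equivalence D C G F by (rule equivalence_sym)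
  obtain \<tau> where \<tau>: "\<And>X. X \<in> Obj C \<Longrightarrow> iso_arr C (on_obj G (on_obj F X)) X (\<tau> X)"
    "\<And>X Y f. X \<in> Obj C \<Longrightarrow> Y \<in> Obj C \<Longrightarrow> f \<in> Hom C X Y \<Longrightarrow>
      Comp C (on_obj G (on_obj F X)) (on_obj G (on_obj F Y)) Y (\<tau> Y)
        (on_arr G (on_obj F X) (on_obj F Y) (on_arr F X Y f)) =
      Comp C (on_obj G (on_obj F X)) X Y f (\<tau> X)"
    using unit by metis
  note FX = F(1)[OF X] and FY = F(1)[OF Y]
  note GFX = G(1)[OF FX] and GFY = G(1)[OF FY]
  obtain t where t: "\<tau> X \<in> Hom C (on_obj G (on_obj F X)) X" "t \<in> Hom C X (on_obj G (on_obj F X))"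
    "Comp C (on_obj G (on_obj F X)) X (on_obj G (on_obj F X)) t (\<tau> X) = Ident C (on_obj G (on_obj F X))"
    using C.iso_arrE[OF \<tau>(1)[OF X]] by metis
  note tY = C.iso_arr_hom[OF \<tau>(1)[OF Y]]
  note Gh = G(2)[OF FX FY h]
  define e where "e = Comp C (on_obj G (on_obj F X)) (on_obj G (on_obj F Y)) Y (\<tau> Y)
    (on_arr G (on_obj F X) (on_obj F Y) h)"
  have e: "e \<in> Hom C (on_obj G (on_obj F X)) Y"
    unfolding e_def by (rule C.comp[OF GFX GFY Y Gh tY])
  \<comment> \<open>Since \<open>t\<close> is the inverse of \<open>\<tau>\<close> at
    \<open>X\<close>, this is \<open>\<tau>\<close> at \<open>Y\<close> after \<open>G h\<close>
    after the inverse of \<open>\<tau>\<close> at \<open>X\<close>.\<close>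
  define f where "f = Comp C X (on_obj G (on_obj F X)) Y e t"
  have f: "f \<in> Hom C X Y" unfolding f_def by (rule C.comp[OF X GFX Y t(2) e])
  note Ff = F(2)[OF X Y f]
  have "Comp C (on_obj G (on_obj F X)) X Y f (\<tau> X) = e"
    unfolding f_def using C.assoc[OF GFX X GFX Y t(1,2) e] by (simp add: t(3) C.ident_right[OF GFX Y e])
  then have "on_arr G (on_obj F X) (on_obj F Y) (on_arr F X Y f) = on_arr G (on_obj F X) (on_obj F Y) h"
    by (intro C.iso_cancel_left[OF GFX GFY Y \<tau>(1)[OF Y] G(2)[OF FX FY Ff] Gh])
      (simp add: \<tau>(2)[OF X Y f] e_def)
  then have "on_arr F X Y f = h" by (rule op.faithful[OF FX FY Ff h])
  then show thesis using that f by metis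
qed

text \<open>Every object \<open>W\<close> of the target is isomorphic to some \<open>F V\<close>.
  Arrows out of \<open>W\<close> are precomposed with that isomorphism and lifted to arrows out of
  \<open>V\<close>: fullness yields existence of the mediating arrow, faithfulness its
  uniqueness.\<close>

lemma preserves_product:
  assumes P: "P \<in> Obj C" and X: "X \<in> Obj C" and Y: "Y \<in> Obj C" and "C.is_product P X Y \<pi> \<rho>"
  shows "D.is_product (on_obj F P) (on_obj F X) (on_obj F Y) (on_arr F P X \<pi>) (on_arr F P Y \<rho>)"
proof -
  interpret op: equivalence D C G F by (rule equivalence_sym)
  note p = C.is_productD[OF assms(4)]
  note FP = F(1)[OF P] and FX = F(1)[OF X] and FY = F(1)[OF Y]
  note F\<pi> = F(2)[OF P X p(1)] and F\<rho> = F(2)[OF P Y p(2)]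
  \<comment> \<open>The object \<open>V\<close> is \<open>G W\<close>; the counit supplies the
    isomorphism.\<close>
  have cover: "\<exists>V s s'. V \<in> Obj C \<and> iso_arr D (on_obj F V) W s \<and>
      s' \<in> Hom D W (on_obj F V) \<and> Comp D W (on_obj F V) W s s' = Ident D W" if "W \<in> Obj D" for W
    using op.isomorphic_unit[OF that] G(1)[OF that] D.iso_arrE unfolding D.isomorphic_def by metis
  show ?thesis
    unfolding D.is_product_def
  proof (intro conjI ballI impI F\<pi> F\<rho>)
    fix W f g assume W: "W \<in> Obj D" and f: "f \<in> Hom D W (on_obj F X)" and g: "g \<in> Hom D W (on_obj F Y)"
    obtain V s s' where V: "V \<in> Obj C" and "iso_arr D (on_obj F V) W s"
      and s': "s' \<in> Hom D W (on_obj F V)" "Comp D W (on_obj F V) W s s' = Ident D W"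
      using cover[OF W] by metis
    note FV = F(1)[OF V] and s = D.iso_arr_hom[OF \<open>iso_arr D (on_obj F V) W s\<close>]
    obtain f' where f': "f' \<in> Hom C V X" "on_arr F V X f' = Comp D (on_obj F V) W (on_obj F X) f s"
      using full[OF V X D.comp[OF FV W FX s f]] by metis
    obtain g' where g': "g' \<in> Hom C V Y" "on_arr F V Y g' = Comp D (on_obj F V) W (on_obj F Y) g s"
      using full[OF V Y D.comp[OF FV W FY s g]] by metis
    obtain h where h: "h \<in> Hom C V P" "Comp C V P X \<pi> h = f'" "Comp C V P Y \<rho> h = g'"
      using p(3)[OF V f'(1) g'(1)] by metis
    note Fh = F(2)[OF V P h(1)]
    have "Comp D W (on_obj F P) (on_obj F X) (on_arr F P X \<pi>)
        (Comp D W (on_obj F V) (on_obj F P) (on_arr F V P h) s') =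
      Comp D W (on_obj F V) (on_obj F X) (Comp D (on_obj F V) W (on_obj F X) f s) s'"
      using D.assoc[OF W FV FP FX s'(1) Fh F\<pi>] F(4)[OF V P X h(1) p(1)] h(2) f'(2) by simp
    also have "\<dots> = f"
      using D.assoc[OF W FV W FX s'(1) s f] D.ident_right[OF W FX f] s'(2) by simp
    finally have 1: "Comp D W (on_obj F P) (on_obj F X) (on_arr F P X \<pi>)
        (Comp D W (on_obj F V) (on_obj F P) (on_arr F V P h) s') = f" .
    have "Comp D W (on_obj F P) (on_obj F Y) (on_arr F P Y \<rho>)
        (Comp D W (on_obj F V) (on_obj F P) (on_arr F V P h) s') =
      Comp D W (on_obj F V) (on_obj F Y) (Comp D (on_obj F V) W (on_obj F Y) g s) s'"
      using D.assoc[OF W FV FP FY s'(1) Fh F\<rho>] F(4)[OF V P Y h(1) p(2)] h(3) g'(2) by simp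
    also have "\<dots> = g"
      using D.assoc[OF W FV W FY s'(1) s g] D.ident_right[OF W FY g] s'(2) by simp
    finally show "\<exists>h\<in>Hom D W (on_obj F P). Comp D W (on_obj F P) (on_obj F X) (on_arr F P X \<pi>) h = f \<and>
        Comp D W (on_obj F P) (on_obj F Y) (on_arr F P Y \<rho>) h = g"
      using 1 D.comp[OF W FV FP s'(1) Fh] by metis
  next
    fix W h k assume W: "W \<in> Obj D" and h: "h \<in> Hom D W (on_obj F P)" and k: "k \<in> Hom D W (on_obj F P)"
      and eq: "Comp D W (on_obj F P) (on_obj F X) (on_arr F P X \<pi>) h =
          Comp D W (on_obj F P) (on_obj F X) (on_arr F P X \<pi>) k \<and>
        Comp D W (on_obj F P) (on_obj F Y) (on_arr F P Y \<rho>) h =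
          Comp D W (on_obj F P) (on_obj F Y) (on_arr F P Y \<rho>) k"
    obtain V s where V: "V \<in> Obj C" and iso: "iso_arr D (on_obj F V) W s"
      using cover[OF W] by metis
    note FV = F(1)[OF V] and s = D.iso_arr_hom[OF iso]
    obtain h' where h': "h' \<in> Hom C V P" "on_arr F V P h' = Comp D (on_obj F V) W (on_obj F P) h s"
      using full[OF V P D.comp[OF FV W FP s h]] by metis
    obtain k' where k': "k' \<in> Hom C V P" "on_arr F V P k' = Comp D (on_obj F V) W (on_obj F P) k s"
      using full[OF V P D.comp[OF FV W FP s k]] by metis
    have "Comp C V P X \<pi> h' = Comp C V P X \<pi> k'"
      by (rule faithful[OF V X C.comp[OF V P X h'(1) p(1)] C.comp[OF V P X k'(1) p(1)]])
        (simp add: F(4)[OF V P X h'(1) p(1)] F(4)[OF V P X k'(1) p(1)] h'(2) k'(2)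
          D.assoc[OF FV W FP FX s h F\<pi>, symmetric] D.assoc[OF FV W FP FX s k F\<pi>, symmetric] eq)
    moreover have "Comp C V P Y \<rho> h' = Comp C V P Y \<rho> k'"
      by (rule faithful[OF V Y C.comp[OF V P Y h'(1) p(2)] C.comp[OF V P Y k'(1) p(2)]])
        (simp add: F(4)[OF V P Y h'(1) p(2)] F(4)[OF V P Y k'(1) p(2)] h'(2) k'(2)
          D.assoc[OF FV W FP FY s h F\<rho>, symmetric] D.assoc[OF FV W FP FY s k F\<rho>, symmetric] eq)
    ultimately have "h' = k'" by (rule p(4)[OF V h'(1) k'(1)])
    then show "h = k"
      using h'(2) k'(2) by (intro D.iso_cancel_right[OF FV W FP iso h k]) simp
  qed
qed

end


section \<open>The stable module category\<close>

lemma hom_group_simps: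
  "carrier (hom_group A M N) = rhom A M N"
  "f \<otimes>\<^bsub>hom_group A M N\<^esub> g = (\<lambda>x\<in>carrier M. f x \<oplus>\<^bsub>N\<^esub> g x)"
  "\<one>\<^bsub>hom_group A M N\<^esub> = (\<lambda>x\<in>carrier M. \<zero>\<^bsub>N\<^esub>)"
  by (simp_all add: hom_group_def)

lemma hom_group_comm_group:
  assumes M: "right_module A M" and N: "right_module A N"
  shows "comm_group (hom_group A M N)"
proof -
  interpret N: right_module A N by (rule N)
  note sum = rhom_sum[OF M N] and zero = rhom_zero_map[OF M N] and neg = rhom_uminus[OF M N]
  show ?thesis
  proof (rule comm_groupI)
    fix f g h
    assume f: "f \<in> carrier (hom_group A M N)" and g: "g \<in> carrier (hom_group A M N)"
      and h: "h \<in> carrier (hom_group A M N)"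
    then have *: "f \<in> rhom A M N" "g \<in> rhom A M N" "h \<in> rhom A M N" by (simp_all add: hom_group_simps)
    show "f \<otimes>\<^bsub>hom_group A M N\<^esub> g \<otimes>\<^bsub>hom_group A M N\<^esub> h =
        f \<otimes>\<^bsub>hom_group A M N\<^esub> (g \<otimes>\<^bsub>hom_group A M N\<^esub> h)"
      by (rule ext) (simp add: hom_group_simps restrict_def N.a_assoc rhom_closed[OF *(1)]
          rhom_closed[OF *(2)] rhom_closed[OF *(3)])
  next
    fix f g assume "f \<in> carrier (hom_group A M N)" "g \<in> carrier (hom_group A M N)"
    then have *: "f \<in> rhom A M N" "g \<in> rhom A M N" by (simp_all add: hom_group_simps)
    show "f \<otimes>\<^bsub>hom_group A M N\<^esub> g \<in> carrier (hom_group A M N)"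
      using sum[OF *] by (simp add: hom_group_simps)
    show "f \<otimes>\<^bsub>hom_group A M N\<^esub> g = g \<otimes>\<^bsub>hom_group A M N\<^esub> f"
      by (rule ext) (simp add: hom_group_simps restrict_def N.a_comm rhom_closed[OF *(1)]
          rhom_closed[OF *(2)])
  next
    fix f assume "f \<in> carrier (hom_group A M N)"
    then have f: "f \<in> rhom A M N" by (simp add: hom_group_simps)
    show "\<one>\<^bsub>hom_group A M N\<^esub> \<otimes>\<^bsub>hom_group A M N\<^esub> f = f"
      unfolding hom_group_simps
      by (rule rhom_eqI[OF sum[OF zero f] f]) (simp add: rhom_closed[OF f])
    show "\<exists>g\<in>carrier (hom_group A M N). g \<otimes>\<^bsub>hom_group A M N\<^esub> f = \<one>\<^bsub>hom_group A M N\<^esub>"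
      unfolding hom_group_simps
      by (rule bexI[OF _ neg[OF f]])
        (rule rhom_eqI[OF sum[OF neg[OF f] f] zero], simp add: rhom_closed[OF f] N.l_neg)
  qed (simp add: hom_group_simps zero)
qed

lemma factor_proj_subgroup:
  assumes M: "M \<in> modA A" and N: "N \<in> modA A"
  shows "subgroup (factor_proj A M N) (hom_group A M N)"
proof -
  note Mm = modA_module[OF M] and Nm = modA_module[OF N]
  interpret N: right_module A N by (rule Nm)
  interpret H: comm_group "hom_group A M N" by (rule hom_group_comm_group[OF Mm Nm])
  show ?thesis
  proof (rule H.subgroupI)
    show "factor_proj A M N \<subseteq> carrier (hom_group A M N)"
      using factor_proj_rhom[OF Mm] by (auto simp: hom_group_simps)
    show "factor_proj A M N \<noteq> {}" using factor_proj_zero[OF M Nm] by blast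
    fix f assume f: "f \<in> factor_proj A M N"
    note fh = factor_proj_rhom[OF Mm f]
    have "inv\<^bsub>hom_group A M N\<^esub> f = (\<lambda>x\<in>carrier M. \<ominus>\<^bsub>N\<^esub> f x)"
    proof (rule H.inv_equality)
      show "(\<lambda>x\<in>carrier M. \<ominus>\<^bsub>N\<^esub> f x) \<otimes>\<^bsub>hom_group A M N\<^esub> f = \<one>\<^bsub>hom_group A M N\<^esub>"
        by (rule ext) (simp add: hom_group_simps restrict_def N.l_neg rhom_closed[OF fh])
    qed (simp_all add: hom_group_simps fh rhom_uminus[OF Mm Nm fh])
    then show "inv\<^bsub>hom_group A M N\<^esub> f \<in> factor_proj A M N"
      using factor_proj_uminus[OF Mm Nm f] by simp
    fix g assume g: "g \<in> factor_proj A M N"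
    show "f \<otimes>\<^bsub>hom_group A M N\<^esub> g \<in> factor_proj A M N"
      using factor_proj_sum[OF Mm Nm f g] by (simp add: hom_group_simps)
  qed
qed

context
  fixes A :: "('a, 'r) ring_scheme" and M N :: "'a obj"
  assumes M: "M \<in> modA A" and N: "N \<in> modA A"
begin

interpretation H: comm_group "hom_group A M N"
  by (rule hom_group_comm_group[OF modA_module[OF M] modA_module[OF N]])

lemma mem_stable_class_iff:
  assumes f: "f \<in> rhom A M N"
  shows "g \<in> stable_class A M N f \<longleftrightarrow>
    g \<in> rhom A M N \<and> (\<exists>p\<in>factor_proj A M N. \<forall>x\<in>carrier M. g x = p x \<oplus>\<^bsub>N\<^esub> f x)"
proof -
  note Mm = modA_module[OF M] and Nm = modA_module[OF N]
  have "g \<in> stable_class A M N f \<longleftrightarrow>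
      (\<exists>p\<in>factor_proj A M N. g = (\<lambda>x\<in>carrier M. p x \<oplus>\<^bsub>N\<^esub> f x))"
    by (auto simp: stable_class_def r_coset_def hom_group_simps)
  also have "\<dots> \<longleftrightarrow> g \<in> rhom A M N \<and>
      (\<exists>p\<in>factor_proj A M N. \<forall>x\<in>carrier M. g x = p x \<oplus>\<^bsub>N\<^esub> f x)"
  proof (safe)
    fix p assume "p \<in> factor_proj A M N"
    then show "(\<lambda>x\<in>carrier M. p x \<oplus>\<^bsub>N\<^esub> f x) \<in> rhom A M N"
      by (rule rhom_sum[OF Mm Nm factor_proj_rhom[OF Mm] f])
    then show "\<exists>q\<in>factor_proj A M N. \<forall>x\<in>carrier M. (\<lambda>x\<in>carrier M. p x \<oplus>\<^bsub>N\<^esub> f x) x = q x \<oplus>\<^bsub>N\<^esub> f x"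
      using \<open>p \<in> factor_proj A M N\<close> by (intro bexI[of _ p]) simp_all
  next
    fix p assume g: "g \<in> rhom A M N" and p: "p \<in> factor_proj A M N"
      and eq: "\<forall>x\<in>carrier M. g x = p x \<oplus>\<^bsub>N\<^esub> f x"
    have "g = (\<lambda>x\<in>carrier M. p x \<oplus>\<^bsub>N\<^esub> f x)"
      by (rule rhom_eqI[OF g rhom_sum[OF Mm Nm factor_proj_rhom[OF Mm p] f]]) (simp add: eq)
    then show "\<exists>p\<in>factor_proj A M N. g = (\<lambda>x\<in>carrier M. p x \<oplus>\<^bsub>N\<^esub> f x)"
      using p by metis
  qed
  finally show ?thesis .
qed

lemma stable_class_self: "f \<in> rhom A M N \<Longrightarrow> f \<in> stable_class A M N f"
  unfolding stable_class_def
  by (rule H.rcos_self[OF _ factor_proj_subgroup[OF M N]]) (simp add: hom_group_simps)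

lemma stable_class_eqI:
  "g \<in> stable_class A M N f \<Longrightarrow> f \<in> rhom A M N \<Longrightarrow> stable_class A M N g = stable_class A M N f"
  unfolding stable_class_def
  using H.repr_independence[OF _ _ factor_proj_subgroup[OF M N], of g f]
  by (simp add: hom_group_simps)

lemma stable_class_eq_iff:
  assumes "f \<in> rhom A M N" and "g \<in> rhom A M N"
  shows "stable_class A M N g = stable_class A M N f \<longleftrightarrow>
    (\<exists>p\<in>factor_proj A M N. \<forall>x\<in>carrier M. g x = p x \<oplus>\<^bsub>N\<^esub> f x)"
  using mem_stable_class_iff[OF assms(1), of g] stable_class_self[OF assms(2)]
    stable_class_eqI[OF _ assms(1), of g] assms(2) by metis

lemma stable_hom_iff: "\<Phi> \<in> Hom (stable_mod A) M N \<longleftrightarrow> (\<exists>f\<in>rhom A M N. \<Phi> = stable_class A M N f)"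
  by (auto simp: stable_mod_def FactGroup_def RCOSETS_def stable_class_def hom_group_simps)

end

text \<open>Composition of classes is defined as a union over all representatives; it has to be
  checked that every choice contributes the same class.\<close>

lemma stable_comp:
  assumes L: "L \<in> modA A" and M: "M \<in> modA A" and N: "N \<in> modA A"
    and f: "f \<in> rhom A L M" and g: "g \<in> rhom A M N"
  shows "Comp (stable_mod A) L M N (stable_class A M N g) (stable_class A L M f) =
    stable_class A L N (compose (carrier L) g f)"
proof -
  note Lm = modA_module[OF L] and Mm = modA_module[OF M] and Nm = modA_module[OF N]
  interpret N: right_module A N by (rule Nm)
  have *: "stable_class A L N (compose (carrier L) g' f') = stable_class A L N (compose (carrier L) g f)"
    if g'_in: "g' \<in> stable_class A M N g" and f'_in: "f' \<in> stable_class A L M f" for g' f'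
  proof -
    obtain p where g': "g' \<in> rhom A M N" and p: "p \<in> factor_proj A M N"
      "\<And>x. x \<in> carrier M \<Longrightarrow> g' x = p x \<oplus>\<^bsub>N\<^esub> g x"
      using g'_in unfolding mem_stable_class_iff[OF M N g] by metis
    obtain q where f': "f' \<in> rhom A L M" and q: "q \<in> factor_proj A L M"
      "\<And>x. x \<in> carrier L \<Longrightarrow> f' x = q x \<oplus>\<^bsub>M\<^esub> f x"
      using f'_in unfolding mem_stable_class_iff[OF L M f] by metis
    note ph = factor_proj_rhom[OF Mm p(1)] and qh = factor_proj_rhom[OF Lm q(1)]
    \<comment> \<open>With \<open>g' = p + g\<close> and \<open>f' = q + f\<close>, the composite of
      \<open>g'\<close> and \<open>f'\<close> differs from that of \<open>g\<close> and
      \<open>f\<close> by \<open>p f' + g q\<close>.\<close>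
    define r where "r = (\<lambda>x\<in>carrier L. compose (carrier L) p f' x \<oplus>\<^bsub>N\<^esub> compose (carrier L) g q x)"
    have "r \<in> factor_proj A L N"
      unfolding r_def
      by (rule factor_proj_sum[OF Lm Nm factor_proj_compose_right[OF Lm Mm f' p(1)]
            factor_proj_compose_left[OF Lm q(1) g]])
    moreover have "compose (carrier L) g' f' x = r x \<oplus>\<^bsub>N\<^esub> compose (carrier L) g f x"
      if x: "x \<in> carrier L" for x
    proof -
      have "g' (f' x) = p (f' x) \<oplus>\<^bsub>N\<^esub> g (f' x)" by (rule p(2)[OF rhom_closed[OF f' x]])
      also have "g (f' x) = g (q x) \<oplus>\<^bsub>N\<^esub> g (f x)"
        by (simp add: q(2)[OF x] rhom_add[OF g] rhom_closed[OF qh x] rhom_closed[OF f x])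
      finally show ?thesis
        using x by (simp add: r_def compose_eq N.a_assoc rhom_closed[OF ph] rhom_closed[OF g]
            rhom_closed[OF f'] rhom_closed[OF qh] rhom_closed[OF f])
    qed
    ultimately show ?thesis
      unfolding stable_class_eq_iff[OF L N rhom_compose[OF Lm f g] rhom_compose[OF Lm f' g']]
      by blast
  qed
  \<comment> \<open>A union of a constant family is its common value only if the index sets are
    nonempty.\<close>
  have ne: "stable_class A M N g \<noteq> {}" "stable_class A L M f \<noteq> {}"
    using stable_class_self[OF M N g] stable_class_self[OF L M f] by (metis empty_iff)+
  have "Comp (stable_mod A) L M N (stable_class A M N g) (stable_class A L M f) =
      (\<Union>g'\<in>stable_class A M N g. \<Union>f'\<in>stable_class A L M f.
        stable_class A L N (compose (carrier L) g' f'))"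
    by (simp add: stable_mod_def)
  also have "\<dots> = (\<Union>g'\<in>stable_class A M N g. \<Union>f'\<in>stable_class A L M f.
        stable_class A L N (compose (carrier L) g f))"
    by (rule SUP_cong[OF refl], rule SUP_cong[OF refl], rule *)
  also have "\<dots> = stable_class A L N (compose (carrier L) g f)"
    using ne by simp
  finally show ?thesis .
qed

lemma stable_mod_simps [simp]:
  "Obj (stable_mod A) = modA A"
  "Ident (stable_mod A) M = stable_class A M M (\<lambda>x\<in>carrier M. x)"
  by (simp_all add: stable_mod_def)

lemma compose_id_left: "f \<in> rhom A M N \<Longrightarrow> compose (carrier M) (\<lambda>x\<in>carrier N. x) f = f"
  by (rule extensionalityI[of _ "carrier M"])
    (simp_all add: compose_eq rhom_extensional rhom_closed)

lemma compose_id_right: "f \<in> rhom A M N \<Longrightarrow> compose (carrier M) f (\<lambda>x\<in>carrier M. x) = f"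
  by (rule extensionalityI[of _ "carrier M"]) (simp_all add: compose_eq rhom_extensional)

lemma category_stable_mod: "category (stable_mod A)"
proof
  fix X assume X: "X \<in> Obj (stable_mod A)"
  then show "Ident (stable_mod A) X \<in> Hom (stable_mod A) X X"
    using rhom_id[OF modA_module] by (simp add: stable_hom_iff) blast
next
  fix X Y Z f g
  assume *: "X \<in> Obj (stable_mod A)" "Y \<in> Obj (stable_mod A)" "Z \<in> Obj (stable_mod A)"
    "f \<in> Hom (stable_mod A) X Y" "g \<in> Hom (stable_mod A) Y Z"
  then have XYZ: "X \<in> modA A" "Y \<in> modA A" "Z \<in> modA A" by simp_all
  obtain f' g' where fg: "f' \<in> rhom A X Y" "f = stable_class A X Y f'"
    "g' \<in> rhom A Y Z" "g = stable_class A Y Z g'"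
    using *(4,5) XYZ by (auto simp: stable_hom_iff)
  show "Comp (stable_mod A) X Y Z g f \<in> Hom (stable_mod A) X Z"
    unfolding stable_hom_iff[OF XYZ(1,3)] fg stable_comp[OF XYZ fg(1,3)]
    using rhom_compose[OF modA_module[OF XYZ(1)] fg(1,3)] by blast
next
  fix X Y f
  assume *: "X \<in> Obj (stable_mod A)" "Y \<in> Obj (stable_mod A)" "f \<in> Hom (stable_mod A) X Y"
  then have XY: "X \<in> modA A" "Y \<in> modA A" by simp_all
  obtain f' where f: "f' \<in> rhom A X Y" "f = stable_class A X Y f'"
    using *(3) XY by (auto simp: stable_hom_iff)
  show "Comp (stable_mod A) X Y Y (Ident (stable_mod A) Y) f = f"
    using stable_comp[OF XY(1,2,2) f(1) rhom_id[OF modA_module[OF XY(2)]]] compose_id_left[OF f(1)] f(2)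
    by simp
  show "Comp (stable_mod A) X X Y f (Ident (stable_mod A) X) = f"
    using stable_comp[OF XY(1,1,2) rhom_id[OF modA_module[OF XY(1)]] f(1)] compose_id_right[OF f(1)] f(2)
    by simp
next
  fix W X Y Z f g h
  assume *: "W \<in> Obj (stable_mod A)" "X \<in> Obj (stable_mod A)" "Y \<in> Obj (stable_mod A)"
    "Z \<in> Obj (stable_mod A)" "f \<in> Hom (stable_mod A) W X" "g \<in> Hom (stable_mod A) X Y"
    "h \<in> Hom (stable_mod A) Y Z"
  then have O: "W \<in> modA A" "X \<in> modA A" "Y \<in> modA A" "Z \<in> modA A" by simp_all
  note Wm = modA_module[OF O(1)] and Xm = modA_module[OF O(2)]
  obtain f' g' h' where fgh: "f' \<in> rhom A W X" "f = stable_class A W X f'"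
    "g' \<in> rhom A X Y" "g = stable_class A X Y g'" "h' \<in> rhom A Y Z" "h = stable_class A Y Z h'"
    using *(5-7) O by (auto simp: stable_hom_iff)
  have "compose (carrier W) (compose (carrier X) h' g') f' =
      compose (carrier W) h' (compose (carrier W) g' f')"
    by (rule ext) (simp add: compose_def restrict_def rhom_closed[OF fgh(1)])
  then show "Comp (stable_mod A) W X Z (Comp (stable_mod A) X Y Z h g) f =
      Comp (stable_mod A) W Y Z h (Comp (stable_mod A) W X Y g f)"
    unfolding fgh
    by (simp add: stable_comp[OF O(1-3) fgh(1,3)] stable_comp[OF O(2-4) fgh(3,5)]
        stable_comp[OF O(1,2,4) fgh(1) rhom_compose[OF Xm fgh(3,5)]]
        stable_comp[OF O(1,3,4) rhom_compose[OF Wm fgh(1,3)] fgh(5)])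
qed

lemma isomorphic_stable_mod_iff:
  assumes M: "M \<in> modA A" and N: "N \<in> modA A"
  shows "category.isomorphic (stable_mod A) M N \<longleftrightarrow> stably_isomorphic A M N"
proof -
  note Mm = modA_module[OF M] and Nm = modA_module[OF N]
  have *: "(Comp (stable_mod A) M N M (stable_class A N M g) (stable_class A M N f) = Ident (stable_mod A) M \<and>
      Comp (stable_mod A) N M N (stable_class A M N f) (stable_class A N M g) = Ident (stable_mod A) N) \<longleftrightarrow>
     (\<exists>p\<in>factor_proj A M M. \<exists>q\<in>factor_proj A N N.
       (\<forall>x\<in>carrier M. g (f x) = p x \<oplus>\<^bsub>M\<^esub> x) \<and> (\<forall>y\<in>carrier N. f (g y) = q y \<oplus>\<^bsub>N\<^esub> y))"
    if f: "f \<in> rhom A M N" and g: "g \<in> rhom A N M" for f g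
    unfolding stable_comp[OF M N M f g] stable_comp[OF N M N g f] stable_mod_simps
      stable_class_eq_iff[OF M M rhom_id[OF Mm] rhom_compose[OF Mm f g]]
      stable_class_eq_iff[OF N N rhom_id[OF Nm] rhom_compose[OF Nm g f]]
    by (simp add: compose_eq)
  show ?thesis
    unfolding category.isomorphic_def[OF category_stable_mod] iso_arr_def stably_isomorphic_def
      stable_hom_iff[OF M N] Bex_def stable_hom_iff[OF N M]
    using * by (auto simp: Bex_def) metis+
qed

text \<open>Mediating arrows come from the module category. For uniqueness, if the components of
  \<open>h\<close> and \<open>k\<close> differ by \<open>r\<close> and \<open>s\<close>, then
  \<open>h\<close> and \<open>k\<close> differ by \<open>i r + j s\<close>, which factors through a
  projective module.\<close>

lemma biproduct_stable_product:
  assumes M: "M \<in> modA A" and N: "N \<in> modA A" and S: "S \<in> modA A"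
    and "biproduct A M N S i j p q"
  shows "category.is_product (stable_mod A) S M N (stable_class A S M p) (stable_class A S N q)"
proof -
  interpret C: category "stable_mod A" by (rule category_stable_mod)
  note b = biproductD[OF assms(4)]
  note Mm = modA_module[OF M] and Nm = modA_module[OF N] and Sm = modA_module[OF S]
  interpret M: right_module A M by (rule Mm)
  interpret N: right_module A N by (rule Nm)
  interpret S: right_module A S by (rule Sm)
  note [simp] = biproduct_closed[OF assms(4)]
    compose_eq b(5-8) rhom_add[OF b(1)] rhom_add[OF b(2)] rhom_add[OF b(3)] rhom_add[OF b(4)]
  show ?thesis
    unfolding C.is_product_def
  proof (intro conjI ballI impI)
    show "stable_class A S M p \<in> Hom (stable_mod A) S M" "stable_class A S N q \<in> Hom (stable_mod A) S N"
      using b(3,4) by (auto simp: stable_hom_iff[OF S M] stable_hom_iff[OF S N])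
  next
    fix W F G assume *: "W \<in> Obj (stable_mod A)" "F \<in> Hom (stable_mod A) W M" "G \<in> Hom (stable_mod A) W N"
    then have W: "W \<in> modA A" by simp
    note Wm = modA_module[OF W]
    obtain f where f: "f \<in> rhom A W M" "F = stable_class A W M f"
      using *(2) unfolding stable_hom_iff[OF W M] by metis
    obtain g where g: "g \<in> rhom A W N" "G = stable_class A W N g"
      using *(3) unfolding stable_hom_iff[OF W N] by metis
    define h where "h = (\<lambda>x\<in>carrier W. compose (carrier W) i f x \<oplus>\<^bsub>S\<^esub> compose (carrier W) j g x)"
    have h: "h \<in> rhom A W S"
      unfolding h_def by (rule rhom_sum[OF Wm Sm rhom_compose[OF Wm f(1) b(1)] rhom_compose[OF Wm g(1) b(2)]])
    have "compose (carrier W) p h = f" "compose (carrier W) q h = g"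
      by (rule rhom_eqI[OF rhom_compose[OF Wm h b(3)] f(1)] rhom_eqI[OF rhom_compose[OF Wm h b(4)] g(1)];
          simp add: h_def rhom_closed[OF f(1)] rhom_closed[OF g(1)])+
    then have "Comp (stable_mod A) W S M (stable_class A S M p) (stable_class A W S h) = F \<and>
        Comp (stable_mod A) W S N (stable_class A S N q) (stable_class A W S h) = G"
      by (simp add: stable_comp[OF W S M h b(3)] stable_comp[OF W S N h b(4)] f(2) g(2))
    moreover have "stable_class A W S h \<in> Hom (stable_mod A) W S"
      unfolding stable_hom_iff[OF W S] using h by blast
    ultimately show "\<exists>H\<in>Hom (stable_mod A) W S.
        Comp (stable_mod A) W S M (stable_class A S M p) H = F \<and>
        Comp (stable_mod A) W S N (stable_class A S N q) H = G" by metis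
  next
    fix W H K
    assume *: "W \<in> Obj (stable_mod A)" "H \<in> Hom (stable_mod A) W S" "K \<in> Hom (stable_mod A) W S"
      and eq: "Comp (stable_mod A) W S M (stable_class A S M p) H =
          Comp (stable_mod A) W S M (stable_class A S M p) K \<and>
        Comp (stable_mod A) W S N (stable_class A S N q) H =
          Comp (stable_mod A) W S N (stable_class A S N q) K"
    then have W: "W \<in> modA A" by simp
    note Wm = modA_module[OF W]
    obtain h where h: "h \<in> rhom A W S" "H = stable_class A W S h"
      using *(2) unfolding stable_hom_iff[OF W S] by metis
    obtain k where k: "k \<in> rhom A W S" "K = stable_class A W S k"
      using *(3) unfolding stable_hom_iff[OF W S] by metis
    have "stable_class A W M (compose (carrier W) p h) = stable_class A W M (compose (carrier W) p k)"
      "stable_class A W N (compose (carrier W) q h) = stable_class A W N (compose (carrier W) q k)"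
      using eq unfolding h(2) k(2) stable_comp[OF W S M h(1) b(3)] stable_comp[OF W S M k(1) b(3)]
        stable_comp[OF W S N h(1) b(4)] stable_comp[OF W S N k(1) b(4)] by metis+
    then obtain r s where r: "r \<in> factor_proj A W M" "\<forall>x\<in>carrier W. p (h x) = r x \<oplus>\<^bsub>M\<^esub> p (k x)"
      and s: "s \<in> factor_proj A W N" "\<forall>x\<in>carrier W. q (h x) = s x \<oplus>\<^bsub>N\<^esub> q (k x)"
      unfolding stable_class_eq_iff[OF W M rhom_compose[OF Wm k(1) b(3)] rhom_compose[OF Wm h(1) b(3)]]
        stable_class_eq_iff[OF W N rhom_compose[OF Wm k(1) b(4)] rhom_compose[OF Wm h(1) b(4)]]
      by auto
    note rh = factor_proj_rhom[OF Wm r(1)] and sh = factor_proj_rhom[OF Wm s(1)]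
    note [simp] = rhom_closed[OF rh] rhom_closed[OF sh] rhom_closed[OF h(1)] rhom_closed[OF k(1)]
    define t where "t = (\<lambda>x\<in>carrier W. compose (carrier W) i r x \<oplus>\<^bsub>S\<^esub> compose (carrier W) j s x)"
    have t: "t \<in> factor_proj A W S"
      unfolding t_def
      by (rule factor_proj_sum[OF Wm Sm factor_proj_compose_left[OF Wm r(1) b(1)]
            factor_proj_compose_left[OF Wm s(1) b(2)]])
    have "h x = t x \<oplus>\<^bsub>S\<^esub> k x" if x: "x \<in> carrier W" for x
    proof -
      have "h x = i (p (h x)) \<oplus>\<^bsub>S\<^esub> j (q (h x))" using x b(9)[of "h x"] by simp
      also have "\<dots> = (i (r x) \<oplus>\<^bsub>S\<^esub> i (p (k x))) \<oplus>\<^bsub>S\<^esub> (j (s x) \<oplus>\<^bsub>S\<^esub> j (q (k x)))"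
        using x r(2) s(2) by simp
      also have "\<dots> = t x \<oplus>\<^bsub>S\<^esub> (i (p (k x)) \<oplus>\<^bsub>S\<^esub> j (q (k x)))"
        using x by (simp add: t_def S.a_ac)
      finally show ?thesis using x b(9)[of "k x"] by simp
    qed
    then show "H = K"
      unfolding h(2) k(2) stable_class_eq_iff[OF W S k(1) h(1)] using t by blast
  qed
qed

text \<open>Both \<open>T\<close> and the image of \<open>S\<close> are products of the images of
  \<open>M\<close> and \<open>N\<close> in the stable category.\<close>

lemma stable_equivalence_biproduct:
  assumes "quasi_inverse (stable_mod A) (stable_mod B) \<alpha> \<beta>"
    and M: "M \<in> modA A" and N: "N \<in> modA A" and S: "S \<in> modA A" and b: "biproduct A M N S i j p q"
    and V: "V \<in> modA B" and W: "W \<in> modA B" and T: "T \<in> modA B" and b': "biproduct B V W T i' j' p' q'"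
    and VM: "stably_isomorphic B V (on_obj \<alpha> M)" and WN: "stably_isomorphic B W (on_obj \<alpha> N)"
  shows "stably_isomorphic B T (on_obj \<alpha> S)"
proof -
  interpret E: equivalence "stable_mod A" "stable_mod B" \<alpha> \<beta>
    by (intro equivalence.intro equivalence_axioms.intro category_stable_mod assms(1))
  have obj: "on_obj \<alpha> M \<in> modA B" "on_obj \<alpha> N \<in> modA B" "on_obj \<alpha> S \<in> modA B"
    using E.F(1) M N S by simp_all
  obtain d where d: "iso_arr (stable_mod B) V (on_obj \<alpha> M) d"
    using VM unfolding isomorphic_stable_mod_iff[OF V obj(1), symmetric] E.D.isomorphic_def by metis
  obtain e where e: "iso_arr (stable_mod B) W (on_obj \<alpha> N) e"
    using WN unfolding isomorphic_stable_mod_iff[OF W obj(2), symmetric] E.D.isomorphic_def by metis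
  have "E.D.isomorphic T (on_obj \<alpha> S)"
    by (rule E.D.is_product_unique[OF _ _ _ _
          E.D.is_product_iso_factors[OF _ _ _ _ _ biproduct_stable_product[OF V W T b'] d e]
          E.preserves_product[OF _ _ _ biproduct_stable_product[OF M N S b]]])
      (simp_all add: M N S V W T obj)
  then show ?thesis by (simp add: isomorphic_stable_mod_iff T obj)
qed

section \<open>Perfect exact sequences\<close>

lemma regular_simps [simp]:
  "carrier (regular A) = carrier A" "\<zero>\<^bsub>regular A\<^esub> = \<zero>\<^bsub>A\<^esub>"
  "x \<oplus>\<^bsub>regular A\<^esub> y = x \<oplus>\<^bsub>A\<^esub> y" "x \<star>\<^bsub>regular A\<^esub> a = x \<otimes>\<^bsub>A\<^esub> a"
  by (simp_all add: regular_def)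

lemma right_module_regular: "ring A \<Longrightarrow> right_module A (regular A)"
proof -
  assume "ring A"
  then interpret A: ring A .
  have "abelian_group (regular A)"
    by (rule abelian_groupI) (auto simp: A.a_ac intro: A.l_neg)
  then show ?thesis
    by (intro right_module.intro right_module_axioms.intro A.ring_axioms)
      (simp_all add: A.l_distr A.r_distr A.m_assoc)
qed

lemma rmod_ses_iff:
  "rmod_ses A X Y Z f g \<longleftrightarrow> f \<in> rhom A X Y \<and> g \<in> rhom A Y Z \<and> inj_on f (carrier X) \<and>
     g ` carrier Y = carrier Z \<and> f ` carrier X = {y \<in> carrier Y. g y = \<zero>\<^bsub>Z\<^esub>}"
  unfolding rmod_ses_def ses_def mon_def epi_def kernel_def hom_def
  by (auto simp: rhom_closed rhom_add)

text \<open>Universal property of the cokernel: \<open>\<chi>\<close> is \<open>\<phi>\<close> on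
  arbitrarily chosen preimages, and is a homomorphism because \<open>\<phi>\<close> depends only on
  the value of \<open>g\<close>.\<close>

lemma rmod_ses_factor:
  assumes Y: "right_module A Y" and Z: "right_module A Z" and W: "right_module A W"
    and f: "f \<in> rhom A X Y" and ses: "rmod_ses A X Y Z f g" and \<phi>: "\<phi> \<in> rhom A Y W"
    and \<phi>f: "\<And>x. x \<in> carrier X \<Longrightarrow> \<phi> (f x) = \<zero>\<^bsub>W\<^esub>"
  obtains \<chi> where "\<chi> \<in> rhom A Z W" and "\<And>y. y \<in> carrier Y \<Longrightarrow> \<chi> (g y) = \<phi> y"
proof -
  interpret Y: right_module A Y by (rule Y)
  interpret Z: right_module A Z by (rule Z)
  interpret W: right_module A W by (rule W)
  have g: "g \<in> rhom A Y Z" and surj: "g ` carrier Y = carrier Z"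
    and ker: "f ` carrier X = {y \<in> carrier Y. g y = \<zero>\<^bsub>Z\<^esub>}"
    using ses unfolding rmod_ses_iff by metis+
  have "\<forall>z\<in>carrier Z. \<exists>y. y \<in> carrier Y \<and> g y = z"
    using surj by (metis imageE)
  then obtain s where s: "\<And>z. z \<in> carrier Z \<Longrightarrow> s z \<in> carrier Y \<and> g (s z) = z" by metis
  have eq: "\<phi> y = \<phi> y'" if y: "y \<in> carrier Y" "y' \<in> carrier Y" "g y = g y'" for y y'
  proof -
    have "g (y \<oplus>\<^bsub>Y\<^esub> \<ominus>\<^bsub>Y\<^esub> y') = \<zero>\<^bsub>Z\<^esub>"
      using y rhom_closed[OF g] by (simp add: rhom_add[OF g] rhom_minus[OF Y Z g] Z.r_neg)
    then have "y \<oplus>\<^bsub>Y\<^esub> \<ominus>\<^bsub>Y\<^esub> y' \<in> f ` carrier X" using y by (simp add: ker)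
    then have "\<phi> (y \<oplus>\<^bsub>Y\<^esub> \<ominus>\<^bsub>Y\<^esub> y') = \<zero>\<^bsub>W\<^esub>" using \<phi>f by (metis imageE)
    then have "\<phi> y \<oplus>\<^bsub>W\<^esub> \<ominus>\<^bsub>W\<^esub> \<phi> y' = \<zero>\<^bsub>W\<^esub>"
      using y by (simp add: rhom_add[OF \<phi>] rhom_minus[OF Y W \<phi>])
    then show ?thesis
      using y rhom_closed[OF \<phi>] W.minus_equality[of "\<phi> y" "\<ominus>\<^bsub>W\<^esub> \<phi> y'"] by simp
  qed
  note [simp] = rhom_closed[OF g] rhom_closed[OF \<phi>]
  have sY: "s z \<in> carrier Y" and gs: "g (s z) = z" if "z \<in> carrier Z" for z
    using s[OF that] by simp_all
  have \<phi>s: "\<phi> (s (g y)) = \<phi> y" if "y \<in> carrier Y" for y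
    using that by (intro eq) (simp_all add: sY gs)
  have "restrict (\<phi> \<circ> s) (carrier Z) \<in> rhom A Z W"
  proof (rule rhom_restrictI[OF Z])
    fix x assume x: "x \<in> carrier Z"
    then show "(\<phi> \<circ> s) x \<in> carrier W" by (simp add: sY)
    {
      fix y assume y: "y \<in> carrier Z"
      have e: "x \<oplus>\<^bsub>Z\<^esub> y = g (s x \<oplus>\<^bsub>Y\<^esub> s y)"
        using x y by (simp add: rhom_add[OF g] sY gs)
      have "\<phi> (s (x \<oplus>\<^bsub>Z\<^esub> y)) = \<phi> (s x \<oplus>\<^bsub>Y\<^esub> s y)"
        unfolding e by (rule \<phi>s) (simp add: sY x y)
      then show "(\<phi> \<circ> s) (x \<oplus>\<^bsub>Z\<^esub> y) = (\<phi> \<circ> s) x \<oplus>\<^bsub>W\<^esub> (\<phi> \<circ> s) y"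
        by (simp add: rhom_add[OF \<phi>] sY x y)
    next
      fix a assume a: "a \<in> carrier A"
      have e: "x \<star>\<^bsub>Z\<^esub> a = g (s x \<star>\<^bsub>Y\<^esub> a)"
        using x a by (simp add: rhom_smult[OF g] sY gs)
      have "\<phi> (s (x \<star>\<^bsub>Z\<^esub> a)) = \<phi> (s x \<star>\<^bsub>Y\<^esub> a)"
        unfolding e by (rule \<phi>s) (simp add: sY x a Y.rsmult_closed)
      then show "(\<phi> \<circ> s) (x \<star>\<^bsub>Z\<^esub> a) = (\<phi> \<circ> s) x \<star>\<^bsub>W\<^esub> a"
        by (simp add: rhom_smult[OF \<phi>] sY x a)
    }
  qed
  moreover have "restrict (\<phi> \<circ> s) (carrier Z) (g y) = \<phi> y" if "y \<in> carrier Y" for y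
    using that by (simp add: \<phi>s)
  ultimately show thesis by (rule that)
qed

text \<open>Since \<open>Hom(-, A)\<close> is left exact, only the surjectivity of \<open>Y\<^sup>* \<rightarrow> X\<^sup>*\<close> has to be required.\<close>

lemma perfect_exact_iff:
  assumes X: "right_module A X" and Y: "right_module A Y" and Z: "right_module A Z"
  shows "perfect_exact A X Y Z f g \<longleftrightarrow> rmod_ses A X Y Z f g \<and>
    (\<forall>\<phi>\<in>rhom A X (regular A). \<exists>\<psi>\<in>rhom A Y (regular A). \<forall>x\<in>carrier X. \<psi> (f x) = \<phi> x)"
proof (cases "rmod_ses A X Y Z f g")
  case True
  then have f: "f \<in> rhom A X Y" and g: "g \<in> rhom A Y Z" and surj: "g ` carrier Y = carrier Z"
    and ker: "f ` carrier X = {y \<in> carrier Y. g y = \<zero>\<^bsub>Z\<^esub>}"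
    unfolding rmod_ses_iff by metis+
  note R = right_module_regular[OF right_module_ring[OF X]]
  let ?Z = "dual A Z" and ?Y = "dual A Y" and ?X = "dual A X"
  have hom: "dual_map Y g \<in> hom ?Z ?Y" "dual_map X f \<in> hom ?Y ?X"
    using rhom_compose[OF Y g] rhom_compose[OF X f]
    by (auto simp: hom_def dual_def hom_group_simps dual_map_def compose_def restrict_def
        rhom_closed[OF f] rhom_closed[OF g])
  have gf: "g (f x) = \<zero>\<^bsub>Z\<^esub>" if "x \<in> carrier X" for x
    using that ker by blast
  have "inj_on (dual_map Y g) (carrier ?Z)"
  proof (rule inj_onI)
    fix \<phi> \<psi> assume *: "\<phi> \<in> carrier ?Z" "\<psi> \<in> carrier ?Z" "dual_map Y g \<phi> = dual_map Y g \<psi>"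
    then have h: "\<phi> \<in> rhom A Z (regular A)" "\<psi> \<in> rhom A Z (regular A)"
      by (simp_all add: dual_def hom_group_simps)
    show "\<phi> = \<psi>"
    proof (rule rhom_eqI[OF h])
      fix z assume "z \<in> carrier Z"
      then obtain y where "y \<in> carrier Y" "z = g y" using surj by blast
      then show "\<phi> z = \<psi> z"
        using fun_cong[OF *(3), of y] by (simp add: dual_map_def compose_eq)
    qed
  qed
  moreover have "dual_map Y g ` carrier ?Z = kernel ?Y ?X (dual_map X f)"
  proof
    show "dual_map Y g ` carrier ?Z \<subseteq> kernel ?Y ?X (dual_map X f)"
    proof
      fix \<psi> assume "\<psi> \<in> dual_map Y g ` carrier ?Z"
      then obtain \<phi> where \<phi>: "\<phi> \<in> rhom A Z (regular A)" "\<psi> = compose (carrier Y) \<phi> g"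
        by (auto simp: dual_def hom_group_simps dual_map_def)
      have "\<psi> \<in> rhom A Y (regular A)" unfolding \<phi>(2) by (rule rhom_compose[OF Y g \<phi>(1)])
      moreover have "compose (carrier X) \<psi> f = (\<lambda>x\<in>carrier X. \<zero>\<^bsub>A\<^esub>)"
        using rhom_zero[OF Z R \<phi>(1)] unfolding \<phi>(2)
        by (auto simp: compose_def restrict_def rhom_closed[OF f] gf)
      ultimately show "\<psi> \<in> kernel ?Y ?X (dual_map X f)"
        by (simp add: kernel_def dual_def hom_group_simps dual_map_def)
    qed
    show "kernel ?Y ?X (dual_map X f) \<subseteq> dual_map Y g ` carrier ?Z"
    proof
      fix \<psi> assume "\<psi> \<in> kernel ?Y ?X (dual_map X f)"
      then have \<psi>: "\<psi> \<in> rhom A Y (regular A)" "compose (carrier X) \<psi> f = (\<lambda>x\<in>carrier X. \<zero>\<^bsub>A\<^esub>)"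
        by (simp_all add: kernel_def dual_def hom_group_simps dual_map_def)
      have "\<psi> (f x) = \<zero>\<^bsub>regular A\<^esub>" if "x \<in> carrier X" for x
        using fun_cong[OF \<psi>(2), of x] that by (simp add: compose_eq)
      then obtain \<chi> where \<chi>: "\<chi> \<in> rhom A Z (regular A)" "\<And>y. y \<in> carrier Y \<Longrightarrow> \<chi> (g y) = \<psi> y"
        using rmod_ses_factor[OF Y Z R f True \<psi>(1)] by metis
      have "\<psi> = compose (carrier Y) \<chi> g"
        by (rule rhom_eqI[OF \<psi>(1) rhom_compose[OF Y g \<chi>(1)]]) (simp add: compose_eq \<chi>(2))
      then show "\<psi> \<in> dual_map Y g ` carrier ?Z"
        using \<chi>(1) by (auto simp: dual_def hom_group_simps dual_map_def)
    qed
  qed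
  ultimately have "ses ?Z ?Y ?X (dual_map Y g) (dual_map X f) \<longleftrightarrow>
      dual_map X f ` carrier ?Y = carrier ?X"
    using hom by (simp add: ses_def mon_def epi_def)
  also have "\<dots> \<longleftrightarrow> (\<forall>\<phi>\<in>rhom A X (regular A). \<exists>\<psi>\<in>rhom A Y (regular A). \<phi> = compose (carrier X) \<psi> f)"
    using rhom_compose[OF X f] by (auto simp: dual_def hom_group_simps dual_map_def)
  also have "\<dots> \<longleftrightarrow> (\<forall>\<phi>\<in>rhom A X (regular A). \<exists>\<psi>\<in>rhom A Y (regular A). \<forall>x\<in>carrier X. \<psi> (f x) = \<phi> x)"
  proof (intro ball_cong bex_cong refl)
    fix \<phi> \<psi> assume "\<phi> \<in> rhom A X (regular A)" "\<psi> \<in> rhom A Y (regular A)"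
    then show "\<phi> = compose (carrier X) \<psi> f \<longleftrightarrow> (\<forall>x\<in>carrier X. \<psi> (f x) = \<phi> x)"
      using rhom_eqI[of \<phi> A X "regular A" "compose (carrier X) \<psi> f" "regular A"]
        rhom_compose[OF X f, of \<psi> "regular A"] by (auto simp: compose_eq)
  qed
  finally show ?thesis using True by (simp add: perfect_exact_def)
qed (simp add: perfect_exact_def)

text \<open>Brings the middle term into the literal form \<open>direct_sum Y P\<close> that the
  relations of the group require.\<close>

lemma perfect_exact_iso:
  assumes X: "right_module A X" and Y: "right_module A Y" and Y': "right_module A Y'"
    and Z: "right_module A Z" and "perfect_exact A X Y Z f g" and iso: "rmod_isomorphic A Y Y'"
  obtains f' g' where "perfect_exact A X Y' Z f' g'"
proof -
  obtain h k where h: "h \<in> rhom A Y Y'" and k: "k \<in> rhom A Y' Y"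
    and kh: "\<And>x. x \<in> carrier Y \<Longrightarrow> k (h x) = x" and hk: "\<And>y. y \<in> carrier Y' \<Longrightarrow> h (k y) = y"
    using rmod_isomorphicE[OF Y Y' iso] by metis
  have f: "f \<in> rhom A X Y" and g: "g \<in> rhom A Y Z" and inj: "inj_on f (carrier X)"
    and surj: "g ` carrier Y = carrier Z"
    and ker: "f ` carrier X = {y \<in> carrier Y. g y = \<zero>\<^bsub>Z\<^esub>}"
    and ext: "\<forall>\<phi>\<in>rhom A X (regular A). \<exists>\<psi>\<in>rhom A Y (regular A). \<forall>x\<in>carrier X. \<psi> (f x) = \<phi> x"
    using assms(5) unfolding perfect_exact_iff[OF X Y Z] rmod_ses_iff by metis+
  define f' where "f' = compose (carrier X) h f"
  define g' where "g' = compose (carrier Y') g k"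
  have f'x: "f' x = h (f x)" if "x \<in> carrier X" for x using that by (simp add: f'_def compose_eq)
  have g'y: "g' y = g (k y)" if "y \<in> carrier Y'" for y using that by (simp add: g'_def compose_eq)
  note [simp] = rhom_closed[OF h] rhom_closed[OF k] rhom_closed[OF f] kh hk f'x g'y
  have "f' \<in> rhom A X Y'" "g' \<in> rhom A Y' Z"
    unfolding f'_def g'_def by (rule rhom_compose[OF X f h] rhom_compose[OF Y' k g])+
  moreover have "inj_on f' (carrier X)"
  proof (rule inj_onI)
    fix x y assume *: "x \<in> carrier X" "y \<in> carrier X" "f' x = f' y"
    then have "h (f x) = h (f y)" by simp
    then have "k (h (f x)) = k (h (f y))" by (simp only:)
    then have "f x = f y" using *(1,2) by simp
    then show "x = y" using inj_onD[OF inj] *(1,2) by metis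
  qed
  moreover have "g' ` carrier Y' = carrier Z"
  proof
    show "g' ` carrier Y' \<subseteq> carrier Z" using rhom_closed[OF g] by auto
    show "carrier Z \<subseteq> g' ` carrier Y'"
    proof
      fix z assume "z \<in> carrier Z"
      then obtain y where y: "y \<in> carrier Y" "z = g y" using surj by blast
      then have "z = g' (h y)" by simp
      then show "z \<in> g' ` carrier Y'" using y(1) rhom_closed[OF h] by blast
    qed
  qed
  moreover have "f' ` carrier X = {y \<in> carrier Y'. g' y = \<zero>\<^bsub>Z\<^esub>}"
  proof
    have "g (f x) = \<zero>\<^bsub>Z\<^esub>" if "x \<in> carrier X" for x using that ker by blast
    then show "f' ` carrier X \<subseteq> {y \<in> carrier Y'. g' y = \<zero>\<^bsub>Z\<^esub>}" by auto
    show "{y \<in> carrier Y'. g' y = \<zero>\<^bsub>Z\<^esub>} \<subseteq> f' ` carrier X"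
    proof
      fix y assume "y \<in> {y \<in> carrier Y'. g' y = \<zero>\<^bsub>Z\<^esub>}"
      then have y: "y \<in> carrier Y'" "g' y = \<zero>\<^bsub>Z\<^esub>" by blast+
      then have "k y \<in> f ` carrier X" unfolding ker by simp
      then obtain x where x: "x \<in> carrier X" "k y = f x" by blast
      then have "f' x = h (k y)" by simp
      then have "y = f' x" using y by simp
      then show "y \<in> f' ` carrier X" using x(1) by blast
    qed
  qed
  moreover have "\<exists>\<psi>\<in>rhom A Y' (regular A). \<forall>x\<in>carrier X. \<psi> (f' x) = \<phi> x"
    if \<phi>: "\<phi> \<in> rhom A X (regular A)" for \<phi>
  proof -
    obtain \<psi> where \<psi>: "\<psi> \<in> rhom A Y (regular A)" "\<forall>x\<in>carrier X. \<psi> (f x) = \<phi> x"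
      using ext \<phi> by metis
    show ?thesis
      by (rule bexI[OF _ rhom_compose[OF Y' k \<psi>(1)]]) (simp add: compose_eq \<psi>(2))
  qed
  ultimately have "perfect_exact A X Y' Z f' g'"
    unfolding perfect_exact_iff[OF X Y' Z] rmod_ses_iff by blast
  then show thesis by (rule that)
qed

text \<open>Split sequences are perfect exact, since a functional on \<open>M\<close> extends to
  \<open>S\<close> by composing it with the projection \<open>p\<close>.\<close>

lemma perfect_exact_biproduct:
  assumes M: "right_module A M" and N: "right_module A N" and S: "right_module A S"
    and "biproduct A M N S i j p q"
  shows "perfect_exact A M S N i q"
proof -
  note b = biproductD[OF assms(4)]
  interpret S: right_module A S by (rule S)
  note [simp] = biproduct_closed[OF assms(4)] b(5-8)
  have "inj_on i (carrier M)"
    by (rule inj_on_inverseI[of _ p]) simp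
  moreover have "i ` carrier M = {s \<in> carrier S. q s = \<zero>\<^bsub>N\<^esub>}"
  proof
    show "i ` carrier M \<subseteq> {s \<in> carrier S. q s = \<zero>\<^bsub>N\<^esub>}" by auto
    show "{s \<in> carrier S. q s = \<zero>\<^bsub>N\<^esub>} \<subseteq> i ` carrier M"
    proof
      fix s assume "s \<in> {s \<in> carrier S. q s = \<zero>\<^bsub>N\<^esub>}"
      then have s: "s \<in> carrier S" "q s = \<zero>\<^bsub>N\<^esub>" by simp_all
      then have "s = i (p s)" using b(9)[OF s(1)] rhom_zero[OF N S b(2)] by simp
      then show "s \<in> i ` carrier M" using s(1) rhom_closed[OF b(3)] by blast
    qed
  qed
  moreover have "\<exists>\<psi>\<in>rhom A S (regular A). \<forall>x\<in>carrier M. \<psi> (i x) = \<phi> x"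
    if \<phi>: "\<phi> \<in> rhom A M (regular A)" for \<phi>
    by (rule bexI[OF _ rhom_compose[OF S b(3) \<phi>]]) (simp add: compose_eq)
  ultimately show ?thesis
    unfolding perfect_exact_iff[OF M S N] rmod_ses_iff using b(1,4) biproduct_surj(2)[OF assms(4)] by blast
qed

text \<open>The missing projection sends \<open>y\<close> to the preimage under \<open>f\<close> of
  \<open>y - s (g y)\<close>, an element of the kernel of \<open>g\<close>.\<close>

lemma biproduct_of_split:
  assumes X: "right_module A X" and Y: "right_module A Y" and Z: "right_module A Z"
    and "split_ses A X Y Z f g"
  obtains i j p q where "biproduct A X Z Y i j p q"
proof -
  interpret X: right_module A X by (rule X)
  interpret Y: right_module A Y by (rule Y)
  interpret Z: right_module A Z by (rule Z)
  have f: "f \<in> rhom A X Y" and g: "g \<in> rhom A Y Z" and inj: "inj_on f (carrier X)"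
    and ker: "f ` carrier X = {y \<in> carrier Y. g y = \<zero>\<^bsub>Z\<^esub>}"
    using assms(4) unfolding split_ses_def rmod_ses_iff by metis+
  obtain s where s: "s \<in> rhom A Z Y" and "compose (carrier Z) g s = (\<lambda>z\<in>carrier Z. z)"
    using assms(4) unfolding split_ses_def by metis
  then have gs: "g (s z) = z" if "z \<in> carrier Z" for z
    using that fun_cong[of _ _ z] by (metis compose_eq restrict_apply')
  note [simp] = rhom_closed[OF f] rhom_closed[OF g] rhom_closed[OF s] gs
    rhom_add[OF f] rhom_add[OF g] rhom_add[OF s] rhom_minus[OF Y Z g] rhom_smult[OF f]
    rhom_smult[OF g] rhom_smult[OF s]
  have gf: "g (f x) = \<zero>\<^bsub>Z\<^esub>" if "x \<in> carrier X" for x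
    using that ker by blast
  have "\<forall>y\<in>carrier Y. \<exists>x. x \<in> carrier X \<and> f x = y \<oplus>\<^bsub>Y\<^esub> \<ominus>\<^bsub>Y\<^esub> s (g y)"
  proof
    fix y assume y: "y \<in> carrier Y"
    then have "y \<oplus>\<^bsub>Y\<^esub> \<ominus>\<^bsub>Y\<^esub> s (g y) \<in> f ` carrier X" unfolding ker by (simp add: Z.r_neg)
    then show "\<exists>x. x \<in> carrier X \<and> f x = y \<oplus>\<^bsub>Y\<^esub> \<ominus>\<^bsub>Y\<^esub> s (g y)" by (metis imageE)
  qed
  then obtain p where p: "\<And>y. y \<in> carrier Y \<Longrightarrow> p y \<in> carrier X \<and> f (p y) = y \<oplus>\<^bsub>Y\<^esub> \<ominus>\<^bsub>Y\<^esub> s (g y)"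
    by metis
  have sum: "f (p y) \<oplus>\<^bsub>Y\<^esub> s (g y) = y" if "y \<in> carrier Y" for y
    using that p[OF that] by (simp add: Y.a_assoc Y.l_neg)
  \<comment> \<open>This characterisation of \<open>p y\<close>, from injectivity of
    \<open>f\<close>, gives additivity, linearity and the values on both summands.\<close>
  have p_eq: "p y = x" if "y \<in> carrier Y" "x \<in> carrier X" "f x \<oplus>\<^bsub>Y\<^esub> s (g y) = y" for x y
  proof (rule inj_onD[OF inj])
    have "f (p y) \<oplus>\<^bsub>Y\<^esub> s (g y) = f x \<oplus>\<^bsub>Y\<^esub> s (g y)" using that sum by simp
    moreover have "p y \<in> carrier X" using p[OF that(1)] by simp
    ultimately show "f (p y) = f x"
      using that(1,2) Y.add.right_cancel[of "s (g y)" "f (p y)" "f x"] by simp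
  qed (use that p in auto)
  have "restrict p (carrier Y) \<in> rhom A Y X"
  proof (rule rhom_restrictI[OF Y])
    fix x y assume x: "x \<in> carrier Y" and y: "y \<in> carrier Y"
    have "(f (p x) \<oplus>\<^bsub>Y\<^esub> f (p y)) \<oplus>\<^bsub>Y\<^esub> (s (g x) \<oplus>\<^bsub>Y\<^esub> s (g y)) =
        (f (p x) \<oplus>\<^bsub>Y\<^esub> s (g x)) \<oplus>\<^bsub>Y\<^esub> (f (p y) \<oplus>\<^bsub>Y\<^esub> s (g y))"
      using x y p by (simp add: Y.a_ac)
    then show "p (x \<oplus>\<^bsub>Y\<^esub> y) = p x \<oplus>\<^bsub>X\<^esub> p y"
      using x y p sum by (intro p_eq) simp_all
  next
    fix x a assume x: "x \<in> carrier Y" and a: "a \<in> carrier A"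
    have "f (p x) \<star>\<^bsub>Y\<^esub> a \<oplus>\<^bsub>Y\<^esub> s (g x) \<star>\<^bsub>Y\<^esub> a = (f (p x) \<oplus>\<^bsub>Y\<^esub> s (g x)) \<star>\<^bsub>Y\<^esub> a"
      using x a p[OF x] by (intro Y.rsmult_add_l[symmetric]) simp_all
    then show "p (x \<star>\<^bsub>Y\<^esub> a) = p x \<star>\<^bsub>X\<^esub> a"
      using x a p sum by (intro p_eq) (simp_all add: Y.rsmult_closed X.rsmult_closed)
  qed (use p in simp)
  moreover have "p (f x) = x" if "x \<in> carrier X" for x
    using that rhom_zero[OF Z Y s] by (intro p_eq) (simp_all add: gf)
  moreover have "p (s z) = \<zero>\<^bsub>X\<^esub>" if "z \<in> carrier Z" for z
    using that rhom_zero[OF X Y f] by (intro p_eq) simp_all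
  ultimately have "biproduct A X Z Y f s (restrict p (carrier Y)) g"
    unfolding biproduct_def using f g s sum by (simp add: gf)
  then show thesis by (rule that)
qed

text \<open>Because \<open>f\<close> and \<open>g\<close> respect both summands, the projections
  onto the second summands commute with them (\<open>qf\<close>, \<open>qg\<close>). Preimages found
  in the large sequence can thus be projected into the small one.\<close>

lemma perfect_exact_summand:
  assumes X: "right_module A X" and Y: "right_module A Y" and Z: "right_module A Z"
    and "perfect_exact A X Y Z f g"
    and dX: "internal_direct_sum A X X1 X2" and dY: "internal_direct_sum A Y Y1 Y2"
    and dZ: "internal_direct_sum A Z Z1 Z2"
    and f12: "f ` X1 \<subseteq> Y1" "f ` X2 \<subseteq> Y2" and g12: "g ` Y1 \<subseteq> Z1" "g ` Y2 \<subseteq> Z2"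
  shows "perfect_exact A (X\<lparr>carrier := X2\<rparr>) (Y\<lparr>carrier := Y2\<rparr>) (Z\<lparr>carrier := Z2\<rparr>)
    (restrict f X2) (restrict g Y2)"
proof -
  interpret X: right_module A X by (rule X)
  interpret Y: right_module A Y by (rule Y)
  interpret Z: right_module A Z by (rule Z)
  have f: "f \<in> rhom A X Y" and g: "g \<in> rhom A Y Z" and inj: "inj_on f (carrier X)"
    and surj: "g ` carrier Y = carrier Z"
    and ker: "f ` carrier X = {y \<in> carrier Y. g y = \<zero>\<^bsub>Z\<^esub>}"
    and ext: "\<forall>\<phi>\<in>rhom A X (regular A). \<exists>\<psi>\<in>rhom A Y (regular A). \<forall>x\<in>carrier X. \<psi> (f x) = \<phi> x"
    using assms(4) unfolding perfect_exact_iff[OF X Y Z] rmod_ses_iff by metis+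
  have sub: "rsubmodule A X X1" "rsubmodule A X X2" "rsubmodule A Y Y1" "rsubmodule A Y Y2"
    "rsubmodule A Z Z1" "rsubmodule A Z Z2"
    using dX dY dZ by (simp_all add: internal_direct_sum_def)
  obtain pX qX where "biproduct A (X\<lparr>carrier := X1\<rparr>) (X\<lparr>carrier := X2\<rparr>) X (\<lambda>x\<in>X1. x) (\<lambda>x\<in>X2. x) pX qX"
    using biproduct_of_internal[OF X dX] .
  note bX = biproductD[OF this]
  obtain pY qY where "biproduct A (Y\<lparr>carrier := Y1\<rparr>) (Y\<lparr>carrier := Y2\<rparr>) Y (\<lambda>x\<in>Y1. x) (\<lambda>x\<in>Y2. x) pY qY"
    using biproduct_of_internal[OF Y dY] .
  note bY = biproductD[OF this]
  obtain pZ qZ where "biproduct A (Z\<lparr>carrier := Z1\<rparr>) (Z\<lparr>carrier := Z2\<rparr>) Z (\<lambda>x\<in>Z1. x) (\<lambda>x\<in>Z2. x) pZ qZ"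
    using biproduct_of_internal[OF Z dZ] .
  note bZ = biproductD[OF this]
  have cX: "x \<in> carrier X" if "x \<in> X2" for x using that rsubmoduleD(1)[OF sub(2)] by blast
  have cY: "y \<in> carrier Y" if "y \<in> Y2" for y using that rsubmoduleD(1)[OF sub(4)] by blast
  have cZ: "z \<in> carrier Z" if "z \<in> Z2" for z using that rsubmoduleD(1)[OF sub(6)] by blast
  have dec: "pX x \<in> X1 \<and> qX x \<in> X2 \<and> pX x \<oplus>\<^bsub>X\<^esub> qX x = x" if "x \<in> carrier X" for x
    using bX(9)[OF that] rhom_closed[OF bX(3) that] rhom_closed[OF bX(4) that] by simp
  have decY: "pY y \<in> Y1 \<and> qY y \<in> Y2 \<and> pY y \<oplus>\<^bsub>Y\<^esub> qY y = y" if "y \<in> carrier Y" for y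
    using bY(9)[OF that] rhom_closed[OF bY(3) that] rhom_closed[OF bY(4) that] by simp
  note r = right_module_sub[OF X sub(2)] right_module_sub[OF Y sub(4)] right_module_sub[OF Z sub(6)]
  have cX1: "x \<in> carrier X" if "x \<in> X1" for x using that rsubmoduleD(1)[OF sub(1)] by blast
  have cY1: "y \<in> carrier Y" if "y \<in> Y1" for y using that rsubmoduleD(1)[OF sub(3)] by blast
  have qf: "qY (f x) = f (qX x)" if x: "x \<in> carrier X" for x
  proof -
    have "f x = f (pX x) \<oplus>\<^bsub>Y\<^esub> f (qX x)"
      using dec[OF x] rhom_add[OF f, of "pX x" "qX x"] cX cX1 by simp
    moreover have f1: "f (pX x) \<in> Y1" and f2: "f (qX x) \<in> Y2" using dec[OF x] f12 by blast+
    ultimately show ?thesis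
      using rhom_add[OF bY(4) cY1[OF f1] cY[OF f2]] bY(6)[of "f (pX x)"] bY(8)[of "f (qX x)"]
        cY[OF f2] by simp
  qed
  have qg: "qZ (g y) = g (qY y)" if y: "y \<in> carrier Y" for y
  proof -
    have "g y = g (pY y) \<oplus>\<^bsub>Z\<^esub> g (qY y)"
      using decY[OF y] rhom_add[OF g, of "pY y" "qY y"] cY cY1 by simp
    moreover have g1: "g (pY y) \<in> Z1" and g2: "g (qY y) \<in> Z2" using decY[OF y] g12 by blast+
    ultimately show ?thesis
      using rhom_add[OF bZ(4) subsetD[OF rsubmoduleD(1)[OF sub(5)] g1] cZ[OF g2]]
        bZ(6)[of "g (pY y)"] bZ(8)[of "g (qY y)"] cZ[OF g2] by simp
  qed
  have q2: "qX x = x" if "x \<in> X2" for x using that bX(8)[of x] by simp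
  have "restrict f X2 \<in> rhom A (X\<lparr>carrier := X2\<rparr>) (Y\<lparr>carrier := Y2\<rparr>)"
    by (rule rhom_into_sub[OF rhom_restrict_sub[OF X sub(2) f]]) (use f12 in auto)
  moreover have "restrict g Y2 \<in> rhom A (Y\<lparr>carrier := Y2\<rparr>) (Z\<lparr>carrier := Z2\<rparr>)"
    by (rule rhom_into_sub[OF rhom_restrict_sub[OF Y sub(4) g]]) (use g12 in auto)
  moreover have "inj_on (restrict f X2) X2"
    using inj_on_subset[OF inj rsubmoduleD(1)[OF sub(2)]] by (simp add: inj_on_def)
  moreover have "restrict g Y2 ` Y2 = Z2"
  proof
    show "restrict g Y2 ` Y2 \<subseteq> Z2" using g12 by auto
    show "Z2 \<subseteq> restrict g Y2 ` Y2"
    proof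
      fix z assume z: "z \<in> Z2"
      then obtain y where y: "y \<in> carrier Y" "z = g y" using surj cZ by blast
      then have "z = g (qY y)" using qg[OF y(1)] bZ(8)[of z] z by simp
      then show "z \<in> restrict g Y2 ` Y2" using decY[OF y(1)] by auto
    qed
  qed
  moreover have "restrict f X2 ` X2 = {y \<in> Y2. restrict g Y2 y = \<zero>\<^bsub>Z\<^esub>}"
  proof
    have "g (f x) = \<zero>\<^bsub>Z\<^esub>" if "x \<in> X2" for x using cX[OF that] ker by blast
    then show "restrict f X2 ` X2 \<subseteq> {y \<in> Y2. restrict g Y2 y = \<zero>\<^bsub>Z\<^esub>}" using f12 by auto
    show "{y \<in> Y2. restrict g Y2 y = \<zero>\<^bsub>Z\<^esub>} \<subseteq> restrict f X2 ` X2"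
    proof
      fix y assume "y \<in> {y \<in> Y2. restrict g Y2 y = \<zero>\<^bsub>Z\<^esub>}"
      then have y: "y \<in> Y2" "g y = \<zero>\<^bsub>Z\<^esub>" by (auto split: if_splits)
      then have "y \<in> f ` carrier X" unfolding ker using cY by simp
      then obtain x where x: "x \<in> carrier X" "y = f x" by blast
      then have "y = f (qX x)" using qf[OF x(1)] bY(8)[of y] y(1) by simp
      then show "y \<in> restrict f X2 ` X2" using dec[OF x(1)] by auto
    qed
  qed
  moreover have "\<exists>\<psi>\<in>rhom A (Y\<lparr>carrier := Y2\<rparr>) (regular A). \<forall>x\<in>X2. \<psi> (restrict f X2 x) = \<phi> x"
    if \<phi>: "\<phi> \<in> rhom A (X\<lparr>carrier := X2\<rparr>) (regular A)" for \<phi>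
  proof -
    \<comment> \<open>A functional on the summand is first extended to \<open>X\<close> along the
      projection, then to \<open>Y\<close> by perfectness, and finally restricted.\<close>
    obtain \<psi> where \<psi>: "\<psi> \<in> rhom A Y (regular A)"
      "\<forall>x\<in>carrier X. \<psi> (f x) = compose (carrier X) \<phi> qX x"
      using ext rhom_compose[OF X bX(4) \<phi>] by metis
    show ?thesis
    proof (rule bexI[OF _ rhom_restrict_sub[OF Y sub(4) \<psi>(1)]], rule ballI)
      fix x assume x: "x \<in> X2"
      then have "f x \<in> Y2" using f12 by blast
      then show "restrict \<psi> Y2 (restrict f X2 x) = \<phi> x"
        using x cX[OF x] \<psi>(2) q2[OF x] by (simp add: compose_eq)
    qed
  qed
  ultimately show ?thesis
    unfolding perfect_exact_iff[OF r] rmod_ses_iff by simp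
qed

section \<open>The Grothendieck group\<close>

lemma carrier_L_group [simp]:
  "x \<in> carrier (L_group A) \<longleftrightarrow> Poly_Mapping.keys x \<subseteq> iso_class A ` nonproj_mod A"
  by (simp add: L_group_def)

lemma mult_L_group [simp]: "x \<otimes>\<^bsub>L_group A\<^esub> y = x + y"
  and one_L_group [simp]: "\<one>\<^bsub>L_group A\<^esub> = 0"
  by (simp_all add: L_group_def)

lemma comm_group_L_group: "comm_group (L_group A)"
  by (simp add: L_group_def abelian_free_Abelian_group)

lemma G0P_relations_subgroup: "subgroup (G0P_relations A) (L_group A)"
proof -
  interpret L: comm_group "L_group A" by (rule comm_group_L_group)
  have "frag_of (iso_class A X) - frag_of (iso_class A Y) + frag_of (iso_class A Z) \<in> carrier (L_group A)"
    if "X \<in> nonproj_mod A" "Y \<in> nonproj_mod A" "Z \<in> nonproj_mod A" for X Y Z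
    using that unfolding carrier_L_group
    by (intro order_trans[OF keys_add] Un_least order_trans[OF keys_diff]) auto
  then show ?thesis
    unfolding G0P_relations_def by (intro L.generate_is_subgroup) auto
qed

lemma G0P_relations_normal: "normal (G0P_relations A) (L_group A)"
  by (rule comm_group.subgroup_imp_normal[OF comm_group_L_group G0P_relations_subgroup])

lemma G0P_relations_zero: "0 \<in> G0P_relations A"
  using subgroup.one_closed[OF G0P_relations_subgroup, of A] by simp

lemma G0P_relations_add: "x \<in> G0P_relations A \<Longrightarrow> y \<in> G0P_relations A \<Longrightarrow> x + y \<in> G0P_relations A"
  using subgroup.m_closed[OF G0P_relations_subgroup, of x A y] by simp

lemma G0P_relations_minus:
  assumes "x \<in> G0P_relations A"
  shows "- x \<in> G0P_relations A"
proof -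
  have "Poly_Mapping.keys x \<subseteq> iso_class A ` nonproj_mod A"
    using subgroup.mem_carrier[OF G0P_relations_subgroup assms] by simp
  then show ?thesis
    using subgroup.m_inv_closed[OF G0P_relations_subgroup assms] by (simp add: L_group_def)
qed

lemma G0P_relations_diff: "x \<in> G0P_relations A \<Longrightarrow> y \<in> G0P_relations A \<Longrightarrow> x - y \<in> G0P_relations A"
  using G0P_relations_add[OF _ G0P_relations_minus, of x A y] by simp

lemma G0P_relationI:
  assumes "X \<in> nonproj_mod A" and "Y \<in> nonproj_mod A" and "Z \<in> nonproj_mod A" and "P \<in> projA A"
    and "perfect_exact A X (direct_sum Y P) Z f g"
  shows "frag_of (iso_class A X) - frag_of (iso_class A Y) + frag_of (iso_class A Z) \<in> G0P_relations A"
  unfolding G0P_relations_def by (rule generate.incl) (use assms in blast)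

lemma iso_class_eqI:
  assumes X: "X \<in> modA A" and Y: "Y \<in> modA A" and iso: "rmod_isomorphic A X Y"
  shows "iso_class A X = iso_class A Y"
proof -
  note Xm = modA_module[OF X] and Ym = modA_module[OF Y]
  have "rmod_isomorphic A X M \<longleftrightarrow> rmod_isomorphic A Y M" for M :: "'a obj"
    using rmod_isomorphic_trans[OF Xm iso, of M]
      rmod_isomorphic_trans[OF Ym rmod_isomorphic_sym[OF Xm Ym iso], of M] by blast
  then show ?thesis by (simp add: iso_class_def)
qed

lemma iso_class_eqD:
  assumes "Y \<in> modA A" and "iso_class A X = iso_class A Y"
  shows "rmod_isomorphic A X Y"
  using assms rmod_isomorphic_refl[OF modA_module[OF assms(1)]] by (auto simp: iso_class_def)

section \<open>The map on free groups induced by a stable equivalence\<close>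

lemma stably_isomorphic_sym:
  "M \<in> modA A \<Longrightarrow> N \<in> modA A \<Longrightarrow> stably_isomorphic A M N \<Longrightarrow> stably_isomorphic A N M"
  using category.isomorphic_sym[OF category_stable_mod, of A M N] by (simp add: isomorphic_stable_mod_iff)

lemma stably_isomorphic_trans:
  assumes "L \<in> modA A" and "M \<in> modA A" and "N \<in> modA A"
    and "stably_isomorphic A L M" and "stably_isomorphic A M N"
  shows "stably_isomorphic A L N"
  using category.isomorphic_trans[OF category_stable_mod, of L A M N] assms
  by (simp add: isomorphic_stable_mod_iff)

lemma rmod_isomorphic_stably_isomorphic:
  assumes M: "M \<in> modA A" and N: "N \<in> modA A" and iso: "rmod_isomorphic A M N"
  shows "stably_isomorphic A M N"
proof -
  note Mm = modA_module[OF M] and Nm = modA_module[OF N]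
  interpret M: right_module A M by (rule Mm)
  interpret N: right_module A N by (rule Nm)
  obtain h k where h: "h \<in> rhom A M N" and k: "k \<in> rhom A N M"
    and "\<And>x. x \<in> carrier M \<Longrightarrow> k (h x) = x" and "\<And>y. y \<in> carrier N \<Longrightarrow> h (k y) = y"
    using rmod_isomorphicE[OF Mm Nm iso] by metis
  then have "(\<forall>x\<in>carrier M. k (h x) = (\<lambda>x\<in>carrier M. \<zero>\<^bsub>M\<^esub>) x \<oplus>\<^bsub>M\<^esub> x) \<and>
      (\<forall>y\<in>carrier N. h (k y) = (\<lambda>x\<in>carrier N. \<zero>\<^bsub>N\<^esub>) y \<oplus>\<^bsub>N\<^esub> y)"
    by simp
  then show ?thesis
    unfolding stably_isomorphic_def using h k factor_proj_zero[OF M Mm] factor_proj_zero[OF N Nm] by blast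
qed

text \<open>Kept in the free group, and used for all modules of \<open>modA\<close>, not only for
  those without projective summands.\<close>

definition image_class ::
    "('b, 's) ring_scheme \<Rightarrow> ('a, 'b) stable_functor \<Rightarrow> 'a obj \<Rightarrow> 'b obj set \<Rightarrow>\<^sub>0 int" where
  "image_class B \<alpha> X = frag_of (iso_class B (nonproj_image B \<alpha> X))"

text \<open>The basis of the free group consists of isomorphism classes, so a representative has to
  be chosen; \<open>image_lift_class\<close> shows that the choice is immaterial.\<close>

definition image_lift :: "('a, 'r) ring_scheme \<Rightarrow> ('b, 's) ring_scheme \<Rightarrow> ('a, 'b) stable_functor \<Rightarrow>
    ('a obj set \<Rightarrow>\<^sub>0 int) \<Rightarrow> 'b obj set \<Rightarrow>\<^sub>0 int" where
  "image_lift A B \<alpha> =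
     frag_extend (\<lambda>c. image_class B \<alpha> (SOME M. M \<in> nonproj_mod A \<and> iso_class A M = c))"

text \<open>Symmetric in the two algebras, so that every result is also available for \<beta>
  through \<open>stable_equivalence_sym\<close>.\<close>

locale stable_equivalence =
  fixes K :: "('k, 'i) ring_scheme" and A :: "('k, 'a, 'j) module_scheme"
    and L :: "('l, 'u) ring_scheme" and B :: "('l, 'b, 'v) module_scheme"
    and \<alpha> :: "('a, 'b) stable_functor" and \<beta> :: "('b, 'a) stable_functor"
  assumes fd_A: "fd_algebra K A" and fd_B: "fd_algebra L B"
    and quasi_inverse: "quasi_inverse (stable_mod A) (stable_mod B) \<alpha> \<beta>"
begin

sublocale E: equivalence "stable_mod A" "stable_mod B" \<alpha> \<beta>
  by (intro equivalence.intro equivalence_axioms.intro category_stable_mod quasi_inverse)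

lemma stable_equivalence_sym: "stable_equivalence L B K A \<beta> \<alpha>"
  by (intro stable_equivalence.intro fd_A fd_B quasi_inverse_sym[OF quasi_inverse])

lemma obj_image: "X \<in> modA A \<Longrightarrow> on_obj \<alpha> X \<in> modA B"
  using E.F(1)[of X] by simp

lemma stably_isomorphic_image:
  assumes "X \<in> modA A" and "Y \<in> modA A" and "stably_isomorphic A X Y"
  shows "stably_isomorphic B (on_obj \<alpha> X) (on_obj \<alpha> Y)"
  using E.isomorphic_obj[of X Y] assms by (simp add: isomorphic_stable_mod_iff obj_image)

text \<open>The decomposition of the image of \<open>X\<close> provides a candidate, which justifies
  the choice operator in \<open>nonproj_image\<close>.\<close>

lemma nonproj_image:
  assumes X: "X \<in> modA A"
  shows "nonproj_image B \<alpha> X \<in> nonproj_mod B"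
    and "stably_isomorphic B (nonproj_image B \<alpha> X) (on_obj \<alpha> X)"
proof -
  note \<alpha>X = obj_image[OF X]
  have iso: "(\<exists>f. iso_arr (stable_mod B) W (on_obj \<alpha> X) f) \<longleftrightarrow> stably_isomorphic B W (on_obj \<alpha> X)"
    if "W \<in> modA B" for W
    using isomorphic_stable_mod_iff[OF that \<alpha>X] by (simp add: E.D.isomorphic_def)
  obtain Y P i j p q where Y: "Y \<in> nonproj_mod B" and P: "P \<in> projA B"
    and b: "biproduct B Y P (on_obj \<alpha> X) i j p q"
    using fd_algebra.nonproj_decomposition[OF fd_B \<alpha>X] .
  have "stably_isomorphic B Y (on_obj \<alpha> X)"
    by (rule biproduct_proj_stably_isomorphic(1)[OF nonproj_modA[OF Y] P \<alpha>X b])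
  then have "Y \<in> modA B \<and> no_proj_summand B Y \<and> (\<exists>f. iso_arr (stable_mod B) Y (on_obj \<alpha> X) f)"
    using Y iso by (simp add: nonproj_mod_def)
  then have W: "nonproj_image B \<alpha> X \<in> modA B \<and> no_proj_summand B (nonproj_image B \<alpha> X) \<and>
      (\<exists>f. iso_arr (stable_mod B) (nonproj_image B \<alpha> X) (on_obj \<alpha> X) f)"
    unfolding nonproj_image_def by (rule someI)
  then show "nonproj_image B \<alpha> X \<in> nonproj_mod B" by (simp add: nonproj_mod_def)
  show "stably_isomorphic B (nonproj_image B \<alpha> X) (on_obj \<alpha> X)"
    using W iso by metis
qed

text \<open>Two candidates are stably isomorphic and have no projective summands, hence are
  isomorphic. So any convenient candidate may be used to compute the class.\<close>

lemma image_class_eqI: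
  assumes X: "X \<in> modA A" and W: "W \<in> nonproj_mod B" and "stably_isomorphic B W (on_obj \<alpha> X)"
  shows "image_class B \<alpha> X = frag_of (iso_class B W)"
proof -
  note V = nonproj_image[OF X] and \<alpha>X = obj_image[OF X]
  note V' = nonproj_modA[OF V(1)] and W' = nonproj_modA[OF W]
  have "stably_isomorphic B W (nonproj_image B \<alpha> X)"
    by (rule stably_isomorphic_trans[OF W' \<alpha>X V' assms(3) stably_isomorphic_sym[OF V' \<alpha>X V(2)]])
  then have "rmod_isomorphic B W (nonproj_image B \<alpha> X)"
    by (rule fd_algebra.stably_isomorphic_nonproj[OF fd_B W V(1)])
  then show ?thesis
    unfolding image_class_def using iso_class_eqI[OF W' V'] by simp
qed

lemma image_class_cong:
  assumes X: "X \<in> modA A" and Y: "Y \<in> modA A" and "stably_isomorphic A X Y"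
  shows "image_class B \<alpha> X = image_class B \<alpha> Y"
proof -
  note W = nonproj_image[OF Y]
  have "stably_isomorphic B (nonproj_image B \<alpha> Y) (on_obj \<alpha> X)"
    by (rule stably_isomorphic_trans[OF nonproj_modA[OF W(1)] obj_image[OF Y] obj_image[OF X] W(2)
          stably_isomorphic_image[OF Y X stably_isomorphic_sym[OF X Y assms(3)]]])
  then show ?thesis
    using image_class_eqI[OF X W(1)] by (simp add: image_class_def)
qed

text \<open>The direct sum \<open>T\<close> of the two images again has no projective summands, so
  it is a candidate for the image of \<open>S\<close>, and the split sequence through
  \<open>T\<close> is a defining relation.\<close>

lemma image_class_biproduct:
  assumes X: "X \<in> modA A" and Y: "Y \<in> modA A" and S: "S \<in> modA A" and b: "biproduct A X Y S i j p q"
  shows "image_class B \<alpha> X - image_class B \<alpha> S + image_class B \<alpha> Y \<in> G0P_relations B"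
proof -
  note V = nonproj_image[OF X] and W = nonproj_image[OF Y]
  note V' = nonproj_modA[OF V(1)] and W' = nonproj_modA[OF W(1)]
  note Vm = modA_module[OF V'] and Wm = modA_module[OF W']
  obtain T i' j' p' q' where T: "T \<in> modA B"
    and b': "biproduct B (nonproj_image B \<alpha> X) (nonproj_image B \<alpha> Y) T i' j' p' q'"
    using biproduct_exists[OF V' W'] .
  note Tm = modA_module[OF T]
  have Tn: "T \<in> nonproj_mod B"
    by (rule fd_algebra.nonproj_biproduct[OF fd_B V(1) W(1) T b'])
  have "stably_isomorphic B T (on_obj \<alpha> S)"
    by (rule stable_equivalence_biproduct[OF quasi_inverse X Y S b V' W' T b' V(2) W(2)])
  then have "image_class B \<alpha> S = frag_of (iso_class B T)"
    by (rule image_class_eqI[OF S Tn])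
  \<comment> \<open>A relation needs a middle term with a projective summand; the zero module fills
    that place.\<close>
  moreover obtain Z where Z: "Z \<in> projA B" "carrier Z = {\<zero>\<^bsub>Z\<^esub>}"
    using zero_object[OF T] .
  note Zm = projA_module[OF Z(1)]
  obtain f g where "perfect_exact B (nonproj_image B \<alpha> X) (direct_sum T Z) (nonproj_image B \<alpha> Y) f g"
    using perfect_exact_iso[OF Vm Tm right_module_direct_sum[OF Tm Zm] Wm
        perfect_exact_biproduct[OF Vm Wm Tm b']
        biproduct_unique[OF Tm Zm Tm right_module_direct_sum[OF Tm Zm] biproduct_zero[OF Tm Zm Z(2)]
          biproduct_direct_sum[OF Tm Zm]]] .
  then have "frag_of (iso_class B (nonproj_image B \<alpha> X)) - frag_of (iso_class B T) +
      frag_of (iso_class B (nonproj_image B \<alpha> Y)) \<in> G0P_relations B"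
    by (rule G0P_relationI[OF V(1) Tn W(1) Z(1)])
  ultimately show ?thesis by (simp add: image_class_def)
qed

text \<open>A projective module is stably isomorphic to zero, and the decomposition of zero as the
  sum of zero with itself makes the class of zero a relation.\<close>

lemma image_class_proj:
  assumes P: "P \<in> projA A"
  shows "image_class B \<alpha> P \<in> G0P_relations B"
proof -
  note P' = projA_modA[OF P] and Pm = projA_module[OF P]
  obtain Z where Z: "Z \<in> projA A" "carrier Z = {\<zero>\<^bsub>Z\<^esub>}" using zero_object[OF P'] .
  note Z' = projA_modA[OF Z(1)] and Zm = projA_module[OF Z(1)]
  have "stably_isomorphic A Z P"
    by (rule biproduct_proj_stably_isomorphic(1)[OF Z' P P'
          biproduct_swap[OF Pm biproduct_zero[OF Pm Zm Z(2)]]])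
  then have "image_class B \<alpha> Z = image_class B \<alpha> P" by (rule image_class_cong[OF Z' P'])
  moreover have "image_class B \<alpha> Z - image_class B \<alpha> Z + image_class B \<alpha> Z \<in> G0P_relations B"
    by (rule image_class_biproduct[OF Z' Z' Z' biproduct_zero[OF Zm Zm Z(2)]])
  ultimately show ?thesis by simp
qed

text \<open>The hypothesis on \<open>\<alpha>\<close> concerns only sequences without split summands. A nontrivial split
  summand is removed by induction on the length of the outer terms; it contributes a relation
  because \<open>\<alpha>\<close> is compatible with direct sums.\<close>

lemma image_class_perfect_exact:
  assumes pres: "preserves_perfect_exact A B \<alpha>"
    and "X \<in> modA A" and "Y \<in> nonproj_mod A" and "Z \<in> modA A" and "P \<in> projA A"
    and "perfect_exact A X (direct_sum Y P) Z f g"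
  shows "image_class B \<alpha> X - image_class B \<alpha> Y + image_class B \<alpha> Z \<in> G0P_relations B"
  using assms(2-)
\<comment> \<open>The outer terms range over all of \<open>modA\<close>, so nothing about projective
  summands has to be shown for the complements \<open>X2\<close> and \<open>Z2\<close>.\<close>
proof (induction "len A X + len A Z" arbitrary: X Y Z P f g rule: less_induct)
  case less
  note X = less.prems(1) and Yn = less.prems(2) and Z = less.prems(3) and P = less.prems(4)
    and perfect = less.prems(5)
  note Y = nonproj_modA[OF Yn]
  note Xm = modA_module[OF X] and Ym = modA_module[OF Y] and Zm = modA_module[OF Z]
    and Pm = projA_module[OF P]
  define E where "E = direct_sum Y P"
  have Em: "right_module A E" unfolding E_def by (rule right_module_direct_sum[OF Ym Pm])
  have bE: "biproduct A Y P E (\<lambda>x\<in>carrier Y. (x, \<zero>\<^bsub>P\<^esub>)) (\<lambda>y\<in>carrier P. (\<zero>\<^bsub>Y\<^esub>, y))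
      (restrict fst (carrier Y \<times> carrier P)) (restrict snd (carrier Y \<times> carrier P))"
    unfolding E_def by (rule biproduct_direct_sum[OF Ym Pm])
  have perfectE: "perfect_exact A X E Z f g" using perfect by (simp add: E_def)
  show ?case
  proof (cases "no_split_summand A X E Z f g")
    case True
    then obtain P' f' g' where P': "P' \<in> projA B"
      and "perfect_exact B (nonproj_image B \<alpha> X) (direct_sum (nonproj_image B \<alpha> Y) P')
        (nonproj_image B \<alpha> Z) f' g'"
      using pres X Y Z P Yn perfectE unfolding preserves_perfect_exact_def nonproj_mod_def E_def
      by blast
    then show ?thesis
      unfolding image_class_def
      by (intro G0P_relationI[OF nonproj_image(1)[OF X] nonproj_image(1)[OF Y] nonproj_image(1)[OF Z] P'])
  next
    case False
    then obtain X1 X2 E1 E2 Z1 Z2 where dX: "internal_direct_sum A X X1 X2"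
      and dE: "internal_direct_sum A E E1 E2" and dZ: "internal_direct_sum A Z Z1 Z2"
      and fg: "f ` X1 \<subseteq> E1" "f ` X2 \<subseteq> E2" "g ` E1 \<subseteq> Z1" "g ` E2 \<subseteq> Z2"
      and split: "split_ses A (X\<lparr>carrier := X1\<rparr>) (E\<lparr>carrier := E1\<rparr>) (Z\<lparr>carrier := Z1\<rparr>)
        (restrict f X1) (restrict g E1)"
      and nz: "\<not> (X1 = {\<zero>\<^bsub>X\<^esub>} \<and> E1 = {\<zero>\<^bsub>E\<^esub>} \<and> Z1 = {\<zero>\<^bsub>Z\<^esub>})"
      unfolding no_split_summand_def not_all not_imp by (elim exE conjE) (rule that)
    let ?X1 = "X\<lparr>carrier := X1\<rparr>" and ?X2 = "X\<lparr>carrier := X2\<rparr>"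
    let ?E1 = "E\<lparr>carrier := E1\<rparr>" and ?E2 = "E\<lparr>carrier := E2\<rparr>"
    let ?Z1 = "Z\<lparr>carrier := Z1\<rparr>" and ?Z2 = "Z\<lparr>carrier := Z2\<rparr>"
    have sub: "rsubmodule A X X1" "rsubmodule A X X2" "rsubmodule A E E1" "rsubmodule A E E2"
      "rsubmodule A Z Z1" "rsubmodule A Z Z2"
      using dX dE dZ by (simp_all add: internal_direct_sum_def)
    note X12 = modA_summand[OF X dX] and Z12 = modA_summand[OF Z dZ]
    note E1m = right_module_sub[OF Em sub(3)] and E2m = right_module_sub[OF Em sub(4)]
    obtain pE qE where dec: "biproduct A ?E1 ?E2 E (\<lambda>x\<in>E1. x) (\<lambda>x\<in>E2. x) pE qE"
      using biproduct_of_internal[OF Em dE] .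
    obtain iX jX pX qX where bX: "biproduct A ?X1 ?X2 X iX jX pX qX"
      using biproduct_of_internal[OF Xm dX] by metis
    obtain iZ jZ pZ qZ where bZ: "biproduct A ?Z1 ?Z2 Z iZ jZ pZ qZ"
      using biproduct_of_internal[OF Zm dZ] by metis
    obtain i1 j1 p1 q1 where b1: "biproduct A ?X1 ?Z1 ?E1 i1 j1 p1 q1"
      using biproduct_of_split[OF modA_module[OF X12(1)] E1m modA_module[OF Z12(1)] split] .
    have perfect2: "perfect_exact A ?X2 ?E2 ?Z2 (restrict f X2) (restrict g E2)"
      by (rule perfect_exact_summand[OF Xm Em Zm perfectE dX dE dZ fg])

    \<comment> \<open>A nonzero split summand has a nonzero outer term, because its middle term is
      the sum of the outer ones. This is why the length of the middle term can stay out of the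
      induction measure.\<close>
    have "X2 \<noteq> carrier X \<or> Z2 \<noteq> carrier Z"
    proof (rule ccontr)
      assume "\<not> (X2 \<noteq> carrier X \<or> Z2 \<noteq> carrier Z)"
      then have X1: "X1 = {\<zero>\<^bsub>X\<^esub>}" and Z1: "Z1 = {\<zero>\<^bsub>Z\<^esub>}"
        using dX dZ rsubmoduleD(1)[OF sub(1)] rsubmoduleD(1)[OF sub(5)]
        unfolding internal_direct_sum_def by blast+
      note b = biproductD[OF b1]
      have "y = \<zero>\<^bsub>E\<^esub>" if y: "y \<in> E1" for y
      proof -
        have "p1 y = \<zero>\<^bsub>?X1\<^esub>" "q1 y = \<zero>\<^bsub>?Z1\<^esub>"
          using rhom_closed[OF b(3), of y] rhom_closed[OF b(4), of y] y X1 Z1 by simp_all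
        moreover have "i1 \<zero>\<^bsub>?X1\<^esub> = \<zero>\<^bsub>?E1\<^esub>" "j1 \<zero>\<^bsub>?Z1\<^esub> = \<zero>\<^bsub>?E1\<^esub>"
          using rhom_zero[OF modA_module[OF X12(1)] E1m b(1)] rhom_zero[OF modA_module[OF Z12(1)] E1m b(2)]
          by simp_all
        ultimately have "\<zero>\<^bsub>?E1\<^esub> \<oplus>\<^bsub>?E1\<^esub> \<zero>\<^bsub>?E1\<^esub> = y" using b(9)[of y] y by simp
        moreover have "\<zero>\<^bsub>?E1\<^esub> \<oplus>\<^bsub>?E1\<^esub> \<zero>\<^bsub>?E1\<^esub> = \<zero>\<^bsub>?E1\<^esub>"
        proof -
          interpret E1: right_module A ?E1 by (rule E1m)
          show ?thesis by (rule E1.l_zero[OF E1.zero_closed])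
        qed
        ultimately show ?thesis by simp
      qed
      then have "E1 = {\<zero>\<^bsub>E\<^esub>}" using rsubmoduleD(2)[OF sub(3)] by blast
      then show False using nz X1 Z1 by blast
    qed
    then have smaller: "len A ?X2 + len A ?Z2 < len A X + len A Z"
      using len_sub_less[OF Xm fd_algebra.finite_length_modA[OF fd_A X] sub(2)]
        len_sub_le[OF Xm fd_algebra.finite_length_modA[OF fd_A X] sub(2)]
        len_sub_less[OF Zm fd_algebra.finite_length_modA[OF fd_A Z] sub(6)]
        len_sub_le[OF Zm fd_algebra.finite_length_modA[OF fd_A Z] sub(6)]
      by linarith

    have Efg: "finitely_generated A E"
      by (rule biproduct_fg[OF Ym Pm Em bE modA_fg[OF Y] modA_fg[OF projA_modA[OF P]]])
    note surj = biproduct_surj[OF dec]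
    note b = biproductD[OF dec]
    \<comment> \<open>\<open>E\<close> and its summands consist of pairs; copies in
      \<open>modA\<close> are needed because \<open>image_class\<close> applies only to objects with
      list carriers.\<close>
    obtain E' where E': "E' \<in> modA A" "rmod_isomorphic A E E'"
      using fg_module_in_modA[OF Em Efg] by metis
    obtain E1' where E1': "E1' \<in> modA A" "rmod_isomorphic A ?E1 E1'"
      using fg_module_in_modA[OF E1m finitely_generated_image[OF Em E1m b(3) surj(1) Efg]] by metis
    obtain E2' where E2': "E2' \<in> modA A" "rmod_isomorphic A ?E2 E2'"
      using fg_module_in_modA[OF E2m finitely_generated_image[OF Em E2m b(4) surj(2) Efg]] by metis
    note E'm = modA_module[OF E'(1)] and E1'm = modA_module[OF E1'(1)] and E2'm = modA_module[OF E2'(1)]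
    \<comment> \<open>The complement \<open>E2\<close> need not be compatible with the decomposition
      of \<open>E\<close> into \<open>Y\<close> and \<open>P\<close>; a new decomposition puts the
      smaller sequence into the form required by the induction hypothesis.\<close>
    obtain Y2 P2 i2 j2 p2 q2 where Y2n: "Y2 \<in> nonproj_mod A" and P2: "P2 \<in> projA A"
      and b2: "biproduct A Y2 P2 E2' i2 j2 p2 q2"
      using fd_algebra.nonproj_decomposition[OF fd_A E2'(1)] .
    note Y2 = nonproj_modA[OF Y2n]
    note Y2m = modA_module[OF Y2] and P2m = projA_module[OF P2]
    note D2m = right_module_direct_sum[OF Y2m P2m]
    have "rmod_isomorphic A ?E2 (direct_sum Y2 P2)"
      by (rule rmod_isomorphic_trans[OF E2m E2'(2)
            biproduct_unique[OF Y2m P2m E2'm D2m b2 biproduct_direct_sum[OF Y2m P2m]]])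
    then obtain f2 g2 where "perfect_exact A ?X2 (direct_sum Y2 P2) ?Z2 f2 g2"
      using perfect_exact_iso[OF modA_module[OF X12(2)] E2m D2m modA_module[OF Z12(2)] perfect2] by metis
    from less.hyps[OF smaller X12(2) Y2n Z12(2) P2 this]
    have IH: "image_class B \<alpha> ?X2 - image_class B \<alpha> Y2 + image_class B \<alpha> ?Z2 \<in> G0P_relations B" .

    obtain i3 j3 p3 q3 where b3: "biproduct A E1' E2' E' i3 j3 p3 q3"
      using biproduct_transport[OF E1m E2m Em E1'm E2'm E'm dec E1'(2) E2'(2) E'(2)] .
    obtain i4 j4 p4 q4 where b4: "biproduct A ?X1 ?Z1 E1' i4 j4 p4 q4"
      using biproduct_transport[OF modA_module[OF X12(1)] modA_module[OF Z12(1)] E1m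
          modA_module[OF X12(1)] modA_module[OF Z12(1)] E1'm b1
          rmod_isomorphic_refl[OF modA_module[OF X12(1)]] rmod_isomorphic_refl[OF modA_module[OF Z12(1)]]
          E1'(2)] .
    obtain i5 j5 p5 q5 where b5: "biproduct A Y P E' i5 j5 p5 q5"
      using biproduct_transport[OF Ym Pm Em Ym Pm E'm bE rmod_isomorphic_refl[OF Ym]
          rmod_isomorphic_refl[OF Pm] E'(2)] .
    let ?c = "image_class B \<alpha>"
    \<comment> \<open>Modulo relations, the classes of \<open>X\<close>, \<open>Z\<close> and
      \<open>E'\<close> split along the summands, \<open>E1'\<close> has the class of
      \<open>X1\<close> plus \<open>Z1\<close>, and \<open>P\<close>, \<open>P2\<close> vanish. What
      is left is the induction hypothesis.\<close>
    have "?c X - ?c Y + ?c Z =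
        (?c ?X2 - ?c Y2 + ?c ?Z2) - (?c ?X1 - ?c X + ?c ?X2) - (?c ?Z1 - ?c Z + ?c ?Z2)
        + (?c ?X1 - ?c E1' + ?c ?Z1) + (?c E1' - ?c E' + ?c E2')
        + (?c Y2 - ?c E2' + ?c P2) - ?c P2 - (?c Y - ?c E' + ?c P) + ?c P"
      by (simp add: algebra_simps)
    also have "\<dots> \<in> G0P_relations B"
      by (intro G0P_relations_add G0P_relations_diff IH image_class_proj P P2
          image_class_biproduct[OF X12 X bX] image_class_biproduct[OF Z12 Z bZ]
          image_class_biproduct[OF X12(1) Z12(1) E1'(1) b4]
          image_class_biproduct[OF E1'(1) E2'(1) E'(1) b3]
          image_class_biproduct[OF Y2 projA_modA[OF P2] E2'(1) b2]
          image_class_biproduct[OF Y projA_modA[OF P] E'(1) b5])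
    finally show ?thesis .
  qed
qed

lemma image_lift_class:
  assumes M: "M \<in> nonproj_mod A"
  shows "image_lift A B \<alpha> (frag_of (iso_class A M)) = image_class B \<alpha> M"
proof -
  define N where "N = (SOME N. N \<in> nonproj_mod A \<and> iso_class A N = iso_class A M)"
  have N: "N \<in> nonproj_mod A \<and> iso_class A N = iso_class A M"
    unfolding N_def by (rule someI[of _ M]) (simp add: M)
  note M' = nonproj_modA[OF M] and N' = nonproj_modA[of N A]
  have "image_class B \<alpha> N = image_class B \<alpha> M"
    using N N' M' by (intro image_class_cong rmod_isomorphic_stably_isomorphic iso_class_eqD) simp_all
  then show ?thesis by (simp add: image_lift_def N_def)
qed

lemma image_lift_closed:
  assumes "x \<in> carrier (L_group A)"
  shows "image_lift A B \<alpha> x \<in> carrier (L_group B)"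
  using assms unfolding carrier_L_group
proof (induction x rule: free_Abelian_group_induct[where S = "iso_class A ` nonproj_mod A"])
  case (3 x y)
  then show ?case
    unfolding image_lift_def frag_extend_diff
    by (intro order_trans[OF keys_diff] Un_least)
next
  case (4 c)
  then obtain M where M: "M \<in> nonproj_mod A" "c = iso_class A M" by blast
  show ?case
    unfolding M(2) image_lift_class[OF M(1)] image_class_def
    using nonproj_image(1)[OF nonproj_modA[OF M(1)]] by simp
qed (use assms in \<open>simp_all add: image_lift_def\<close>)

text \<open>Since the lift is additive, only the generating relations need the hypothesis on
  \<alpha>, through \<open>image_class_perfect_exact\<close>.\<close>

lemma image_lift_relations:
  assumes pres: "preserves_perfect_exact A B \<alpha>" and "x \<in> G0P_relations A"
  shows "image_lift A B \<alpha> x \<in> G0P_relations B"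
proof -
  interpret L: comm_group "L_group A" by (rule comm_group_L_group)
  have gen: "image_lift A B \<alpha> r \<in> G0P_relations B"
    if "r \<in> {frag_of (iso_class A X) - frag_of (iso_class A Y) + frag_of (iso_class A Z) | X Y Z P f g.
        X \<in> nonproj_mod A \<and> Y \<in> nonproj_mod A \<and> Z \<in> nonproj_mod A \<and> P \<in> projA A \<and>
        perfect_exact A X (direct_sum Y P) Z f g}" for r
  proof -
    from that obtain X Y Z P f g where *: "X \<in> nonproj_mod A" "Y \<in> nonproj_mod A" "Z \<in> nonproj_mod A"
      "P \<in> projA A" "perfect_exact A X (direct_sum Y P) Z f g"
      and r: "r = frag_of (iso_class A X) - frag_of (iso_class A Y) + frag_of (iso_class A Z)" by blast
    have "image_lift A B \<alpha> r = image_class B \<alpha> X - image_class B \<alpha> Y + image_class B \<alpha> Z"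
      unfolding r using *(1-3)
      by (simp add: image_lift_class[symmetric]) (simp add: image_lift_def frag_extend_add frag_extend_diff)
    then show ?thesis
      using image_class_perfect_exact[OF pres nonproj_modA[OF *(1)] *(2) nonproj_modA[OF *(3)] *(4,5)]
      by simp
  qed
  have minus: "image_lift A B \<alpha> (- y) = - image_lift A B \<alpha> y" for y
    by (simp add: image_lift_def frag_extend_minus)
  from assms(2) show ?thesis
    unfolding G0P_relations_def[of A]
  proof (induction rule: generate.induct)
    case one
    then show ?case by (simp add: image_lift_def G0P_relations_zero)
  next
    case (incl r)
    then show ?case by (rule gen)
  next
    case (inv r)
    then have "r \<in> G0P_relations A" unfolding G0P_relations_def by (rule generate.incl)
    then have "inv\<^bsub>L_group A\<^esub> r = - r"
      using subgroup.mem_carrier[OF G0P_relations_subgroup, of r A] by (simp add: L_group_def)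
    then show ?case using gen[OF inv] by (simp add: minus G0P_relations_minus)
  next
    case (eng r s)
    then show ?case by (simp add: image_lift_def frag_extend_add G0P_relations_add)
  qed
qed

text \<open>Applying \<beta> to the chosen image of \<open>M\<close> gives a module stably
  isomorphic to \<open>M\<close>, and \<open>M\<close> itself has no projective summands, so it
  represents the class. No relations are used.\<close>

lemma image_lift_inverse:
  assumes "x \<in> carrier (L_group A)"
  shows "image_lift B A \<beta> (image_lift A B \<alpha> x) = x"
  using assms unfolding carrier_L_group
proof (induction x rule: free_Abelian_group_induct[where S = "iso_class A ` nonproj_mod A"])
  case (3 x y)
  then show ?case by (simp add: image_lift_def frag_extend_diff)
next
  case (4 c)
  interpret op: stable_equivalence L B K A \<beta> \<alpha> by (rule stable_equivalence_sym)
  obtain M where M: "M \<in> nonproj_mod A" "c = iso_class A M" using 4 by blast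
  note M' = nonproj_modA[OF M(1)] and W = nonproj_image[OF nonproj_modA[OF M(1)]]
  note W' = nonproj_modA[OF W(1)] and \<alpha>M = obj_image[OF M']
  have "stably_isomorphic A (on_obj \<beta> (on_obj \<alpha> M)) M"
    using E.isomorphic_unit[of M] M' op.obj_image[OF \<alpha>M] by (simp add: isomorphic_stable_mod_iff)
  then have "stably_isomorphic A (on_obj \<beta> (nonproj_image B \<alpha> M)) M"
    by (rule stably_isomorphic_trans[OF op.obj_image[OF W'] op.obj_image[OF \<alpha>M] M'
          op.stably_isomorphic_image[OF W' \<alpha>M W(2)]])
  then have "image_class A \<beta> (nonproj_image B \<alpha> M) = frag_of (iso_class A M)"
    by (intro op.image_class_eqI[OF W' M(1)] stably_isomorphic_sym[OF op.obj_image[OF W'] M'])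
  then show ?case
    unfolding M(2) image_lift_class[OF M(1)] image_class_def[of B] op.image_lift_class[OF W(1)] .
qed (use assms in \<open>simp_all add: image_lift_def\<close>)

text \<open>First isomorphism theorem for the map from the free group of \<open>A\<close> to the
  quotient for \<open>B\<close>. Its kernel is no larger than the relations of \<open>A\<close>: if
  the lift of \<open>x\<close> is a relation, then the lift along \<beta> leads back to
  \<open>x\<close> and preserves relations.\<close>

lemma G0P_iso:
  assumes "preserves_perfect_exact A B \<alpha>" and "preserves_perfect_exact B A \<beta>"
  shows "\<exists>\<phi>\<in>iso (G0P A) (G0P B).
    \<forall>M\<in>nonproj_mod A. \<phi> (G0P_class A M) = G0P_class B (nonproj_image B \<alpha> M)"
proof -
  interpret op: stable_equivalence L B K A \<beta> \<alpha> by (rule stable_equivalence_sym)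
  interpret LA: comm_group "L_group A" by (rule comm_group_L_group)
  interpret LB: comm_group "L_group B" by (rule comm_group_L_group)
  interpret RA: normal "G0P_relations A" "L_group A" by (rule G0P_relations_normal)
  interpret RB: normal "G0P_relations B" "L_group B" by (rule G0P_relations_normal)
  let ?l = "image_lift A B \<alpha>"
  define h where "h = (\<lambda>x. G0P_relations B #>\<^bsub>L_group B\<^esub> ?l x)"
  have l: "?l \<in> hom (L_group A) (L_group B)"
  proof (rule homI)
    show "?l x \<in> carrier (L_group B)" if "x \<in> carrier (L_group A)" for x
      by (rule image_lift_closed[OF that])
  qed (simp add: image_lift_def frag_extend_add)
  have hom: "h \<in> hom (L_group A) (G0P B)"
    using hom_compose[OF l RB.r_coset_hom_Mod] by (simp add: h_def comp_def G0P_def)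
  interpret h: group_hom "L_group A" "G0P B" h
    using RB.factorgroup_is_group hom
    by (intro group_hom.intro group_hom_axioms.intro LA.group_axioms) (simp_all add: G0P_def)
  have ker: "kernel (L_group A) (G0P B) h = G0P_relations A"
  proof
    show "G0P_relations A \<subseteq> kernel (L_group A) (G0P B) h"
    proof
      fix x assume x: "x \<in> G0P_relations A"
      have "h x = G0P_relations B"
        unfolding h_def by (rule RB.rcos_const[OF LB.group_axioms image_lift_relations[OF assms(1) x]])
      then show "x \<in> kernel (L_group A) (G0P B) h"
        using RA.mem_carrier[OF x] by (simp add: kernel_def G0P_def FactGroup_def)
    qed
    show "kernel (L_group A) (G0P B) h \<subseteq> G0P_relations A"
    proof
      fix x assume "x \<in> kernel (L_group A) (G0P B) h"
      then have x: "x \<in> carrier (L_group A)"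
        and hx: "G0P_relations B #>\<^bsub>L_group B\<^esub> ?l x = G0P_relations B"
        by (simp_all add: kernel_def G0P_def FactGroup_def h_def)
      have "?l x \<in> G0P_relations B"
        by (rule LB.coset_join1[OF hx image_lift_closed[OF x] RB.subgroup_axioms])
      from op.image_lift_relations[OF assms(2) this] show "x \<in> G0P_relations A"
        unfolding image_lift_inverse[OF x] .
    qed
  qed
  have "h ` carrier (L_group A) = carrier (G0P B)"
  proof
    show "h ` carrier (L_group A) \<subseteq> carrier (G0P B)"
      using h.hom_closed by blast
    show "carrier (G0P B) \<subseteq> h ` carrier (L_group A)"
    proof
      fix C assume "C \<in> carrier (G0P B)"
      then obtain y where y: "y \<in> carrier (L_group B)" "C = G0P_relations B #>\<^bsub>L_group B\<^esub> y"
        unfolding G0P_def FactGroup_def RCOSETS_def by auto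
      have "C = h (image_lift B A \<beta> y)"
        unfolding h_def y(2) op.image_lift_inverse[OF y(1)] ..
      then show "C \<in> h ` carrier (L_group A)" using op.image_lift_closed[OF y(1)] by blast
    qed
  qed
  then have iso: "(\<lambda>C. the_elem (h ` C)) \<in> iso (G0P A) (G0P B)"
    using h.FactGroup_iso_set unfolding ker G0P_def[of A] by blast
  \<comment> \<open>The induced map is given as the only element of the image of a coset under
    \<open>h\<close>; to evaluate it, \<open>h\<close> is shown to be constant on the coset.\<close>
  have val: "the_elem (h ` G0P_class A M) = G0P_class B (nonproj_image B \<alpha> M)"
    if M: "M \<in> nonproj_mod A" for M
  proof -
    let ?m = "frag_of (iso_class A M)"
    have m: "?m \<in> carrier (L_group A)" using M by simp
    have "h x = h ?m" if x: "x \<in> G0P_class A M" for x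
    proof -
      obtain r where r: "r \<in> G0P_relations A" "x = r \<otimes>\<^bsub>L_group A\<^esub> ?m"
        using x unfolding G0P_class_def r_coset_def by auto
      have "r \<in> kernel (L_group A) (G0P B) h" using r(1) ker by simp
      then have "h r = \<one>\<^bsub>G0P B\<^esub>" by (simp add: kernel_def)
      then show ?thesis
        unfolding r(2) h.hom_mult[OF RA.mem_carrier[OF r(1)] m]
        using h.H.l_one[OF h.hom_closed[OF m]] by simp
    qed
    moreover have "?m \<in> G0P_class A M"
      unfolding G0P_class_def by (rule LA.rcos_self[OF m RA.subgroup_axioms])
    ultimately have "h ` G0P_class A M = {h ?m}" by blast
    then show ?thesis
      by (simp add: h_def image_lift_class[OF M] image_class_def G0P_class_def)
  qed
  show ?thesis by (rule bexI[OF _ iso]) (simp add: val)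
qed

end

theorem theorem3p4:
  fixes K :: "'k ring" and A :: "('k, 'a) module" and B :: "('k, 'b) module"
    and \<alpha> :: "('a, 'b) stable_functor" and \<beta> :: "('b, 'a) stable_functor"
  assumes "fd_algebra K A" and "fd_algebra K B"
    and "no_semisimple_summand A" and "no_semisimple_summand B"
    and "quasi_inverse (stable_mod A) (stable_mod B) \<alpha> \<beta>"
    and "preserves_perfect_exact A B \<alpha>" and "preserves_perfect_exact B A \<beta>"
  shows "\<exists>\<phi>\<in>iso (G0P A) (G0P B).
    \<forall>M\<in>nonproj_mod A. \<phi> (G0P_class A M) = G0P_class B (nonproj_image B \<alpha> M)"
  using stable_equivalence.G0P_iso[OF stable_equivalence.intro[OF assms(1,2,5)] assms(6,7)] .

end
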